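(* Let $\mathcal{A}=(A_1,\ldots,A_d)$ be a $d$-tuple of commuting dissipative operators on a separable Hilbert space $\mathcal{H}$. If $\mathcal{A}$ has the dissipative embedding property, then the semigroup of contractions $t\mapsto e^{i\sum_{j=1}^d t_jA_j}$, $t\in\mathbb{R}^d_{\ge 0}$, generated by $\mathcal{A}$ admits a commutative unitary dilation.
   Context: All operators are bounded. An operator $A$ is dissipative if $\frac{1}{2i}(A-A^* )\ge 0$. Vessel. Let $A_1,\ldots,A_d$ be commuting bounded operators on a separable Hilbert space $\mathcal{H}$. A (Livsic commutative operator) vessel into which $(A_1,\ldots,A_d)$ is embedded is a collection $\mathfrak{V}=(\mathcal{H},\mathcal{E},\Phi,\{A_j\},\{\sigma_j\},\{\gamma_{jk}\},\{\gamma_{*jk}\})$, where $\mathcal{E}$ is a separable Hilbert space, $\Phi:\mathcal{H}\to\mathcal{E}$ is bounded, and $\sigma_j,\gamma_{jk},\gamma_{*jk}$ ($j,k=1,\ldots,d$) are bounded selfadjoint operators on $\mathcal{E}$ such that for all $j,k$: $A_k-A_k^*=i\Phi^*\sigma_k\Phi$; $\gamma_{jk}=-\gamma_{kj}$, $\gamma_{*jk}=-\gamma_{*kj}$; $\sigma_j\Phi A_k^*-\sigma_k\Phi A_j^*=\gamma_{jk}\Phi$; $\sigma_j\Phi A_k-\sigma_k\Phi A_j=\gamma_{*jk}\Phi$; $\gamma_{*jk}-\gamma_{jk}=i(\sigma_j\Phi\Phi^*\sigma_k-\sigma_k\Phi\Phi^*\sigma_j)$. VR conditions. For $T=(T_{ij})\in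 \mathrm{GL}_d(\mathbb{R})$ put $\sigma_j^T=\sum_i T_{ij}\sigma_i$ and $\gamma_{jk}^T=\sum_{i,l}T_{ij}T_{lk}\gamma_{il}$. The vessel satisfies the VR (very reasonable) conditions if for some $T\in \mathrm{GL}_d(\mathbb{R})$ the operator $\sigma_1^T$ is invertible and, writing $s_j=\sigma_j^T$, $g_{jk}=\gamma_{jk}^T$, for all $j,k=2,\ldots,d$: $[s_1^{-1}s_j,s_1^{-1}s_k]=0$; $[s_1^{-1}g_{1j},s_1^{-1}g_{1k}]=0$; $[s_1^{-1}s_k,s_1^{-1}g_{1j}]=[s_1^{-1}s_j,s_1^{-1}g_{1k}]$; $g_{jk}=s_js_1^{-1}g_{1k}-s_ks_1^{-1}g_{1j}$. (These are the VR conditions in the direction $Te_1$.) Positive cone. $\mathrm{Pos}(\mathfrak{V})=\{\xi\in\mathbb{R}^d:\exists\,\epsilon>0,\ \sum_j\xi_j\sigma_j>\epsilon I_{\mathcal{E}}\}$. Dissipative embedding property. $\mathcal{A}$ has it if $\mathcal{A}$ can be embedded in a vessel $\mathfrak{V}$ satisfying the VR conditions, with $\mathrm{Pos}(\mathfrak{V})\ne\emptyset$ and with every standard basis vector $e_j\in\overline{\mathrm{Pos}(\mathfrak{V})}$, $j=1,\ldots,d$. Commutative unitary dilation. A Hilbert space $\mathcal{K}$, an isometry $\iota:\mathcal{H}\to\mathcal{K}$ and a (strongly continuous) unitary representation $\rho$ of the group $\mathbb{R}^d$ on $\mathcal{K}$ such that $\iota^*\rho(t)\iota=e^{i\sum_j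 t_jA_j}$ for all $t$ in the parameter set of the semigroup (here $\mathbb{R}^d_{\ge0}$). *)

theory Defs
  imports "HOL-Analysis.Analysis" "HOL-Library.Complex_Order"
begin

section \<open>Complex Hilbert spaces\<close>

class scaleC = fixes scaleC :: "complex \<Rightarrow> 'a \<Rightarrow> 'a" (infixr \<open>*\<^sub>C\<close> 75)

class complex_vector = real_vector + scaleC +
  assumes scaleC_add_right: "c *\<^sub>C (x + y) = c *\<^sub>C x + c *\<^sub>C y"
    and scaleC_add_left: "(b + c) *\<^sub>C x = b *\<^sub>C x + c *\<^sub>C x"
    and scaleC_scaleC [simp]: "b *\<^sub>C c *\<^sub>C x = (b * c) *\<^sub>C x"
    and scaleR_scaleC: "r *\<^sub>R x = of_real r *\<^sub>C x"

text \<open>The inner product is linear in the first argument.  Its real part is the inner product of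
  the underlying real inner product space, so that norm and topology are those of the library.\<close>

class complex_inner = real_inner + complex_vector +
  fixes cinner :: "'a \<Rightarrow> 'a \<Rightarrow> complex"
  assumes cinner_commute: "cinner x y = cnj (cinner y x)"
    and cinner_add_left: "cinner (x + y) z = cinner x z + cinner y z"
    and cinner_scaleC_left: "cinner (c *\<^sub>C x) y = c * cinner x y"
    and inner_eq_Re_cinner: "inner x y = Re (cinner x y)"

class chilbert_space = complex_inner + complete_space

lemma cinner_self: "cinner x x = of_real ((norm (x::'a::complex_inner))\<^sup>2)"
proof -
  have "Im (cinner x x) = 0"
    using arg_cong[OF cinner_commute[of x x], of Im] by simp
  then show ?thesis
    by (simp add: complex_eq_iff power2_norm_eq_inner inner_eq_Re_cinner)
qed

lemma norm_scaleC: "norm (c *\<^sub>C (x::'a::complex_inner)) = cmod c * norm x"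
proof -
  have "cinner (c *\<^sub>C x) (c *\<^sub>C x) = (c * cnj c) * cinner x x"
    by (metis cinner_commute cinner_scaleC_left complex_cnj_mult mult.assoc mult.left_commute)
  then have "complex_of_real ((norm (c *\<^sub>C x))\<^sup>2) = of_real ((cmod c * norm x)\<^sup>2)"
    unfolding cinner_self complex_norm_square[symmetric] power_mult_distrib of_real_mult .
  then have "(norm (c *\<^sub>C x))\<^sup>2 = (cmod c * norm x)\<^sup>2"
    by (simp only: of_real_eq_iff)
  then show ?thesis
    by simp
qed

section \<open>Bounded operators\<close>

definition bounded_clinear :: "('a::complex_inner \<Rightarrow> 'b::complex_inner) \<Rightarrow> bool" where
  "bounded_clinear f \<longleftrightarrow> bounded_linear f \<and> (\<forall>c x. f (c *\<^sub>C x) = c *\<^sub>C f x)"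

lemma bounded_clinear_scaleC:
  assumes "bounded_clinear f" shows "bounded_clinear (\<lambda>x. c *\<^sub>C f x)"
proof -
  interpret f: bounded_linear f
    using assms by (simp add: bounded_clinear_def)
  have "bounded_linear (\<lambda>x. c *\<^sub>C f x)"
  proof (rule bounded_linear_intro)
    show "norm (c *\<^sub>C f x) \<le> norm x * (cmod c * onorm f)" for x
      using mult_left_mono[OF onorm[OF f.bounded_linear_axioms, of x], of "cmod c"]
      by (simp add: norm_scaleC mult_ac)
  qed (use assms in \<open>auto simp: bounded_clinear_def f.add scaleC_add_right scaleR_scaleC mult.commute\<close>)
  then show ?thesis
    using assms by (simp add: bounded_clinear_def mult.commute)
qed

typedef (overloaded) ('a, 'b) cblinfun (\<open>(_ \<Rightarrow>\<^sub>C\<^sub>L /_)\<close> [22, 21] 21) =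
  "{f :: 'a::complex_inner \<Rightarrow> 'b::complex_inner. bounded_clinear f}"
  morphisms cblinfun_apply CBlinfun
  by (rule exI[of _ "\<lambda>_. 0"]) (use scaleC_add_right[of _ "0::'b" 0] in \<open>auto simp: bounded_clinear_def\<close>)

setup_lifting type_definition_cblinfun

notation cblinfun_apply (infixr \<open>*\<^sub>V\<close> 72)

lift_definition id_cblinfun :: "'a::complex_inner \<Rightarrow>\<^sub>C\<^sub>L 'a" is "\<lambda>x. x"
  by (simp add: bounded_clinear_def bounded_linear_ident)

lift_definition cblinfun_compose ::
  "('b::complex_inner \<Rightarrow>\<^sub>C\<^sub>L 'c::complex_inner) \<Rightarrow> ('a::complex_inner \<Rightarrow>\<^sub>C\<^sub>L 'b) \<Rightarrow> ('a \<Rightarrow>\<^sub>C\<^sub>L 'c)"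
  (infixl \<open>o\<^sub>C\<^sub>L\<close> 71) is "\<lambda>f g x. f (g x)"
  by (auto simp: bounded_clinear_def intro: bounded_linear_compose)

instantiation cblinfun :: (complex_inner, complex_inner) real_normed_vector
begin

lift_definition norm_cblinfun :: "('a \<Rightarrow>\<^sub>C\<^sub>L 'b) \<Rightarrow> real" is onorm .

lift_definition minus_cblinfun :: "('a \<Rightarrow>\<^sub>C\<^sub>L 'b) \<Rightarrow> ('a \<Rightarrow>\<^sub>C\<^sub>L 'b) \<Rightarrow> ('a \<Rightarrow>\<^sub>C\<^sub>L 'b)"
  is "\<lambda>f g x. f x - g x"
proof -
  fix f g :: "'a \<Rightarrow> 'b" assume fg: "bounded_clinear f" "bounded_clinear g"
  have "c *\<^sub>C (x - y) = c *\<^sub>C x - c *\<^sub>C y" for c and x y :: 'b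
    using scaleC_add_right[of c "x - y" y] by (simp add: algebra_simps)
  with fg show "bounded_clinear (\<lambda>x. f x - g x)"
    by (auto simp: bounded_clinear_def intro: bounded_linear_sub)
qed

lift_definition uminus_cblinfun :: "('a \<Rightarrow>\<^sub>C\<^sub>L 'b) \<Rightarrow> ('a \<Rightarrow>\<^sub>C\<^sub>L 'b)" is "\<lambda>f x. - f x"
proof -
  fix f :: "'a \<Rightarrow> 'b" assume "bounded_clinear f"
  from bounded_clinear_scaleC[OF this, of "-1"] show "bounded_clinear (\<lambda>x. - f x)"
    using scaleR_scaleC[of "-1", where 'a='b] by (simp flip: scaleR_scaleC)
qed

lift_definition zero_cblinfun :: "'a \<Rightarrow>\<^sub>C\<^sub>L 'b" is "\<lambda>x. 0"
  using scaleC_add_right[of _ "0::'b" 0] by (auto simp: bounded_clinear_def)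

lift_definition plus_cblinfun :: "('a \<Rightarrow>\<^sub>C\<^sub>L 'b) \<Rightarrow> ('a \<Rightarrow>\<^sub>C\<^sub>L 'b) \<Rightarrow> ('a \<Rightarrow>\<^sub>C\<^sub>L 'b)"
  is "\<lambda>f g x. f x + g x"
  by (auto simp: bounded_clinear_def scaleC_add_right intro: bounded_linear_add)

lift_definition scaleR_cblinfun :: "real \<Rightarrow> ('a \<Rightarrow>\<^sub>C\<^sub>L 'b) \<Rightarrow> ('a \<Rightarrow>\<^sub>C\<^sub>L 'b)" is "\<lambda>r f x. r *\<^sub>R f x"
  by (simp add: scaleR_scaleC bounded_clinear_scaleC)

definition dist_cblinfun :: "('a \<Rightarrow>\<^sub>C\<^sub>L 'b) \<Rightarrow> ('a \<Rightarrow>\<^sub>C\<^sub>L 'b) \<Rightarrow> real"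
  where "dist_cblinfun a b = norm (a - b)"

definition uniformity_cblinfun :: "(('a \<Rightarrow>\<^sub>C\<^sub>L 'b) \<times> ('a \<Rightarrow>\<^sub>C\<^sub>L 'b)) filter" where
  "uniformity_cblinfun = (INF e\<in>{0 <..}. principal {(x, y). dist x y < e})"

definition open_cblinfun :: "('a \<Rightarrow>\<^sub>C\<^sub>L 'b) set \<Rightarrow> bool" where
  "open_cblinfun S = (\<forall>x\<in>S. \<forall>\<^sub>F (x', y) in uniformity. x' = x \<longrightarrow> y \<in> S)"

definition sgn_cblinfun :: "('a \<Rightarrow>\<^sub>C\<^sub>L 'b) \<Rightarrow> ('a \<Rightarrow>\<^sub>C\<^sub>L 'b)"
  where "sgn_cblinfun x = scaleR (inverse (norm x)) x"

instance
  apply standard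
  unfolding dist_cblinfun_def open_cblinfun_def sgn_cblinfun_def uniformity_cblinfun_def
  apply (rule refl | (transfer, force simp: bounded_clinear_def onorm_triangle onorm_scaleR
        onorm_eq_0 algebra_simps))+
  done

end

instantiation cblinfun :: (complex_inner, complex_inner) complex_vector
begin

lift_definition scaleC_cblinfun :: "complex \<Rightarrow> ('a \<Rightarrow>\<^sub>C\<^sub>L 'b) \<Rightarrow> ('a \<Rightarrow>\<^sub>C\<^sub>L 'b)" is "\<lambda>c f x. c *\<^sub>C f x"
  by (rule bounded_clinear_scaleC)

instance
  by standard (transfer, auto simp: scaleC_add_right scaleC_add_left scaleR_scaleC)+

end

text \<open>On Hilbert spaces the adjoint exists by the Riesz representation theorem.\<close>

definition cadjoint :: "('a::chilbert_space \<Rightarrow>\<^sub>C\<^sub>L 'b::chilbert_space) \<Rightarrow> ('b \<Rightarrow>\<^sub>C\<^sub>L 'a)" where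
  "cadjoint A = (THE B. \<forall>x y. cinner (A *\<^sub>V x) y = cinner x (B *\<^sub>V y))"

definition selfadjoint :: "('a::chilbert_space \<Rightarrow>\<^sub>C\<^sub>L 'a) \<Rightarrow> bool" where
  "selfadjoint A \<longleftrightarrow> cadjoint A = A"

definition commutator :: "('a::chilbert_space \<Rightarrow>\<^sub>C\<^sub>L 'a) \<Rightarrow> ('a \<Rightarrow>\<^sub>C\<^sub>L 'a) \<Rightarrow> ('a \<Rightarrow>\<^sub>C\<^sub>L 'a)" where
  "commutator A B = A o\<^sub>C\<^sub>L B - B o\<^sub>C\<^sub>L A"

definition invertible_op :: "('a::chilbert_space \<Rightarrow>\<^sub>C\<^sub>L 'a) \<Rightarrow> bool" where
  "invertible_op A \<longleftrightarrow> (\<exists>B. A o\<^sub>C\<^sub>L B = id_cblinfun \<and> B o\<^sub>C\<^sub>L A = id_cblinfun)"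

definition inverse_op :: "('a::chilbert_space \<Rightarrow>\<^sub>C\<^sub>L 'a) \<Rightarrow> ('a \<Rightarrow>\<^sub>C\<^sub>L 'a)" where
  "inverse_op A = (THE B. A o\<^sub>C\<^sub>L B = id_cblinfun \<and> B o\<^sub>C\<^sub>L A = id_cblinfun)"

definition unitary_op :: "('a::chilbert_space \<Rightarrow>\<^sub>C\<^sub>L 'a) \<Rightarrow> bool" where
  "unitary_op U \<longleftrightarrow> cadjoint U o\<^sub>C\<^sub>L U = id_cblinfun \<and> U o\<^sub>C\<^sub>L cadjoint U = id_cblinfun"

definition isometry_op :: "('a::chilbert_space \<Rightarrow>\<^sub>C\<^sub>L 'b::chilbert_space) \<Rightarrow> bool" where
  "isometry_op V \<longleftrightarrow> (\<forall>x. norm (V *\<^sub>V x) = norm x)"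

text \<open>In the order of \<^theory>\<open>HOL-Library.Complex_Order\<close>, nonnegative complex numbers are real.\<close>

definition nonneg_op :: "('a::chilbert_space \<Rightarrow>\<^sub>C\<^sub>L 'a) \<Rightarrow> bool" where
  "nonneg_op A \<longleftrightarrow> (\<forall>x. 0 \<le> cinner (A *\<^sub>V x) x)"

definition pos_op :: "('a::chilbert_space \<Rightarrow>\<^sub>C\<^sub>L 'a) \<Rightarrow> bool" where
  "pos_op A \<longleftrightarrow> (\<forall>x. x \<noteq> 0 \<longrightarrow> 0 < cinner (A *\<^sub>V x) x)"

definition dissipative :: "('a::chilbert_space \<Rightarrow>\<^sub>C\<^sub>L 'a) \<Rightarrow> bool" where
  "dissipative A \<longleftrightarrow> nonneg_op ((1 / (2 * \<i>)) *\<^sub>C (A - cadjoint A))"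

text \<open>The series converges in operator norm.  The constant \<^const>\<open>exp\<close> requires a unital normed
  algebra, in which \<open>norm 1 = 1\<close>; this fails for operators on the zero space.\<close>

definition exp_op :: "('a::chilbert_space \<Rightarrow>\<^sub>C\<^sub>L 'a) \<Rightarrow> ('a \<Rightarrow>\<^sub>C\<^sub>L 'a)" where
  "exp_op A = (\<Sum>n. ((\<lambda>B. A o\<^sub>C\<^sub>L B) ^^ n) id_cblinfun /\<^sub>R fact n)"

section \<open>Vessels\<close>

text \<open>The index type \<open>'d\<close> plays the role of \<open>{1,\<dots>,d}\<close>; its order only serves to single out the
  first index.\<close>

definition first :: "'d::{finite,linorder}" where
  "first = Min UNIV"

locale vessel =
  fixes A :: "'d::finite \<Rightarrow> ('h::chilbert_space \<Rightarrow>\<^sub>C\<^sub>L 'h)"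
    and \<Phi> :: "'h \<Rightarrow>\<^sub>C\<^sub>L 'e::chilbert_space"
    and \<sigma> :: "'d \<Rightarrow> ('e \<Rightarrow>\<^sub>C\<^sub>L 'e)"
    and \<gamma> \<gamma>s :: "'d \<Rightarrow> 'd \<Rightarrow> ('e \<Rightarrow>\<^sub>C\<^sub>L 'e)"
  assumes separable_inner: "separable_space (euclidean :: 'h topology)"
    and separable_outer: "separable_space (euclidean :: 'e topology)"
    and commuting: "A j o\<^sub>C\<^sub>L A k = A k o\<^sub>C\<^sub>L A j"
    and selfadjoint_\<sigma>: "selfadjoint (\<sigma> j)"
    and selfadjoint_\<gamma>: "selfadjoint (\<gamma> j k)"
    and selfadjoint_\<gamma>s: "selfadjoint (\<gamma>s j k)"
    and colligation: "A k - cadjoint (A k) = \<i> *\<^sub>C (cadjoint \<Phi> o\<^sub>C\<^sub>L \<sigma> k o\<^sub>C\<^sub>L \<Phi>)"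
    and \<gamma>_antisym: "\<gamma> j k = - \<gamma> k j"
    and \<gamma>s_antisym: "\<gamma>s j k = - \<gamma>s k j"
    and input_compat: "\<sigma> j o\<^sub>C\<^sub>L \<Phi> o\<^sub>C\<^sub>L cadjoint (A k) - \<sigma> k o\<^sub>C\<^sub>L \<Phi> o\<^sub>C\<^sub>L cadjoint (A j) = \<gamma> j k o\<^sub>C\<^sub>L \<Phi>"
    and output_compat: "\<sigma> j o\<^sub>C\<^sub>L \<Phi> o\<^sub>C\<^sub>L A k - \<sigma> k o\<^sub>C\<^sub>L \<Phi> o\<^sub>C\<^sub>L A j = \<gamma>s j k o\<^sub>C\<^sub>L \<Phi>"
    and linkage: "\<gamma>s j k - \<gamma> j k
      = \<i> *\<^sub>C (\<sigma> j o\<^sub>C\<^sub>L \<Phi> o\<^sub>C\<^sub>L cadjoint \<Phi> o\<^sub>C\<^sub>L \<sigma> k - \<sigma> k o\<^sub>C\<^sub>L \<Phi> o\<^sub>C\<^sub>L cadjoint \<Phi> o\<^sub>C\<^sub>L \<sigma> j)"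

definition transform_\<sigma> ::
  "real^'d^'d \<Rightarrow> ('d::finite \<Rightarrow> ('e::chilbert_space \<Rightarrow>\<^sub>C\<^sub>L 'e)) \<Rightarrow> 'd \<Rightarrow> ('e \<Rightarrow>\<^sub>C\<^sub>L 'e)" where
  "transform_\<sigma> T \<sigma> j = (\<Sum>i\<in>UNIV. (T $ i $ j) *\<^sub>R \<sigma> i)"

definition transform_\<gamma> ::
  "real^'d^'d \<Rightarrow> ('d::finite \<Rightarrow> 'd \<Rightarrow> ('e::chilbert_space \<Rightarrow>\<^sub>C\<^sub>L 'e)) \<Rightarrow> 'd \<Rightarrow> 'd \<Rightarrow> ('e \<Rightarrow>\<^sub>C\<^sub>L 'e)" where
  "transform_\<gamma> T \<gamma> j k = (\<Sum>i\<in>UNIV. \<Sum>l\<in>UNIV. (T $ i $ j * T $ l $ k) *\<^sub>R \<gamma> i l)"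

definition VR_conditions_at_first ::
  "('d::{finite,linorder} \<Rightarrow> ('e::chilbert_space \<Rightarrow>\<^sub>C\<^sub>L 'e)) \<Rightarrow> ('d \<Rightarrow> 'd \<Rightarrow> ('e \<Rightarrow>\<^sub>C\<^sub>L 'e)) \<Rightarrow> bool" where
  "VR_conditions_at_first s g \<longleftrightarrow>
     invertible_op (s first) \<and>
     (let r = inverse_op (s first) in
      \<forall>j k. j \<noteq> first \<longrightarrow> k \<noteq> first \<longrightarrow>
        commutator (r o\<^sub>C\<^sub>L s j) (r o\<^sub>C\<^sub>L s k) = 0 \<and>
        commutator (r o\<^sub>C\<^sub>L g first j) (r o\<^sub>C\<^sub>L g first k) = 0 \<and>
        commutator (r o\<^sub>C\<^sub>L s k) (r o\<^sub>C\<^sub>L g first j) = commutator (r o\<^sub>C\<^sub>L s j) (r o\<^sub>C\<^sub>L g first k) \<and>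
        g j k = s j o\<^sub>C\<^sub>L r o\<^sub>C\<^sub>L g first k - s k o\<^sub>C\<^sub>L r o\<^sub>C\<^sub>L g first j)"

definition VR_conditions ::
  "('d::{finite,linorder} \<Rightarrow> ('e::chilbert_space \<Rightarrow>\<^sub>C\<^sub>L 'e)) \<Rightarrow> ('d \<Rightarrow> 'd \<Rightarrow> ('e \<Rightarrow>\<^sub>C\<^sub>L 'e)) \<Rightarrow> bool" where
  "VR_conditions \<sigma> \<gamma> \<longleftrightarrow>
     (\<exists>T. invertible T \<and> VR_conditions_at_first (transform_\<sigma> T \<sigma>) (transform_\<gamma> T \<gamma>))"

definition positive_cone :: "('d::finite \<Rightarrow> ('e::chilbert_space \<Rightarrow>\<^sub>C\<^sub>L 'e)) \<Rightarrow> (real^'d) set" where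
  "positive_cone \<sigma> =
     {\<xi>. \<exists>\<epsilon>>0. pos_op ((\<Sum>j\<in>UNIV. (\<xi> $ j) *\<^sub>R \<sigma> j) - \<epsilon> *\<^sub>R id_cblinfun)}"

text \<open>The external space of the vessel is passed as a type argument, since HOL has no
  quantification over types inside formulas.\<close>

definition dissipative_embedding_property ::
  "'e::chilbert_space itself \<Rightarrow> ('d::{finite,linorder} \<Rightarrow> ('h::chilbert_space \<Rightarrow>\<^sub>C\<^sub>L 'h)) \<Rightarrow> bool" where
  "dissipative_embedding_property _ A \<longleftrightarrow>
     (\<exists>(\<Phi> :: 'h \<Rightarrow>\<^sub>C\<^sub>L 'e) \<sigma> \<gamma> \<gamma>s. vessel A \<Phi> \<sigma> \<gamma> \<gamma>s \<and> VR_conditions \<sigma> \<gamma> \<and>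
        positive_cone \<sigma> \<noteq> {} \<and> (\<forall>j. axis j 1 \<in> closure (positive_cone \<sigma>)))"

section \<open>Semigroups and dilations\<close>

definition generated_semigroup ::
  "('d::finite \<Rightarrow> ('h::chilbert_space \<Rightarrow>\<^sub>C\<^sub>L 'h)) \<Rightarrow> real^'d \<Rightarrow> ('h \<Rightarrow>\<^sub>C\<^sub>L 'h)" where
  "generated_semigroup A t = exp_op (\<i> *\<^sub>C (\<Sum>j\<in>UNIV. (t $ j) *\<^sub>R A j))"

definition unitary_representation :: "(real^'d::finite \<Rightarrow> ('k::chilbert_space \<Rightarrow>\<^sub>C\<^sub>L 'k)) \<Rightarrow> bool" where
  "unitary_representation \<rho> \<longleftrightarrow>
     (\<forall>t. unitary_op (\<rho> t)) \<and> \<rho> 0 = id_cblinfun \<and> (\<forall>s t. \<rho> (s + t) = \<rho> s o\<^sub>C\<^sub>L \<rho> t) \<and>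
     (\<forall>x. continuous_on UNIV (\<lambda>t. \<rho> t *\<^sub>V x))"

definition commutative_unitary_dilation ::
  "(real^'d::finite \<Rightarrow> ('h::chilbert_space \<Rightarrow>\<^sub>C\<^sub>L 'h)) \<Rightarrow> ('h \<Rightarrow>\<^sub>C\<^sub>L 'k::chilbert_space) \<Rightarrow>
    (real^'d \<Rightarrow> ('k \<Rightarrow>\<^sub>C\<^sub>L 'k)) \<Rightarrow> bool" where
  "commutative_unitary_dilation S \<iota> \<rho> \<longleftrightarrow>
     isometry_op \<iota> \<and> unitary_representation \<rho> \<and>
     (\<forall>t. (\<forall>j. 0 \<le> t $ j) \<longrightarrow> cadjoint \<iota> o\<^sub>C\<^sub>L \<rho> t o\<^sub>C\<^sub>L \<iota> = S t)"

section \<open>The space of square-summable sequences\<close>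

text \<open>A concrete Hilbert space for the existential statement about dilation spaces.  Any unitary
  dilation of a strongly continuous semigroup on a separable space restricts to a separable
  subspace, and becomes one on \<open>ell2\<close> after adding a trivial representation as a direct summand.\<close>

typedef ell2 = "{f :: nat \<Rightarrow> complex. summable (\<lambda>n. (cmod (f n))\<^sup>2)}"
  morphisms ell2_nth Ell2
  by (rule exI[of _ "\<lambda>_. 0"]) simp

setup_lifting type_definition_ell2

lemma summable_sq_ell2_nth: "summable (\<lambda>n. (cmod (ell2_nth x n))\<^sup>2)"
  using ell2_nth[of x] by simp

lemma summable_mult_cnj:
  assumes "summable (\<lambda>n. (cmod (f n))\<^sup>2)" "summable (\<lambda>n. (cmod (g n))\<^sup>2)"
  shows "summable (\<lambda>n. f n * cnj (g n))"
proof (rule summable_comparison_test)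
  show "\<exists>N. \<forall>n\<ge>N. norm (f n * cnj (g n)) \<le> (cmod (f n))\<^sup>2 + (cmod (g n))\<^sup>2"
  proof (intro exI allI impI)
    fix n :: nat
    have "0 \<le> (cmod (f n) - cmod (g n))\<^sup>2" "0 \<le> cmod (f n) * cmod (g n)"
      by simp_all
    then show "norm (f n * cnj (g n)) \<le> (cmod (f n))\<^sup>2 + (cmod (g n))\<^sup>2"
      unfolding norm_mult complex_mod_cnj power2_diff by linarith
  qed
qed (intro summable_add assms)

lemma summable_sq_add:
  assumes "summable (\<lambda>n. (cmod (f n))\<^sup>2)" "summable (\<lambda>n. (cmod (g n))\<^sup>2)"
  shows "summable (\<lambda>n. (cmod (f n + g n))\<^sup>2)"
proof (rule summable_comparison_test)
  show "\<exists>N. \<forall>n\<ge>N. norm ((cmod (f n + g n))\<^sup>2) \<le> 2 * (cmod (f n))\<^sup>2 + 2 * (cmod (g n))\<^sup>2"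
  proof (intro exI allI impI)
    fix n :: nat
    have "(cmod (f n + g n))\<^sup>2 \<le> (cmod (f n) + cmod (g n))\<^sup>2"
      by (simp add: norm_triangle_ineq power_mono)
    moreover have "0 \<le> (cmod (f n) - cmod (g n))\<^sup>2"
      by simp
    ultimately show "norm ((cmod (f n + g n))\<^sup>2) \<le> 2 * (cmod (f n))\<^sup>2 + 2 * (cmod (g n))\<^sup>2"
      by (simp add: power2_diff power2_sum)
  qed
qed (intro summable_add summable_mult assms)

lemma summable_sq_mult:
  assumes "summable (\<lambda>n. (cmod (f n))\<^sup>2)"
  shows "summable (\<lambda>n. (cmod (c * f n))\<^sup>2)"
  using assms by (simp add: norm_mult power_mult_distrib)

instantiation ell2 :: complex_inner
begin

lift_definition zero_ell2 :: ell2 is "\<lambda>_. 0" by simp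

lift_definition plus_ell2 :: "ell2 \<Rightarrow> ell2 \<Rightarrow> ell2" is "\<lambda>f g n. f n + g n"
  by (rule summable_sq_add)

lift_definition uminus_ell2 :: "ell2 \<Rightarrow> ell2" is "\<lambda>f n. - f n" by simp

lift_definition minus_ell2 :: "ell2 \<Rightarrow> ell2 \<Rightarrow> ell2" is "\<lambda>f g n. f n - g n"
proof -
  fix f g :: "nat \<Rightarrow> complex"
  assume "summable (\<lambda>n. (cmod (f n))\<^sup>2)" "summable (\<lambda>n. (cmod (g n))\<^sup>2)"
  then show "summable (\<lambda>n. (cmod (f n - g n))\<^sup>2)"
    using summable_sq_add[of f "\<lambda>n. - g n"] by simp
qed

lift_definition scaleC_ell2 :: "complex \<Rightarrow> ell2 \<Rightarrow> ell2" is "\<lambda>c f n. c * f n"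
  by (rule summable_sq_mult)

lift_definition scaleR_ell2 :: "real \<Rightarrow> ell2 \<Rightarrow> ell2" is "\<lambda>r f n. of_real r * f n"
  by (rule summable_sq_mult)

lift_definition cinner_ell2 :: "ell2 \<Rightarrow> ell2 \<Rightarrow> complex" is "\<lambda>f g. \<Sum>n. f n * cnj (g n)" .

definition inner_ell2 :: "ell2 \<Rightarrow> ell2 \<Rightarrow> real" where
  "inner_ell2 x y = Re (cinner x y)"

definition norm_ell2 :: "ell2 \<Rightarrow> real" where
  "norm_ell2 x = sqrt (inner x x)"

definition dist_ell2 :: "ell2 \<Rightarrow> ell2 \<Rightarrow> real" where
  "dist_ell2 x y = norm (x - y)"

definition uniformity_ell2 :: "(ell2 \<times> ell2) filter" where
  "uniformity_ell2 = (INF e\<in>{0 <..}. principal {(x, y). dist x y < e})"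

definition open_ell2 :: "ell2 set \<Rightarrow> bool" where
  "open_ell2 S = (\<forall>x\<in>S. \<forall>\<^sub>F (x', y) in uniformity. x' = x \<longrightarrow> y \<in> S)"

definition sgn_ell2 :: "ell2 \<Rightarrow> ell2" where
  "sgn_ell2 x = scaleR (inverse (norm x)) x"

instance
proof
  fix a b c :: complex and r s :: real and x y z :: ell2
  show "x + y + z = x + (y + z)" "x + y = y + x" "0 + x = x" "- x + x = 0" "x - y = x + - y"
    by (transfer, simp add: algebra_simps)+
  show "r *\<^sub>R (x + y) = r *\<^sub>R x + r *\<^sub>R y" "(r + s) *\<^sub>R x = r *\<^sub>R x + s *\<^sub>R x"
    "r *\<^sub>R s *\<^sub>R x = (r * s) *\<^sub>R x" "1 *\<^sub>R x = x"
    by (transfer, simp add: algebra_simps)+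
  show "c *\<^sub>C (x + y) = c *\<^sub>C x + c *\<^sub>C y" "(b + c) *\<^sub>C x = b *\<^sub>C x + c *\<^sub>C x"
    "b *\<^sub>C c *\<^sub>C x = (b * c) *\<^sub>C x" "r *\<^sub>R x = complex_of_real r *\<^sub>C x"
    by (transfer, simp add: algebra_simps)+
  show comm: "cinner x y = cnj (cinner y x)" for x y :: ell2
  proof transfer
    fix f g :: "nat \<Rightarrow> complex"
    assume "summable (\<lambda>n. (cmod (f n))\<^sup>2)" "summable (\<lambda>n. (cmod (g n))\<^sup>2)"
    then have "(\<lambda>n. cnj (g n * cnj (f n))) sums cnj (\<Sum>n. g n * cnj (f n))"
      by (simp only: sums_cnj) (intro summable_sums summable_mult_cnj)
    then show "(\<Sum>n. f n * cnj (g n)) = cnj (\<Sum>n. g n * cnj (f n))"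
      by (simp add: sums_iff mult.commute)
  qed
  show add: "cinner (x + y) z = cinner x z + cinner y z"
    by transfer (simp add: distrib_right suminf_add summable_mult_cnj)
  show scl: "cinner (c *\<^sub>C x) y = c * cinner x y"
    by transfer (simp add: mult.assoc suminf_mult summable_mult_cnj)
  show "inner x y = Re (cinner x y)"
    by (rule inner_ell2_def)
  show "inner x y = inner y x"
    unfolding inner_ell2_def by (subst comm) simp
  show "inner (x + y) z = inner x z + inner y z"
    by (simp add: inner_ell2_def add)
  show "inner (r *\<^sub>R x) y = r * inner x y"
    unfolding inner_ell2_def by transfer (simp add: mult.assoc suminf_mult summable_mult_cnj)
  have sq: "inner x x = (\<Sum>n. (cmod (ell2_nth x n))\<^sup>2)"
    using summable_sq_ell2_nth[of x]
    by (simp add: inner_ell2_def cinner_ell2.rep_eq complex_norm_square[symmetric]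
        suminf_of_real[symmetric] flip: of_real_power)
  show "0 \<le> inner x x"
    unfolding sq by (intro suminf_nonneg summable_sq_ell2_nth) simp
  show "inner x x = 0 \<longleftrightarrow> x = 0"
    unfolding sq by (subst suminf_eq_zero_iff[OF summable_sq_ell2_nth])
      (auto simp: ell2_nth_inject[symmetric] zero_ell2.rep_eq fun_eq_iff)
  show "norm x = sqrt (inner x x)"
    by (rule norm_ell2_def)
qed (rule dist_ell2_def uniformity_ell2_def open_ell2_def sgn_ell2_def)+

end

lemma norm_ell2_sq: "(norm x)\<^sup>2 = (\<Sum>n. (cmod (ell2_nth x n))\<^sup>2)"
  using summable_sq_ell2_nth[of x]
  by (simp add: power2_norm_eq_inner inner_ell2_def cinner_ell2.rep_eq
      complex_norm_square[symmetric] suminf_of_real[symmetric] flip: of_real_power)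

lemma sum_le_norm_ell2: "(\<Sum>n<N. (cmod (ell2_nth x n))\<^sup>2) \<le> (norm x)\<^sup>2"
  unfolding norm_ell2_sq by (intro sum_le_suminf summable_sq_ell2_nth) auto

lemma cmod_ell2_nth_le: "cmod (ell2_nth x n) \<le> norm x"
proof -
  have "(cmod (ell2_nth x n))\<^sup>2 \<le> (\<Sum>k<Suc n. (cmod (ell2_nth x k))\<^sup>2)"
    by (rule member_le_sum) auto
  also have "\<dots> \<le> (norm x)\<^sup>2"
    by (rule sum_le_norm_ell2)
  finally show ?thesis
    by (rule power2_le_imp_le) simp
qed

instance ell2 :: chilbert_space
proof
  fix X :: "nat \<Rightarrow> ell2" assume X: "Cauchy X"
  have "Cauchy (\<lambda>m. ell2_nth (X m) k)" for k
  proof (rule CauchyI)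
    fix e :: real assume "0 < e"
    then obtain M where "\<forall>m\<ge>M. \<forall>n\<ge>M. norm (X m - X n) < e"
      using X CauchyD by blast
    then show "\<exists>M. \<forall>m\<ge>M. \<forall>n\<ge>M. norm (ell2_nth (X m) k - ell2_nth (X n) k) < e"
      by (metis cmod_ell2_nth_le minus_ell2.rep_eq order_le_less_trans)
  qed
  then obtain f where f: "\<And>k. (\<lambda>m. ell2_nth (X m) k) \<longlonglongrightarrow> f k"
    unfolding Cauchy_convergent_iff convergent_def by metis
  have tail: "\<exists>M. \<forall>m\<ge>M. \<forall>N. (\<Sum>k<N. (cmod (ell2_nth (X m) k - f k))\<^sup>2) \<le> e\<^sup>2" if "0 < e" for e :: real
  proof -
    obtain M where M: "\<forall>m\<ge>M. \<forall>n\<ge>M. norm (X m - X n) < e"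
      using X \<open>0 < e\<close> CauchyD by blast
    show ?thesis
    proof (intro exI allI impI)
      fix m N assume m: "M \<le> m"
      have "(\<lambda>n. \<Sum>k<N. (cmod (ell2_nth (X m) k - ell2_nth (X n) k))\<^sup>2)
          \<longlonglongrightarrow> (\<Sum>k<N. (cmod (ell2_nth (X m) k - f k))\<^sup>2)"
        by (intro tendsto_intros f)
      moreover have "(\<Sum>k<N. (cmod (ell2_nth (X m) k - ell2_nth (X n) k))\<^sup>2) \<le> e\<^sup>2" if "M \<le> n" for n
      proof -
        have "(\<Sum>k<N. (cmod (ell2_nth (X m) k - ell2_nth (X n) k))\<^sup>2) \<le> (norm (X m - X n))\<^sup>2"
          using sum_le_norm_ell2[of "X m - X n" N] by (simp add: minus_ell2.rep_eq)
        also have "\<dots> \<le> e\<^sup>2"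
          using M m that by (intro power_mono) (auto intro: less_imp_le)
        finally show ?thesis .
      qed
      ultimately show "(\<Sum>k<N. (cmod (ell2_nth (X m) k - f k))\<^sup>2) \<le> e\<^sup>2"
        using LIMSEQ_le_const2 by blast
    qed
  qed
  have diff: "summable (\<lambda>k. (cmod (ell2_nth (X m) k - f k))\<^sup>2)"
    if "\<forall>N. (\<Sum>k<N. (cmod (ell2_nth (X m) k - f k))\<^sup>2) \<le> e" for m e
    by (rule bounded_imp_summable[of _ e], simp)
      (simp only: lessThan_Suc_atMost[symmetric] that[rule_format])
  obtain m where "\<forall>N. (\<Sum>k<N. (cmod (ell2_nth (X m) k - f k))\<^sup>2) \<le> 1\<^sup>2"
    using tail[of 1] by auto
  from summable_sq_add[OF summable_sq_ell2_nth[of "X m"] summable_sq_mult[OF diff[OF this], of "-1"]]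
  have fs: "summable (\<lambda>k. (cmod (f k))\<^sup>2)"
    by simp
  define L where "L = Ell2 f"
  have L: "ell2_nth L = f"
    unfolding L_def using fs by (simp add: Ell2_inverse)
  have "X \<longlonglongrightarrow> L"
  proof (rule LIMSEQ_I)
    fix e :: real assume "0 < e"
    then obtain M where M: "\<forall>m\<ge>M. \<forall>N. (\<Sum>k<N. (cmod (ell2_nth (X m) k - f k))\<^sup>2) \<le> (e / 2)\<^sup>2"
      using tail[of "e / 2"] by auto
    have "norm (X m - L) < e" if "M \<le> m" for m
    proof -
      have nth: "ell2_nth (X m - L) k = ell2_nth (X m) k - f k" for k
        by (simp add: minus_ell2.rep_eq L)
      have "(norm (X m - L))\<^sup>2 = (\<Sum>k. (cmod (ell2_nth (X m) k - f k))\<^sup>2)"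
        unfolding norm_ell2_sq nth ..
      also have "\<dots> \<le> (e / 2)\<^sup>2"
        using M that by (intro suminf_le_const diff[of m "(e / 2)\<^sup>2"]) blast+
      finally have "(norm (X m - L))\<^sup>2 \<le> (e / 2)\<^sup>2" .
      then have "norm (X m - L) \<le> e / 2"
        using \<open>0 < e\<close> by (auto intro: power2_le_imp_le[of "norm (X m - L)"])
      then show ?thesis
        using \<open>0 < e\<close> by simp
    qed
    then show "\<exists>no. \<forall>n\<ge>no. norm (X n - L) < e"
      by blast
  qed
  then show "convergent X"
    by (rule convergentI)
qed

end

theory Submission
  imports Defs "HOL-Complex_Analysis.Cauchy_Integral_Formula"
begin

text \<open>Fix \<open>\<xi>\<close> in the positive cone.  By the VR conditions, for each complex \<open>x\<close> the operators
  \<open>D x t = \<sigma>\<^sub>\<xi>\<^sup>-\<^sup>1 (x \<sigma>\<^sub>t + \<gamma>\<^sub>\<xi>\<^sub>t)\<close> commute, and for real \<open>x\<close> they are selfadjoint for the inner product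
  \<open>\<langle>\<sigma>\<^sub>\<xi> u, v\<rangle>\<close>.  Putting \<open>x = - \<i> (1 + z) / (1 - z)\<close> with \<open>|z| = 1\<close> makes \<open>exp (\<i> D x t)\<close> a unitary
  representation of \<open>\<real>\<^sup>d\<close> on the square integrable functions on the circle.  Let \<open>G\<close> be the Cayley
  transform of \<open>A\<^sub>\<xi>\<^sup>*\<close> and map \<open>h\<close> to the series \<open>\<Sum>n. z\<^sup>-\<^sup>n \<Psi> G\<^sup>n h\<close>, where
  \<open>\<parallel>h\<parallel>\<^sup>2 - \<parallel>G h\<parallel>\<^sup>2 = \<langle>\<sigma>\<^sub>\<xi> \<Psi> h, \<Psi> h\<rangle>\<close>.  If \<open>\<sigma>\<^sub>t \<ge> 0\<close>, then \<open>exp (- \<i> D x t)\<close> is bounded and analytic in the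
  disc, and compressing it to such series yields \<open>exp (- \<i> A\<^sub>t\<^sup>*)\<close>.  The map is isometric only up to the form
  \<open>q h h' = lim \<langle>G\<^sup>n h, G\<^sup>n h'\<rangle>\<close>, on which the semigroup acts unitarily.  The two contributions add up to a
  continuous positive definite function on \<open>\<real>\<^sup>d\<close> extending the semigroup.  A Cholesky factorization of its
  kernel over a countable dense set realizes the unitary representation on \<open>\<ell>\<^sup>2\<close>.\<close>

section \<open>Operators on Hilbert spaces\<close>

text \<open>The VR conditions are available in one direction, where \<sigma> is invertible but
  perhaps indefinite, while selfadjointness requires a direction \<xi> of the cone;
  \<open>VR_commuting_pencil\<close> carries commutation from the first to the second. The adjoints
  enter because the input condition, multiplied by the inverse of \<sigma> at \<xi>, says that
  \<Phi> turns \<open>N t\<close>, the combination of the adjoints, into the pencil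
  \<open>D x t\<close> with \<open>N \<xi>\<close> put in place of \<open>x\<close>. The numerical
  range of \<open>N \<xi>\<close> lies in the closed lower half-plane, which
  \<open>half_plane\<close> identifies with the disc. The obstacle is the point
  \<open>z = 1\<close>: the pencil has a pole there, so its powers need not be integrable on the
  circle, and only its exponential stays bounded. Hence the compression formula is proved for powers
  on circles of radius \<rho> < 1, with \<open>G\<close> damped to \<open>r G\<close> and r <
  \<rho>; it is summed to exponentials before \<rho> goes to 1, and only last is r sent to 1.
  Positivity of \<sigma> at t is what permits the passage to \<rho> = 1.\<close>

instance chilbert_space \<subseteq> banach ..

lemma scaleC_zero_right [simp]: "c *\<^sub>C (0::'a::complex_vector) = 0"
  using scaleC_add_right[of c "0::'a" 0] by simp

lemma scaleC_zero_left [simp]: "0 *\<^sub>C (x::'a::complex_vector) = 0"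
  using scaleC_add_left[of 0 0 x] by simp

lemma scaleC_one [simp]: "1 *\<^sub>C (x::'a::complex_vector) = x"
  using scaleR_scaleC[of 1 x] by simp

lemma scaleC_minus_right [simp]: "c *\<^sub>C (- x) = - (c *\<^sub>C (x::'a::complex_vector))"
  using scaleC_add_right[of c x "- x"] by (simp add: eq_neg_iff_add_eq_0 add.commute)

lemma scaleC_minus_left [simp]: "(- c) *\<^sub>C x = - (c *\<^sub>C (x::'a::complex_vector))"
  using scaleC_add_left[of c "- c" x] by (simp add: eq_neg_iff_add_eq_0 add.commute)

lemma scaleC_diff_right: "c *\<^sub>C (x - y) = c *\<^sub>C x - c *\<^sub>C (y::'a::complex_vector)"
  using scaleC_add_right[of c x "- y"] by simp

lemma scaleC_diff_left: "(b - c) *\<^sub>C x = b *\<^sub>C x - c *\<^sub>C (x::'a::complex_vector)"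
  using scaleC_add_left[of b "- c" x] by simp

lemma scaleC_sum_right: "c *\<^sub>C (\<Sum>i\<in>I. f i) = (\<Sum>i\<in>I. c *\<^sub>C (f i :: 'a::complex_vector))"
  by (induction I rule: infinite_finite_induct) (auto simp: scaleC_add_right)

lemma scaleC_scaleR: "c *\<^sub>C r *\<^sub>R x = r *\<^sub>R c *\<^sub>C (x::'a::complex_vector)"
  by (simp add: scaleR_scaleC mult.commute)

lemma cinner_zero_left [simp]: "cinner 0 x = 0"
  using cinner_add_left[of 0 0 x] by simp

lemma cinner_zero_right [simp]: "cinner x 0 = 0"
  by (subst cinner_commute) simp

lemma cinner_add_right: "cinner x (y + z) = cinner x y + cinner x z"
  by (metis cinner_add_left cinner_commute complex_cnj_add)

lemma cinner_scaleC_right: "cinner x (c *\<^sub>C y) = cnj c * cinner x y"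
  by (metis cinner_commute cinner_scaleC_left complex_cnj_mult)

lemma cinner_minus_left [simp]: "cinner (- x) y = - cinner x y"
  using cinner_add_left[of x "- x" y] by (simp add: eq_neg_iff_add_eq_0 add.commute)

lemma cinner_minus_right [simp]: "cinner x (- y) = - cinner x y"
  using cinner_add_right[of x y "- y"] by (simp add: eq_neg_iff_add_eq_0 add.commute)

lemma cinner_diff_left: "cinner (x - y) z = cinner x z - cinner y z"
  using cinner_add_left[of x "- y" z] by simp

lemma cinner_diff_right: "cinner x (y - z) = cinner x y - cinner x z"
  using cinner_add_right[of x y "- z"] by simp

lemma cinner_scaleR_left [simp]: "cinner (r *\<^sub>R x) y = of_real r * cinner x y"
  by (simp add: scaleR_scaleC cinner_scaleC_left)

lemma cinner_scaleR_right [simp]: "cinner x (r *\<^sub>R y) = of_real r * cinner x y"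
  by (simp add: scaleR_scaleC cinner_scaleC_right)

lemma cinner_sum_left: "cinner (\<Sum>i\<in>I. f i) y = (\<Sum>i\<in>I. cinner (f i) y)"
  by (induction I rule: infinite_finite_induct) (auto simp: cinner_add_left)

lemma cinner_sum_right: "cinner y (\<Sum>i\<in>I. f i) = (\<Sum>i\<in>I. cinner y (f i))"
  by (induction I rule: infinite_finite_induct) (auto simp: cinner_add_right)

lemmas cinner_simps = cinner_add_left cinner_add_right cinner_diff_left cinner_diff_right
  cinner_scaleC_left cinner_scaleC_right

lemma cmod_cinner_le: "cmod (cinner x y) \<le> norm x * norm y"
proof (cases "cinner x y = 0")
  case False
  \<comment> \<open>The phase \<open>c\<close> turns the complex product into its modulus, so that
    the real Cauchy-Schwarz inequality applies.\<close>
  define c where "c = cnj (sgn (cinner x y))"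
  have c: "cmod c = 1"
    using False by (simp add: c_def norm_sgn)
  have c2: "c * cinner x y = cmod (cinner x y)"
    using False complex_norm_square[of "cinner x y"]
    by (simp add: c_def sgn_eq power2_eq_square divide_simps mult.commute)
  have "cmod (cinner x y) = inner (c *\<^sub>C x) y"
    by (simp add: inner_eq_Re_cinner cinner_scaleC_left c2)
  also have "\<dots> \<le> norm (c *\<^sub>C x) * norm y"
    by (rule norm_cauchy_schwarz)
  finally show ?thesis
    by (simp add: norm_scaleC c)
qed simp

lemma bounded_bilinear_cinner: "bounded_bilinear cinner"
  by standard (auto simp: cinner_simps scaleR_conv_of_real intro!: exI[of _ 1] cmod_cinner_le)

interpretation cinner: bounded_bilinear cinner
  by (rule bounded_bilinear_cinner)

declare cinner.tendsto [tendsto_intros] cinner.continuous [continuous_intros]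
  cinner.continuous_on [continuous_intros]

lemma cinner_eqI: "(\<And>z. cinner x z = cinner y z) \<Longrightarrow> x = y"
  using cinner_self[of "x - y"] by (simp add: cinner_diff_left)

lemma cinner_eqI_right: "(\<And>z. cinner z x = cinner z y) \<Longrightarrow> x = y"
  by (rule cinner_eqI) (metis cinner_commute)

section \<open>Calculus of bounded operators, Riesz representation, adjoints, coercive
  operators\<close>

lemma bounded_clinear_cblinfun_apply: "bounded_clinear (cblinfun_apply A)"
  using cblinfun_apply[of A] by simp

lemma bounded_linear_cblinfun_apply: "bounded_linear (cblinfun_apply A)"
  using bounded_clinear_cblinfun_apply[of A] by (simp add: bounded_clinear_def)

lemmas cblinfun_add_right = bounded_linear_cblinfun_apply[THEN bounded_linear.linear, THEN linear_add]
  and cblinfun_diff_right = bounded_linear_cblinfun_apply[THEN bounded_linear.linear, THEN linear_diff]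
  and cblinfun_sum_right = bounded_linear_cblinfun_apply[THEN bounded_linear.linear, THEN linear_sum]
  and cblinfun_minus_right [simp] = bounded_linear_cblinfun_apply[THEN bounded_linear.linear, THEN linear_neg]
  and cblinfun_zero_right [simp] = bounded_linear_cblinfun_apply[THEN bounded_linear.linear, THEN linear_0]
  and cblinfun_scaleR_right = bounded_linear_cblinfun_apply[THEN bounded_linear.linear, THEN linear_cmul]

lemma cblinfun_scaleC_right: "A *\<^sub>V (c *\<^sub>C x) = c *\<^sub>C (A *\<^sub>V x)"
  using bounded_clinear_cblinfun_apply[of A] by (simp add: bounded_clinear_def)

lemmas cblinfun_linear = cblinfun_add_right cblinfun_diff_right cblinfun_scaleR_right
  cblinfun_scaleC_right

lemmas cblinfun_rep [simp] = plus_cblinfun.rep_eq minus_cblinfun.rep_eq uminus_cblinfun.rep_eq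
  zero_cblinfun.rep_eq scaleR_cblinfun.rep_eq scaleC_cblinfun.rep_eq id_cblinfun.rep_eq
  cblinfun_compose.rep_eq

lemma cblinfun_sum_left: "(\<Sum>i\<in>I. A i) *\<^sub>V x = (\<Sum>i\<in>I. A i *\<^sub>V x)"
  by (induction I rule: infinite_finite_induct) auto

lemma cblinfun_eqI: "(\<And>x. A *\<^sub>V x = B *\<^sub>V x) \<Longrightarrow> A = B"
  by (metis cblinfun_apply_inject ext)

lemma norm_cblinfun_apply: "norm (A *\<^sub>V x) \<le> norm A * norm x"
  unfolding norm_cblinfun.rep_eq by (rule onorm[OF bounded_linear_cblinfun_apply])

lemma norm_cblinfun_bound: "0 \<le> b \<Longrightarrow> (\<And>x. norm (A *\<^sub>V x) \<le> b * norm x) \<Longrightarrow> norm A \<le> b"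
  unfolding norm_cblinfun.rep_eq by (rule onorm_bound)

lemma norm_cblinfun_compose: "norm (A o\<^sub>C\<^sub>L B) \<le> norm A * norm B"
  unfolding norm_cblinfun.rep_eq cblinfun_compose.rep_eq
  using onorm_compose[OF bounded_linear_cblinfun_apply bounded_linear_cblinfun_apply]
  by (simp add: o_def)

lemma tendsto_cblinfun_apply [tendsto_intros]:
  "(f \<longlongrightarrow> x) F \<Longrightarrow> ((\<lambda>t. A *\<^sub>V f t) \<longlongrightarrow> A *\<^sub>V x) F"
  by (rule bounded_linear.tendsto[OF bounded_linear_cblinfun_apply])

lemma continuous_on_cblinfun_apply [continuous_intros]:
  "continuous_on S f \<Longrightarrow> continuous_on S (\<lambda>t. A *\<^sub>V f t)"
  by (rule bounded_linear.continuous_on[OF bounded_linear_cblinfun_apply])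

lemma CBlinfun_apply:
  assumes "\<And>x y. f (x + y) = f x + f y" "\<And>c x. f (c *\<^sub>C x) = c *\<^sub>C f x"
    and "\<And>x. norm (f x) \<le> K * norm x"
  shows "CBlinfun f *\<^sub>V x = f x"
proof -
  have "bounded_linear f"
    by (rule bounded_linear_intro[of f K]) (use assms in \<open>auto simp: scaleR_scaleC mult.commute\<close>)
  then have "bounded_clinear f"
    using assms by (simp add: bounded_clinear_def)
  then show ?thesis
    by (simp add: CBlinfun_inverse)
qed

text \<open>The representing vector is the minimiser of the functional \<open>J\<close>, which is
  bounded below; the parallelogram law makes every minimising sequence Cauchy.\<close>

lemma riesz_real:
  fixes f :: "'a::{real_inner,complete_space} \<Rightarrow> real"
  assumes "bounded_linear f"
  shows "\<exists>y. \<forall>x. f x = inner x y"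
proof -
  interpret f: bounded_linear f by fact
  define J where "J x = (norm x)\<^sup>2 - 2 * f x" for x
  have J: "inner x x - 2 * f x = J x" for x
    by (simp add: J_def power2_norm_eq_inner)
  have lower: "J x \<ge> - (onorm f)\<^sup>2" for x
  proof -
    have "\<bar>f x\<bar> \<le> onorm f * norm x"
      using onorm[OF assms, of x] by simp
    moreover have "0 \<le> (norm x - onorm f)\<^sup>2" by simp
    ultimately show ?thesis
      unfolding J_def power2_diff by (auto simp: mult.commute)
  qed
  define m where "m = (INF x. J x)"
  have bdd: "bdd_below (range J)"
    using lower by (auto intro!: bdd_belowI)
  have m: "m \<le> J x" for x
    unfolding m_def using bdd by (rule cINF_lower) simp
  have "\<exists>x. J x < m + 1 / real (Suc n)" for n
    using cINF_less_iff[OF _ bdd, of "m + 1 / real (Suc n)"] by (auto simp: m_def[symmetric])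
  then obtain X where X: "\<And>n. J (X n) < m + 1 / real (Suc n)"
    by metis
  \<comment> \<open>The linear parts of \<open>J\<close> cancel in this combination, so the
    parallelogram law survives and near-minimisers are close to each other.\<close>
  have par: "(norm (x - y))\<^sup>2 = 2 * J x + 2 * J y - 4 * J ((1/2) *\<^sub>R (x + y))" for x y
    unfolding J_def power2_norm_eq_inner f.scaleR f.add
    by (simp add: inner_simps inner_commute algebra_simps)
  have "Cauchy X"
  proof (rule CauchyI)
    fix e :: real assume e: "0 < e"
    then obtain M where M: "4 / real (Suc M) < e\<^sup>2"
      using reals_Archimedean[of "e\<^sup>2 / 4"] by (auto simp: field_simps)
    have "norm (X k - X n) < e" if "k \<ge> M" "n \<ge> M" for k n
    proof -
      have "(norm (X k - X n))\<^sup>2 \<le> 2 / real (Suc k) + 2 / real (Suc n)"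
        using par[of "X k" "X n"] X[of k] X[of n] m[of "(1/2) *\<^sub>R (X k + X n)"] by simp
      also have "\<dots> \<le> 2 / real (Suc M) + 2 / real (Suc M)"
        using that by (intro add_mono divide_left_mono) auto
      also have "\<dots> < e\<^sup>2"
        using M by simp
      finally show ?thesis
        using e by (simp add: power2_less_imp_less)
    qed
    then show "\<exists>M. \<forall>m\<ge>M. \<forall>n\<ge>M. norm (X m - X n) < e" by blast
  qed
  then obtain y where y: "X \<longlonglongrightarrow> y"
    using Cauchy_convergent convergent_def by blast
  have "(\<lambda>n. J (X n)) \<longlonglongrightarrow> J y"
    unfolding J_def by (intro tendsto_intros y f.tendsto)
  moreover have "(\<lambda>n. m + 1 / real (Suc n)) \<longlonglongrightarrow> m + 0"
    by (intro tendsto_intros LIMSEQ_Suc lim_1_over_n)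
  ultimately have "J y \<le> m + 0"
    by (rule LIMSEQ_le) (use X less_imp_le in blast)
  then have min: "J y \<le> J z" for z
    using m[of z] by simp
  have "f x = inner x y" for x
  proof (rule ccontr)
    define d where "d = inner x y - f x"
    assume "f x \<noteq> inner x y"
    then have d: "d \<noteq> 0" by (simp add: d_def)
    \<comment> \<open>This is the minimiser of the quadratic in t once the squared norm of x is
      enlarged by 1, which keeps the denominator positive.\<close>
    define t where "t = - d / ((norm x)\<^sup>2 + 1)"
    have pos: "(norm x)\<^sup>2 + 1 > 0"
      by (simp add: add_nonneg_pos)
    have "J (y + t *\<^sub>R x) = J y + t\<^sup>2 * (norm x)\<^sup>2 + 2 * t * d"
      unfolding J_def power2_norm_eq_inner d_def f.add f.scaleR
      by (simp add: inner_simps inner_commute algebra_simps power2_eq_square)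
    then have "0 \<le> t\<^sup>2 * (norm x)\<^sup>2 + 2 * t * d"
      using min[of "y + t *\<^sub>R x"] by simp
    also have "\<dots> \<le> t\<^sup>2 * ((norm x)\<^sup>2 + 1) + 2 * t * d"
      by (simp add: algebra_simps)
    also have "\<dots> = - d\<^sup>2 / ((norm x)\<^sup>2 + 1)"
    proof -
      have "t\<^sup>2 * c + 2 * t * d = - d\<^sup>2 / c" if "c > 0" "t = - d / c" for c :: real
      proof -
        have "d = - (t * c)" using that by simp
        with that show ?thesis by (simp add: power2_eq_square)
      qed
      then show ?thesis using pos t_def by blast
    qed
    also have "\<dots> < 0"
      using d pos by simp
    finally show False by simp
  qed
  then show ?thesis by blast
qed

text \<open>A complex-linear functional is determined by its real part, since the imaginary part at
  x is minus the real part at \<open>\<i> *\<^sub>C x\<close>.\<close>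

lemma riesz_complex:
  fixes f :: "'a::chilbert_space \<Rightarrow> complex"
  assumes "\<And>x y. f (x + y) = f x + f y" "\<And>c x. f (c *\<^sub>C x) = c * f x"
    and "\<And>x. cmod (f x) \<le> K * norm x"
  shows "\<exists>y. \<forall>x. f x = cinner x y"
proof -
  have "bounded_linear (\<lambda>x. Re (f x))"
    by (rule bounded_linear_intro[of _ K])
      (use assms in \<open>auto simp: scaleR_scaleC mult.commute intro: order_trans[OF abs_Re_le_cmod]\<close>)
  from riesz_real[OF this] obtain y where y: "\<And>x. Re (f x) = inner x y"
    by blast
  have "f x = cinner x y" for x
  proof -
    have "Im (f x) = - Re (f (\<i> *\<^sub>C x))"
      by (simp add: assms)
    also have "\<dots> = Im (cinner x y)"
      by (simp only: y) (simp add: inner_eq_Re_cinner cinner_scaleC_left)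
    finally show ?thesis
      using y[of x] by (simp add: complex_eq_iff inner_eq_Re_cinner)
  qed
  then show ?thesis by blast
qed

lemma cadjoint_exists:
  fixes A :: "'a::chilbert_space \<Rightarrow>\<^sub>C\<^sub>L 'b::chilbert_space"
  shows "\<exists>B. \<forall>x y. cinner (A *\<^sub>V x) y = cinner x (B *\<^sub>V y)"
proof -
  have "\<exists>z. \<forall>x. cinner (A *\<^sub>V x) y = cinner x z" for y
  proof (rule riesz_complex)
    show "cmod (cinner (A *\<^sub>V x) y) \<le> (norm A * norm y) * norm x" for x
      using cmod_cinner_le[of "A *\<^sub>V x" y] mult_right_mono[OF norm_cblinfun_apply[of A x], of "norm y"]
      by (simp add: mult_ac)
  qed (simp_all add: cblinfun_linear cinner_simps)
  then obtain B where B: "\<And>x y. cinner (A *\<^sub>V x) y = cinner x (B y)"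
    by metis
  have "CBlinfun B *\<^sub>V y = B y" for y
  proof (rule CBlinfun_apply[where K = "norm A"])
    show "B (x + y) = B x + B y" for x y
      by (rule cinner_eqI_right) (simp add: cinner_simps flip: B)
    show "B (c *\<^sub>C x) = c *\<^sub>C B x" for c x
      by (rule cinner_eqI_right) (simp add: cinner_simps flip: B)
    show "norm (B y) \<le> norm A * norm y" for y
    proof (cases "B y = 0")
      case False
      have "norm (B y) * norm (B y) = cmod (cinner (A *\<^sub>V B y) y)"
        by (simp add: B cinner_self norm_power power2_eq_square norm_mult)
      also have "\<dots> \<le> norm A * norm (B y) * norm y"
        using cmod_cinner_le[of "A *\<^sub>V B y" y] mult_right_mono[OF norm_cblinfun_apply[of A "B y"], of "norm y"]
        by simp
      finally have "norm (B y) * norm (B y) \<le> norm (B y) * (norm A * norm y)"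
        by (simp add: mult_ac)
      then show ?thesis
        using False by simp
    qed simp
  qed
  then show ?thesis
    using B by (metis (lifting))
qed

lemma cinner_cadjoint: "cinner (A *\<^sub>V x) y = cinner x (cadjoint A *\<^sub>V y)"
proof -
  obtain B where B: "\<forall>x y. cinner (A *\<^sub>V x) y = cinner x (B *\<^sub>V y)"
    using cadjoint_exists by blast
  have "\<forall>x y. cinner (A *\<^sub>V x) y = cinner x (cadjoint A *\<^sub>V y)"
    unfolding cadjoint_def
  proof (rule theI[of _ B])
    fix B' assume "\<forall>x y. cinner (A *\<^sub>V x) y = cinner x (B' *\<^sub>V y)"
    with B have "cinner x (B' *\<^sub>V y) = cinner x (B *\<^sub>V y)" for x y
      by metis
    then show "B' = B"
      by (intro cblinfun_eqI cinner_eqI_right)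
  qed (rule B)
  then show ?thesis by blast
qed

lemma cinner_cadjoint_left: "cinner (cadjoint A *\<^sub>V x) y = cinner x (A *\<^sub>V y)"
  using cinner_commute[of "cadjoint A *\<^sub>V x" y] cinner_commute[of x "A *\<^sub>V y"]
  by (simp only: cinner_cadjoint)

lemma cadjoint_eqI: "(\<And>x y. cinner (A *\<^sub>V x) y = cinner x (B *\<^sub>V y)) \<Longrightarrow> cadjoint A = B"
  by (intro cblinfun_eqI cinner_eqI_right) (simp only: cinner_cadjoint[symmetric])

lemma cadjoint_compose: "cadjoint (A o\<^sub>C\<^sub>L B) = cadjoint B o\<^sub>C\<^sub>L cadjoint A"
  by (rule cadjoint_eqI) (simp only: cblinfun_rep cinner_cadjoint)

lemma selfadjoint_cinner: "selfadjoint A \<Longrightarrow> cinner (A *\<^sub>V x) y = cinner x (A *\<^sub>V y)"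
  using cinner_cadjoint[of A x y] by (simp add: selfadjoint_def)

text \<open>The Lax-Milgram argument: a solution of \<open>A x = y\<close> is a fixed point of the
  map sending x to \<open>x - \<alpha> (A x - y)\<close>, and coercivity makes this map a
  contraction for suitable \<alpha>.\<close>

lemma coercive_invertible:
  fixes A :: "'a::chilbert_space \<Rightarrow>\<^sub>C\<^sub>L 'a"
  assumes \<epsilon>: "0 < \<epsilon>" and coercive: "\<And>x. \<epsilon> * (norm x)\<^sup>2 \<le> Re (cinner (A *\<^sub>V x) x)"
  obtains B where "\<And>x. A *\<^sub>V B *\<^sub>V x = x" "\<And>x. B *\<^sub>V A *\<^sub>V x = x" "norm B \<le> 1 / \<epsilon>"
proof -
  have lower: "\<epsilon> * norm x \<le> norm (A *\<^sub>V x)" for x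
  proof (cases "x = 0")
    case False
    have "\<epsilon> * norm x * norm x \<le> norm (A *\<^sub>V x) * norm x"
      using order_trans[OF coercive[of x] order_trans[OF complex_Re_le_cmod cmod_cinner_le]]
      by (simp only: power2_eq_square mult.assoc)
    then show ?thesis
      by (rule mult_right_le_imp_le) (use False in simp)
  qed simp
  \<comment> \<open>The summand \<epsilon> makes \<open>K\<close> positive and at least \<epsilon>,
    so that the square root in \<open>c\<close> is defined. The value of \<alpha> below minimises
    the bound \<open>1 - 2 \<alpha> \<epsilon> + \<alpha>\<^sup>2 K\<^sup>2\<close> for the squared
    contraction factor.\<close>
  define K where "K = norm A + \<epsilon>"
  define \<alpha> where "\<alpha> = \<epsilon> / K\<^sup>2"
  have K: "0 < K" "\<epsilon> \<le> K" "norm A \<le> K"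
    using \<epsilon> by (auto simp: K_def add_nonneg_pos)
  then have \<alpha>: "0 < \<alpha>"
    using \<epsilon> by (simp add: \<alpha>_def)
  have "0 \<le> \<epsilon> / K" "\<epsilon> / K \<le> 1" "0 < \<epsilon> / K"
    using K \<epsilon> by simp_all
  then have sq: "(\<epsilon> / K)\<^sup>2 \<le> 1" "0 < (\<epsilon> / K)\<^sup>2"
    by (simp_all only: power_le_one zero_less_power)
  define c where "c = sqrt (1 - (\<epsilon> / K)\<^sup>2)"
  have c: "0 \<le> c" "c < 1" "c\<^sup>2 = 1 - (\<epsilon> / K)\<^sup>2"
    using sq by (auto simp: c_def)
  have contr: "norm (x - \<alpha> *\<^sub>R (A *\<^sub>V x)) \<le> c * norm x" for x
  proof (rule power2_le_imp_le)
    have "(norm (x - \<alpha> *\<^sub>R (A *\<^sub>V x)))\<^sup>2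
        = (norm x)\<^sup>2 - 2 * \<alpha> * Re (cinner (A *\<^sub>V x) x) + \<alpha>\<^sup>2 * (norm (A *\<^sub>V x))\<^sup>2"
      unfolding power2_norm_eq_inner inner_eq_Re_cinner[symmetric]
      by (simp add: inner_simps inner_commute algebra_simps power2_eq_square)
    also have "\<dots> \<le> (norm x)\<^sup>2 - 2 * \<alpha> * (\<epsilon> * (norm x)\<^sup>2) + \<alpha>\<^sup>2 * (K * norm x)\<^sup>2"
    proof (intro add_mono diff_mono mult_left_mono power_mono)
      show "norm (A *\<^sub>V x) \<le> K * norm x"
        using norm_cblinfun_apply[of A x] mult_right_mono[OF K(3), of "norm x"] by simp
    qed (use coercive[of x] \<alpha> in auto)
    also have "\<dots> = (c * norm x)\<^sup>2"
      using K(1) by (simp add: power_mult_distrib c(3)) (simp add: \<alpha>_def field_simps power2_eq_square)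
    finally show "(norm (x - \<alpha> *\<^sub>R (A *\<^sub>V x)))\<^sup>2 \<le> (c * norm x)\<^sup>2" .
  qed (use c in auto)
  have "\<exists>x. A *\<^sub>V x = y" for y
  proof -
    have "\<exists>!x. x - \<alpha> *\<^sub>R (A *\<^sub>V x) + \<alpha> *\<^sub>R y = x"
    proof (rule banach_fix_type[OF c(1,2)], intro allI)
      show "dist (x - \<alpha> *\<^sub>R (A *\<^sub>V x) + \<alpha> *\<^sub>R y) (x' - \<alpha> *\<^sub>R (A *\<^sub>V x') + \<alpha> *\<^sub>R y) \<le> c * dist x x'" for x x'
        using contr[of "x - x'"] by (simp add: dist_norm cblinfun_linear algebra_simps)
    qed
    then obtain x where "x - \<alpha> *\<^sub>R (A *\<^sub>V x) + \<alpha> *\<^sub>R y = x" by blast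
    then have "\<alpha> *\<^sub>R (y - A *\<^sub>V x) = 0" by (simp add: algebra_simps)
    then show ?thesis using \<alpha> by (intro exI[of _ x]) auto
  qed
  then obtain B where B: "\<And>y. A *\<^sub>V B y = y" by metis
  have inj: "x = y" if "A *\<^sub>V x = A *\<^sub>V y" for x y
    using lower[of "x - y"] that \<epsilon> by (simp add: cblinfun_linear mult_le_0_iff)
  have nB: "norm (B y) \<le> 1 / \<epsilon> * norm y" for y
    using lower[of "B y"] \<epsilon> by (simp add: B field_simps)
  have BA: "CBlinfun B *\<^sub>V y = B y" for y
  proof (rule CBlinfun_apply[where K = "1 / \<epsilon>"])
    show "B (x + y) = B x + B y" "B (c *\<^sub>C x) = c *\<^sub>C B x" for x y c
      by (rule inj, simp add: B cblinfun_linear)+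
  qed (rule nB)
  show thesis
  proof (rule that)
    show "A *\<^sub>V CBlinfun B *\<^sub>V x = x" "CBlinfun B *\<^sub>V A *\<^sub>V x = x" for x
      by (simp_all add: BA B inj[OF B])
    show "norm (CBlinfun B) \<le> 1 / \<epsilon>"
      using nB \<epsilon> by (intro norm_cblinfun_bound) (simp_all only: BA, simp)
  qed
qed

lemma bounded_bilinear_cblinfun_apply: "bounded_bilinear cblinfun_apply"
  by standard (auto simp: cblinfun_linear intro!: exI[of _ 1] norm_cblinfun_apply)

section \<open>The exponential\<close>

text \<open>The library develops \<^const>\<open>exp\<close> in unital Banach algebras.  The summand \<^typ>\<open>real\<close> makes the
  identity have norm one even over the zero space.\<close>

typedef (overloaded) 'a endo = "UNIV :: (('a::banach \<times> real) \<Rightarrow>\<^sub>L ('a \<times> real)) set"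
  morphisms endo_blinfun Endo by simp

setup_lifting type_definition_endo

lemma norm_id_blinfun_prod_real: "norm (id_blinfun :: ('a::real_normed_vector \<times> real) \<Rightarrow>\<^sub>L _) = 1"
proof (rule antisym)
  have "norm (blinfun_apply id_blinfun (0::'a, 1::real)) \<le> norm (id_blinfun :: ('a \<times> real) \<Rightarrow>\<^sub>L _) * norm (0::'a, 1::real)"
    by (rule norm_blinfun)
  then show "1 \<le> norm (id_blinfun :: ('a \<times> real) \<Rightarrow>\<^sub>L _)"
    by (simp add: norm_prod_def)
qed (rule norm_blinfun_id_le)

instantiation endo :: (banach) real_normed_algebra_1
begin

lift_definition zero_endo :: "'a endo" is 0 .
lift_definition one_endo :: "'a endo" is id_blinfun .
lift_definition plus_endo :: "'a endo \<Rightarrow> 'a endo \<Rightarrow> 'a endo" is "(+)" .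
lift_definition minus_endo :: "'a endo \<Rightarrow> 'a endo \<Rightarrow> 'a endo" is "(-)" .
lift_definition uminus_endo :: "'a endo \<Rightarrow> 'a endo" is uminus .
lift_definition times_endo :: "'a endo \<Rightarrow> 'a endo \<Rightarrow> 'a endo" is "(o\<^sub>L)" .
lift_definition scaleR_endo :: "real \<Rightarrow> 'a endo \<Rightarrow> 'a endo" is "(*\<^sub>R)" .
lift_definition norm_endo :: "'a endo \<Rightarrow> real" is norm .

definition dist_endo :: "'a endo \<Rightarrow> 'a endo \<Rightarrow> real" where
  "dist_endo x y = norm (x - y)"

definition uniformity_endo :: "('a endo \<times> 'a endo) filter" where
  "uniformity_endo = (INF e\<in>{0 <..}. principal {(x, y). dist x y < e})"

definition open_endo :: "'a endo set \<Rightarrow> bool" where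
  "open_endo S = (\<forall>x\<in>S. \<forall>\<^sub>F (x', y) in uniformity. x' = x \<longrightarrow> y \<in> S)"

definition sgn_endo :: "'a endo \<Rightarrow> 'a endo" where
  "sgn_endo x = scaleR (inverse (norm x)) x"

instance
proof
  fix x y z :: "'a endo" and r s :: real
  show "x + y + z = x + (y + z)" "x + y = y + x" "0 + x = x" "- x + x = 0" "x - y = x + - y"
    "r *\<^sub>R (x + y) = r *\<^sub>R x + r *\<^sub>R y" "(r + s) *\<^sub>R x = r *\<^sub>R x + s *\<^sub>R x"
    "r *\<^sub>R s *\<^sub>R x = (r * s) *\<^sub>R x" "1 *\<^sub>R x = x"
    by (transfer, simp add: algebra_simps)+
  show "x * y * z = x * (y * z)" "1 * x = x" "x * 1 = x"
    by (transfer, rule blinfun_eqI, simp)+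
  show "(x + y) * z = x * z + y * z" "x * (y + z) = x * y + x * z"
    "r *\<^sub>R x * y = r *\<^sub>R (x * y)" "x * r *\<^sub>R y = r *\<^sub>R (x * y)"
    by (transfer, rule blinfun_eqI, simp add: blinfun.bilinear_simps)+
  show "norm x = 0 \<longleftrightarrow> x = 0" "norm (x + y) \<le> norm x + norm y" "norm (r *\<^sub>R x) = \<bar>r\<bar> * norm x"
    by (transfer, simp add: norm_triangle_ineq)+
  show "norm (x * y) \<le> norm x * norm y"
    by transfer (rule norm_blinfun_compose)
  show norm_one: "norm (1 :: 'a endo) = 1"
    by transfer (rule norm_id_blinfun_prod_real)
  have "norm (0 :: 'a endo) = 0"
    by transfer simp
  with norm_one show "(0 :: 'a endo) \<noteq> 1"
    by force
qed (rule dist_endo_def uniformity_endo_def open_endo_def sgn_endo_def)+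

end

instance endo :: (banach) banach
proof
  fix X :: "nat \<Rightarrow> 'a endo"
  assume "Cauchy X"
  then have "Cauchy (\<lambda>n. endo_blinfun (X n))"
    unfolding Cauchy_def dist_norm by (simp add: norm_endo.rep_eq minus_endo.rep_eq)
  then obtain L where "(\<lambda>n. endo_blinfun (X n)) \<longlonglongrightarrow> L"
    using Cauchy_convergent convergent_def by blast
  then have "X \<longlonglongrightarrow> Endo L"
    unfolding tendsto_iff dist_norm norm_endo.rep_eq minus_endo.rep_eq by (simp add: Endo_inverse)
  then show "convergent X"
    by (rule convergentI)
qed

lemma continuous_exp_banach: "continuous_on UNIV (exp :: 'a::{real_normed_algebra_1,banach} \<Rightarrow> 'a)"
proof -
  have "isCont exp a" for a :: 'a
  proof -
    define S where "S = ball (0::'a) (norm a + 1)"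
    have "uniform_limit S (\<lambda>n x. \<Sum>i<n. x ^ i /\<^sub>R fact i) (\<lambda>x. \<Sum>i. x ^ i /\<^sub>R fact i) sequentially"
    proof (rule Weierstrass_m_test)
      show "norm (x ^ n /\<^sub>R fact n) \<le> (norm a + 1) ^ n /\<^sub>R fact n" if "x \<in> S" for n x
        using that by (auto simp: S_def intro!: mult_left_mono order_trans[OF norm_power_ineq power_mono])
      show "summable (\<lambda>n. (norm a + 1) ^ n /\<^sub>R fact n)"
        using exp_converges sums_iff by blast
    qed
    then have "uniform_limit S (\<lambda>n x. \<Sum>i<n. x ^ i /\<^sub>R fact i) exp sequentially"
      by (simp add: exp_def)
    then have "continuous_on S exp"
      by (rule uniform_limit_theorem[rotated]) (auto intro!: always_eventually continuous_intros)
    then show ?thesis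
      by (simp add: S_def continuous_on_eq_continuous_at)
  qed
  then show ?thesis
    by (simp add: continuous_at_imp_continuous_on)
qed

text \<open>The real summand is annihilated, so products are preserved while the identity is sent to
  an idempotent different from 1.\<close>

definition endo_of :: "('a::chilbert_space \<Rightarrow>\<^sub>C\<^sub>L 'a) \<Rightarrow> 'a endo" where
  "endo_of A = Endo (Blinfun (\<lambda>x. (A *\<^sub>V fst x, 0)))"

lemma endo_of_apply: "blinfun_apply (endo_blinfun (endo_of A)) x = (A *\<^sub>V fst x, 0)"
proof -
  have "bounded_linear (\<lambda>x::'a \<times> real. (A *\<^sub>V fst x, 0::real))"
    by (intro bounded_linear_Pair bounded_linear_compose[OF bounded_linear_cblinfun_apply]
        bounded_linear_fst bounded_linear_zero)
  then show ?thesis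
    by (simp add: endo_of_def Endo_inverse bounded_linear_Blinfun_apply)
qed

lemma endo_eqI: "(\<And>x. blinfun_apply (endo_blinfun a) x = blinfun_apply (endo_blinfun b) x) \<Longrightarrow> a = b"
  by (metis blinfun_eqI endo_blinfun_inject)

lemma endo_of_inject: "endo_of A = endo_of B \<Longrightarrow> A = B"
proof (rule cblinfun_eqI)
  fix x assume "endo_of A = endo_of B"
  then show "A *\<^sub>V x = B *\<^sub>V x"
    using endo_of_apply[of A "(x, 0)"] endo_of_apply[of B "(x, 0)"] by simp
qed

lemma endo_of_add: "endo_of (A + B) = endo_of A + endo_of B"
  and endo_of_diff: "endo_of (A - B) = endo_of A - endo_of B"
  and endo_of_scaleR: "endo_of (r *\<^sub>R A) = r *\<^sub>R endo_of A"
  and endo_of_compose: "endo_of (A o\<^sub>C\<^sub>L B) = endo_of A * endo_of B"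
  by (rule endo_eqI, simp add: endo_of_apply plus_endo.rep_eq minus_endo.rep_eq scaleR_endo.rep_eq
      times_endo.rep_eq blinfun.bilinear_simps)+

lemma norm_fst: "norm (fst x) \<le> norm x"
  using norm_fst_le[of "fst x" "snd x"] by simp

lemma norm_endo_apply:
  "norm (fst (blinfun_apply (endo_blinfun Z) (x, 0))) \<le> norm Z * norm x"
  using order_trans[OF norm_fst norm_blinfun[of "endo_blinfun Z" "(x, 0)"]]
  by (simp add: norm_endo.rep_eq norm_prod_def)

lemma norm_endo_of_le: "norm (endo_of A) \<le> norm A"
  unfolding norm_endo.rep_eq
proof (rule norm_blinfun_bound)
  fix x :: "'a \<times> real"
  have "norm (A *\<^sub>V fst x) \<le> norm A * norm (fst x)"
    by (rule norm_cblinfun_apply)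
  also have "\<dots> \<le> norm A * norm x"
    by (intro mult_left_mono norm_fst) auto
  finally show "norm (blinfun_apply (endo_blinfun (endo_of A)) x) \<le> norm A * norm x"
    by (simp add: endo_of_apply norm_prod_def)
qed simp

definition cpower :: "('a::chilbert_space \<Rightarrow>\<^sub>C\<^sub>L 'a) \<Rightarrow> nat \<Rightarrow> ('a \<Rightarrow>\<^sub>C\<^sub>L 'a)" where
  "cpower A n = ((\<lambda>B. A o\<^sub>C\<^sub>L B) ^^ n) id_cblinfun"

lemma cpower_simps [simp]: "cpower A 0 = id_cblinfun" "cpower A (Suc n) = A o\<^sub>C\<^sub>L cpower A n"
  by (simp_all add: cpower_def)

lemma cpower_Suc_right: "cpower A (Suc n) *\<^sub>V x = cpower A n *\<^sub>V A *\<^sub>V x"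
  by (induction n) auto

lemma endo_of_cpower: "blinfun_apply (endo_blinfun (endo_of A ^ n)) (x, 0) = (cpower A n *\<^sub>V x, 0)"
  by (induction n) (auto simp: one_endo.rep_eq times_endo.rep_eq endo_of_apply)

lemma exp_endo_of_sums:
  "(\<lambda>n. (cpower A n *\<^sub>V x) /\<^sub>R fact n) sums fst (blinfun_apply (endo_blinfun (exp (endo_of A))) (x, 0))"
  "snd (blinfun_apply (endo_blinfun (exp (endo_of A))) (x, 0)) = 0"
proof -
  have lin: "bounded_linear (\<lambda>Z. blinfun_apply (endo_blinfun Z) (x, 0::real))"
  proof (rule bounded_linear_intro)
    show "norm (blinfun_apply (endo_blinfun Z) (x, 0::real)) \<le> norm Z * norm (x, 0::real)" for Z
      unfolding norm_endo.rep_eq by (rule norm_blinfun)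
  qed (auto simp: plus_endo.rep_eq scaleR_endo.rep_eq blinfun.bilinear_simps)
  have "(\<lambda>n. blinfun_apply (endo_blinfun (endo_of A ^ n /\<^sub>R fact n)) (x, 0::real))
      sums blinfun_apply (endo_blinfun (exp (endo_of A))) (x, 0)"
    by (intro bounded_linear.sums[OF lin] exp_converges)
  then have *: "(\<lambda>n. ((cpower A n *\<^sub>V x) /\<^sub>R fact n, 0)) sums blinfun_apply (endo_blinfun (exp (endo_of A))) (x, 0)"
    by (simp add: scaleR_endo.rep_eq blinfun.bilinear_simps endo_of_cpower)
  show "(\<lambda>n. (cpower A n *\<^sub>V x) /\<^sub>R fact n) sums fst (blinfun_apply (endo_blinfun (exp (endo_of A))) (x, 0))"
    using bounded_linear.sums[OF bounded_linear_fst *] by simp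
  show "snd (blinfun_apply (endo_blinfun (exp (endo_of A))) (x, 0)) = 0"
    using bounded_linear.sums[OF bounded_linear_snd *] by (simp add: sums_iff)
qed

lemma bounded_linear_scaleC: "bounded_linear (\<lambda>x. c *\<^sub>C (x::'a::complex_inner))"
  by (rule bounded_linear_intro[of _ "cmod c"])
    (auto simp: scaleC_add_right scaleC_scaleR norm_scaleC mult.commute)

text \<open>The limit operator is first built pointwise from the vector-valued series. The operator
  series then converges to it in norm, because its error is dominated by the error of the
  exponential series in the algebra of type \<open>endo\<close>.\<close>

lemma exp_op_endo: "blinfun_apply (endo_blinfun (exp (endo_of A))) (x, 0) = (exp_op A *\<^sub>V x, 0)"
proof -
  define L where "L x = fst (blinfun_apply (endo_blinfun (exp (endo_of A))) (x, 0))" for x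
  note L = exp_endo_of_sums(1)[of A, folded L_def]
  have apply_L: "CBlinfun L *\<^sub>V x = L x" for x
  proof (rule CBlinfun_apply)
    show "L (x + y) = L x + L y" for x y
      using sums_unique2[OF L[of "x + y"]] sums_add[OF L[of x] L[of y]]
      by (simp add: cblinfun_linear algebra_simps)
    show "L (c *\<^sub>C x) = c *\<^sub>C L x" for c x
      using sums_unique2[OF L[of "c *\<^sub>C x"]] bounded_linear.sums[OF bounded_linear_scaleC L[of x], of c]
      by (simp add: cblinfun_linear scaleC_scaleR)
    show "norm (L x) \<le> norm (exp (endo_of A)) * norm x" for x
      unfolding L_def by (rule norm_endo_apply)
  qed
  have "(\<lambda>n. cpower A n /\<^sub>R fact n) sums CBlinfun L"
    unfolding sums_def
  proof (rule Lim_null[THEN iffD2], rule Lim_null_comparison)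
    have fs: "fst (blinfun_apply (endo_blinfun (\<Sum>i<n. endo_of A ^ i /\<^sub>R fact i)) (x, 0)) = (\<Sum>i<n. cpower A i /\<^sub>R fact i) *\<^sub>V x" for n x
      by (induction n) (auto simp: zero_endo.rep_eq plus_endo.rep_eq scaleR_endo.rep_eq
          blinfun.bilinear_simps endo_of_cpower)
    show "\<forall>\<^sub>F n in sequentially. norm ((\<Sum>i<n. cpower A i /\<^sub>R fact i) - CBlinfun L)
        \<le> norm ((\<Sum>i<n. endo_of A ^ i /\<^sub>R fact i) - exp (endo_of A))"
      using norm_endo_apply[of "(\<Sum>i<n. endo_of A ^ i /\<^sub>R fact i) - exp (endo_of A)" for n]
      by (intro always_eventually allI norm_cblinfun_bound)
        (simp_all add: apply_L fs[symmetric] minus_endo.rep_eq blinfun.bilinear_simps L_def)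
    have "(\<lambda>n. \<Sum>i<n. endo_of A ^ i /\<^sub>R fact i) \<longlonglongrightarrow> exp (endo_of A)"
      using exp_converges[of "endo_of A"] by (simp add: sums_def)
    then show "(\<lambda>n. norm ((\<Sum>i<n. endo_of A ^ i /\<^sub>R fact i) - exp (endo_of A))) \<longlonglongrightarrow> 0"
      by (intro tendsto_norm_zero) (simp add: LIM_zero)
  qed
  then have "exp_op A = CBlinfun L"
    by (simp add: exp_op_def cpower_def sums_iff)
  then show ?thesis
    by (simp add: apply_L L_def exp_endo_of_sums(2) prod_eq_iff)
qed

lemma exp_op_sums: "(\<lambda>n. (cpower A n *\<^sub>V x) /\<^sub>R fact n) sums (exp_op A *\<^sub>V x)"
  using exp_endo_of_sums(1)[of A x] by (simp add: exp_op_endo)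

lemma exp_op_zero [simp]: "exp_op 0 = id_cblinfun"
proof (rule cblinfun_eqI)
  fix x :: 'a
  have "cpower (0 :: 'a \<Rightarrow>\<^sub>C\<^sub>L 'a) n *\<^sub>V x = (if n = 0 then x else 0)" for n
    by (cases n) auto
  then have "(\<lambda>n. (cpower (0 :: 'a \<Rightarrow>\<^sub>C\<^sub>L 'a) n *\<^sub>V x) /\<^sub>R fact n) = (\<lambda>n. if n = 0 then x else 0)"
    by auto
  then show "exp_op 0 *\<^sub>V x = id_cblinfun *\<^sub>V x"
    using sums_unique2[OF exp_op_sums[of 0 x]] sums_single[of 0 "\<lambda>_. x"] by simp
qed

lemma exp_op_add:
  assumes "A o\<^sub>C\<^sub>L B = B o\<^sub>C\<^sub>L A"
  shows "exp_op (A + B) = exp_op A o\<^sub>C\<^sub>L exp_op B"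
proof (rule cblinfun_eqI)
  fix x
  have "exp (endo_of (A + B)) = exp (endo_of A) * exp (endo_of B)"
    unfolding endo_of_add by (rule exp_add_commuting) (metis assms endo_of_compose)
  then show "exp_op (A + B) *\<^sub>V x = (exp_op A o\<^sub>C\<^sub>L exp_op B) *\<^sub>V x"
    using exp_op_endo[of "A + B" x] by (simp add: times_endo.rep_eq exp_op_endo)
qed

lemma exp_op_has_vector_derivative:
  "((\<lambda>s. exp_op (s *\<^sub>R A) *\<^sub>V x) has_vector_derivative (A *\<^sub>V exp_op (s *\<^sub>R A) *\<^sub>V x)) (at s within S)"
proof -
  have lin: "bounded_linear (\<lambda>Z. fst (blinfun_apply (endo_blinfun Z) (x, 0::real)))"
  proof (rule bounded_linear_intro)
    show "norm (fst (blinfun_apply (endo_blinfun Z) (x, 0::real))) \<le> norm Z * norm x" for Z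
      by (rule norm_endo_apply)
  qed (auto simp: plus_endo.rep_eq scaleR_endo.rep_eq blinfun.bilinear_simps)
  have "((\<lambda>s. fst (blinfun_apply (endo_blinfun (exp (s *\<^sub>R endo_of A))) (x, 0::real)))
      has_vector_derivative fst (blinfun_apply (endo_blinfun (endo_of A * exp (s *\<^sub>R endo_of A))) (x, 0))) (at s)"
    by (intro bounded_linear.has_vector_derivative[OF lin] exp_scaleR_has_vector_derivative_left)
  then show ?thesis
    by (simp add: times_endo.rep_eq endo_of_apply exp_op_endo flip: endo_of_scaleR)
      (rule has_vector_derivative_at_within)
qed

lemma tendsto_exp_op:
  fixes A :: "'a::chilbert_space \<Rightarrow>\<^sub>C\<^sub>L 'a"
  assumes "(f \<longlongrightarrow> A) F"
  shows "((\<lambda>k. exp_op (f k)) \<longlongrightarrow> exp_op A) F"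
proof (rule Lim_null[THEN iffD2], rule Lim_null_comparison)
  show "\<forall>\<^sub>F k in F. norm (exp_op (f k) - exp_op A) \<le> norm (exp (endo_of (f k)) - exp (endo_of A))"
    using norm_endo_apply[of "exp (endo_of (f k)) - exp (endo_of A)" for k]
    by (intro always_eventually allI norm_cblinfun_bound)
      (simp_all add: minus_endo.rep_eq blinfun.bilinear_simps exp_op_endo)
  have "bounded_linear (endo_of :: ('a \<Rightarrow>\<^sub>C\<^sub>L 'a) \<Rightarrow> _)"
    by (rule bounded_linear_intro[of _ 1]) (auto simp: endo_of_add endo_of_scaleR norm_endo_of_le)
  then have "((\<lambda>k. endo_of (f k)) \<longlongrightarrow> endo_of A) F"
    by (rule bounded_linear.tendsto) (rule assms)
  then have "((\<lambda>k. exp (endo_of (f k))) \<longlongrightarrow> exp (endo_of A)) F"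
    by (rule continuous_on_tendsto_compose[OF continuous_exp_banach]) auto
  then show "((\<lambda>k. norm (exp (endo_of (f k)) - exp (endo_of A))) \<longlongrightarrow> 0) F"
    by (intro tendsto_norm_zero) (simp add: LIM_zero)
qed

lemma exp_op_intertwine:
  assumes "\<And>x. F *\<^sub>V A *\<^sub>V x = B *\<^sub>V F *\<^sub>V x"
  shows "F *\<^sub>V exp_op A *\<^sub>V x = exp_op B *\<^sub>V F *\<^sub>V x"
proof -
  have "F *\<^sub>V cpower A n *\<^sub>V x = cpower B n *\<^sub>V F *\<^sub>V x" for n
    by (induction n) (auto simp: assms)
  then show ?thesis
    using sums_unique2[OF bounded_linear.sums[OF bounded_linear_cblinfun_apply exp_op_sums[of A x], of F]
        _ ] exp_op_sums[of B "F *\<^sub>V x"]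
    by (simp add: cblinfun_linear)
qed

text \<open>Termwise comparison of the two series. The form \<open>q\<close> is arbitrary because
  the lemma serves three of them: the inner product, the form given by \<sigma> at \<xi>, and the
  asymptotic form of the powers of \<open>G\<close>.\<close>

lemma exp_op_adjoint:
  fixes q :: "'a::chilbert_space \<Rightarrow> 'b::chilbert_space \<Rightarrow> complex"
  assumes "bounded_bilinear q" and "\<And>x y. q (A *\<^sub>V x) y = q x (B *\<^sub>V y)"
  shows "q (exp_op A *\<^sub>V x) y = q x (exp_op B *\<^sub>V y)"
proof -
  interpret q: bounded_bilinear q by fact
  have pow: "q (cpower A n *\<^sub>V x) y = q x (cpower B n *\<^sub>V y)" for n
  proof (induction n arbitrary: y)
    case (Suc n)
    show ?case
      unfolding cpower_Suc_right[of B] Suc.IH[symmetric] by (simp add: assms(2))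
  qed simp
  have "(\<lambda>n. q ((cpower A n *\<^sub>V x) /\<^sub>R fact n) y) sums q (exp_op A *\<^sub>V x) y"
    by (rule bounded_linear.sums[OF q.bounded_linear_left exp_op_sums])
  moreover have "(\<lambda>n. q x ((cpower B n *\<^sub>V y) /\<^sub>R fact n)) sums q x (exp_op B *\<^sub>V y)"
    by (rule bounded_linear.sums[OF q.bounded_linear_right exp_op_sums])
  ultimately show ?thesis
    by (simp add: q.scaleR_left q.scaleR_right pow sums_iff)
qed

text \<open>Along the orbit \<open>u s = exp_op (s *\<^sub>R A) *\<^sub>V x\<close> the derivative
  of \<open>q (u s) (u s)\<close> is twice the real part of
  \<open>q (A *\<^sub>V u s) (u s)\<close>.\<close>

lemma exp_op_contraction:
  fixes q :: "'a::chilbert_space \<Rightarrow> 'a \<Rightarrow> complex"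
  assumes "bounded_bilinear q" and herm: "\<And>x y. q x y = cnj (q y x)"
    and diss: "\<And>x. Re (q (A *\<^sub>V x) x) \<le> 0"
  shows "Re (q (exp_op A *\<^sub>V x) (exp_op A *\<^sub>V x)) \<le> Re (q x x)"
proof -
  interpret q: bounded_bilinear q by fact
  define u where "u s = exp_op (s *\<^sub>R A) *\<^sub>V x" for s
  have u: "(u has_vector_derivative (A *\<^sub>V u s)) (at s)" for s
    unfolding u_def by (rule exp_op_has_vector_derivative)
  have "((\<lambda>s. q (u s) (u s)) has_vector_derivative (q (u s) (A *\<^sub>V u s) + q (A *\<^sub>V u s) (u s))) (at s)" for s
    by (rule bounded_bilinear.has_vector_derivative[OF assms(1) u u])
  then have "((\<lambda>s. Re (q (u s) (u s))) has_vector_derivative Re (q (u s) (A *\<^sub>V u s) + q (A *\<^sub>V u s) (u s))) (at s)" for s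
    by (rule bounded_linear.has_vector_derivative[OF bounded_linear_Re])
  moreover have "Re (q (u s) (A *\<^sub>V u s) + q (A *\<^sub>V u s) (u s)) \<le> 0" for s
    using diss[of "u s"] herm[of "u s" "A *\<^sub>V u s"] by simp
  ultimately have "Re (q (u 1) (u 1)) \<le> Re (q (u 0) (u 0))"
    by (intro DERIV_nonpos_imp_nonincreasing[of 0 1 "\<lambda>s. Re (q (u s) (u s))"])
      (auto simp: has_real_derivative_iff_has_vector_derivative)
  then show ?thesis
    by (simp add: u_def)
qed

lemma norm_cpower_le: "norm (cpower A n *\<^sub>V x) \<le> norm A ^ n * norm x"
proof (induction n)
  case (Suc n)
  have "norm (cpower A (Suc n) *\<^sub>V x) \<le> norm A * norm (cpower A n *\<^sub>V x)"
    using norm_cblinfun_apply[of A] by simp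
  also have "\<dots> \<le> norm A * (norm A ^ n * norm x)"
    by (intro mult_left_mono Suc) simp
  finally show ?case by simp
qed simp

lemma cpower_scaleC: "cpower (c *\<^sub>C A) n *\<^sub>V x = c ^ n *\<^sub>C (cpower A n *\<^sub>V x)"
  by (induction n) (auto simp: cblinfun_linear mult.commute)

lemma norm_scaleC_cblinfun_le:
  fixes A :: "'a::complex_inner \<Rightarrow>\<^sub>C\<^sub>L 'b::complex_inner"
  shows "norm (c *\<^sub>C A) \<le> cmod c * norm A"
proof (rule norm_cblinfun_bound)
  show "norm ((c *\<^sub>C A) *\<^sub>V x) \<le> cmod c * norm A * norm x" for x
    using mult_left_mono[OF norm_cblinfun_apply[of A x], of "cmod c"] by (simp add: norm_scaleC mult.assoc)
qed simp

lemma bounded_bilinear_scaleC_cblinfun: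
  "bounded_bilinear (\<lambda>c A. c *\<^sub>C (A :: 'a::complex_inner \<Rightarrow>\<^sub>C\<^sub>L 'b::complex_inner))"
  by standard (auto simp: scaleC_add_left scaleC_add_right scaleR_scaleC[where 'a = "'a \<Rightarrow>\<^sub>C\<^sub>L 'b"]
      scaleR_conv_of_real mult.commute
      intro!: exI[of _ 1] order_trans[OF norm_scaleC_cblinfun_le])

lemma bounded_bilinear_scaleC: "bounded_bilinear (\<lambda>c x. c *\<^sub>C (x :: 'a::complex_inner))"
  by standard (auto simp: scaleC_add_left scaleC_add_right scaleR_scaleC[where 'a = 'a]
      scaleR_conv_of_real mult.commute norm_scaleC intro!: exI[of _ 1])

lemmas continuous_on_scaleC = bounded_bilinear.continuous_on[OF bounded_bilinear_scaleC]
  and continuous_on_scaleC_cblinfun = bounded_bilinear.continuous_on[OF bounded_bilinear_scaleC_cblinfun]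
  and continuous_on_apply_cblinfun = bounded_bilinear.continuous_on[OF bounded_bilinear_cblinfun_apply]

lemma continuous_on_exp_op: "continuous_on S f \<Longrightarrow> continuous_on S (\<lambda>x. exp_op (f x))"
  unfolding continuous_on_def by (auto intro: tendsto_exp_op)

lemma continuous_on_cpower: "continuous_on S f \<Longrightarrow> continuous_on S (\<lambda>z. cpower (f z) n *\<^sub>V x)"
  by (induction n) (auto intro!: continuous_on_apply_cblinfun)

lemma partial_exp_le: "norm (\<Sum>k<K. (cpower A k *\<^sub>V x) /\<^sub>R fact k) \<le> exp (norm A) * norm x"
proof -
  have e: "(\<lambda>n. norm A ^ n /\<^sub>R fact n * norm x) sums (exp (norm A) * norm x)"
    by (intro sums_mult2 exp_converges)
  have le: "norm ((cpower A n *\<^sub>V x) /\<^sub>R fact n) \<le> norm A ^ n /\<^sub>R fact n * norm x" for n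
    using norm_cpower_le[of A n x] by (simp add: divide_simps mult.commute)
  have "norm (\<Sum>k<K. (cpower A k *\<^sub>V x) /\<^sub>R fact k) \<le> (\<Sum>n<K. norm A ^ n /\<^sub>R fact n * norm x)"
    by (intro order_trans[OF norm_sum] sum_mono le)
  also have "\<dots> \<le> (\<Sum>n. norm A ^ n /\<^sub>R fact n * norm x)"
    by (intro sum_le_suminf sums_summable[OF e]) auto
  finally show ?thesis
    using sums_unique[OF e] by simp
qed

section \<open>Positive semidefinite kernels\<close>

definition psd_kernel :: "('i \<Rightarrow> 'i \<Rightarrow> complex) \<Rightarrow> bool" where
  "psd_kernel k \<longleftrightarrow> (\<forall>F c. finite F \<longrightarrow> 0 \<le> (\<Sum>i\<in>F. \<Sum>j\<in>F. c i * cnj (c j) * k i j))"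

lemma psd_kernelD: "psd_kernel k \<Longrightarrow> finite F \<Longrightarrow> 0 \<le> (\<Sum>i\<in>F. \<Sum>j\<in>F. c i * cnj (c j) * k i j)"
  by (simp add: psd_kernel_def)

text \<open>The common core of the Cauchy-Schwarz inequalities below, for kernels, for the form
  \<open>sp\<close> and for the integrals \<open>J\<close>. Taking \<open>c\<close> to be a real
  multiple of \<gamma> reduces it to a real quadratic.\<close>

lemma discriminant_bound:
  fixes \<gamma> :: complex
  assumes "\<And>c. 0 \<le> \<alpha> - 2 * Re (cnj c * \<gamma>) + (cmod c)\<^sup>2 * \<beta>" "0 \<le> \<beta>"
  shows "(cmod \<gamma>)\<^sup>2 \<le> \<alpha> * \<beta>"
proof -
  have quad: "0 \<le> \<alpha> - 2 * t * (cmod \<gamma>)\<^sup>2 + t\<^sup>2 * (cmod \<gamma>)\<^sup>2 * \<beta>" for t :: real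
  proof -
    have "Re (cnj \<gamma> * \<gamma>) = (cmod \<gamma>)\<^sup>2"
      by (simp only: cmod_power2) (simp add: power2_eq_square)
    then show ?thesis
      using assms(1)[of "of_real t * \<gamma>"] by (simp add: norm_mult power_mult_distrib mult.assoc)
  qed
  show ?thesis
  proof (cases "\<beta> = 0")
    case False
    with assms(2) have "0 < \<beta>" by simp
    then show ?thesis
      using quad[of "1 / \<beta>"] by (simp add: power2_eq_square field_simps)
  next
    case True
    have "\<not> 0 < (cmod \<gamma>)\<^sup>2"
    proof
      assume "0 < (cmod \<gamma>)\<^sup>2"
      \<comment> \<open>With \<beta> = 0 the expression is affine in t, and the chosen t gives it
        the value -1.\<close>
      then show False
        using quad[of "(\<alpha> + 1) / (2 * (cmod \<gamma>)\<^sup>2)"] True by simp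
    qed
    with True show ?thesis by simp
  qed
qed

lemma psd_kernel_diag:
  assumes "psd_kernel k" shows "0 \<le> k i i"
  using psd_kernelD[OF assms, of "{i}" "\<lambda>_. 1"] by simp

text \<open>Positive sums are real. The coefficients 1, 1 and 1, \<i> yield one condition on the
  imaginary parts and one on the real parts of the two entries.\<close>

lemma psd_kernel_hermitian:
  assumes "psd_kernel k" shows "k j i = cnj (k i j)"
proof (cases "i = j")
  case True
  then show ?thesis
    using psd_kernel_diag[OF assms, of i] by (simp add: complex_eq_iff less_eq_complex_def)
next
  case False
  have pos: "0 \<le> k i i" "0 \<le> k j j"
    using psd_kernel_diag[OF assms] by auto
  have "0 \<le> k i i + k i j + (k j i + k j j)"
    using psd_kernelD[OF assms, of "{i, j}" "\<lambda>_. 1"] False by simp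
  moreover have "0 \<le> k i i - \<i> * k i j + (\<i> * k j i + k j j)"
    using psd_kernelD[OF assms, of "{i, j}" "\<lambda>x. if x = i then 1 else \<i>"] False by simp
  ultimately show ?thesis
    using pos by (simp add: complex_eq_iff less_eq_complex_def)
qed

lemma psd_kernel_cauchy_schwarz:
  assumes "psd_kernel k" shows "(cmod (k i j))\<^sup>2 \<le> Re (k i i) * Re (k j j)"
proof (cases "i = j")
  case True
  then show ?thesis
    using psd_kernel_diag[OF assms, of i]
    by (simp add: less_eq_complex_def cmod_power2) (simp add: power2_eq_square)
next
  case False
  show ?thesis
  proof (rule discriminant_bound)
    show "0 \<le> Re (k i i) - 2 * Re (cnj c * k i j) + (cmod c)\<^sup>2 * Re (k j j)" for c
    proof -
      have "0 \<le> k i i - cnj c * k i j + (- (c * k j i) + c * cnj c * k j j)"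
        using psd_kernelD[OF assms, of "{i, j}" "\<lambda>x. if x = i then 1 else - c"] False by simp
      then have "0 \<le> Re (k i i - cnj c * k i j + (- (c * cnj (k i j)) + c * cnj c * k j j))"
        by (simp only: psd_kernel_hermitian[OF assms, of j i] less_eq_complex_def) simp
      then show ?thesis
        using psd_kernel_diag[OF assms, of j]
        by (simp add: less_eq_complex_def cmod_power2 distrib_right) (simp add: algebra_simps power2_eq_square)
    qed
    show "0 \<le> Re (k j j)"
      using psd_kernel_diag[OF assms, of j] by (simp add: less_eq_complex_def)
  qed
qed

lemma psd_kernel_add:
  assumes "psd_kernel k" "psd_kernel k'" shows "psd_kernel (\<lambda>x y. k x y + k' x y)"
  unfolding psd_kernel_def
proof (intro allI impI)
  fix F :: "'a set" and c :: "'a \<Rightarrow> complex" assume "finite F"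
  from add_nonneg_nonneg[OF psd_kernelD[OF assms(1) this, of c] psd_kernelD[OF assms(2) this, of c]]
  show "0 \<le> (\<Sum>i\<in>F. \<Sum>j\<in>F. c i * cnj (c j) * (k i j + k' i j))"
    by (simp add: distrib_left sum.distrib)
qed

lemma psd_kernel_limit:
  assumes "\<And>n::nat. psd_kernel (k n)" "\<And>x y. (\<lambda>n. k n x y) \<longlonglongrightarrow> l x y"
  shows "psd_kernel l"
  unfolding psd_kernel_def
proof (intro allI impI)
  fix F :: "'a set" and c :: "'a \<Rightarrow> complex" assume F: "finite F"
  define s where "s n = (\<Sum>i\<in>F. \<Sum>j\<in>F. c i * cnj (c j) * k n i j)" for n
  have s: "0 \<le> Re (s n)" "Im (s n) = 0" for n
    using psd_kernelD[OF assms(1)[of n] F, of c] by (auto simp: s_def less_eq_complex_def)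
  have lim: "s \<longlonglongrightarrow> (\<Sum>i\<in>F. \<Sum>j\<in>F. c i * cnj (c j) * l i j)"
    unfolding s_def by (intro tendsto_intros assms(2))
  have "0 \<le> Re (\<Sum>i\<in>F. \<Sum>j\<in>F. c i * cnj (c j) * l i j)"
    by (rule LIMSEQ_le_const[OF tendsto_Re[OF lim]]) (use s in auto)
  moreover have "Im (\<Sum>i\<in>F. \<Sum>j\<in>F. c i * cnj (c j) * l i j) = 0"
    using LIMSEQ_unique[OF tendsto_Im[OF lim]] s(2) by simp
  ultimately show "0 \<le> (\<Sum>i\<in>F. \<Sum>j\<in>F. c i * cnj (c j) * l i j)"
    by (simp add: less_eq_complex_def)
qed

section \<open>Schur complements and Cholesky factorization\<close>

definition schur_complement :: "'i \<Rightarrow> ('i \<Rightarrow> 'i \<Rightarrow> complex) \<Rightarrow> 'i \<Rightarrow> 'i \<Rightarrow> complex" where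
  "schur_complement p k i j = k i j - k i p * k p j / k p p"

text \<open>Completing the square: among all changes of the coefficient at \<open>p\<close>,
  subtracting \<open>d\<close> minimises the quadratic form of \<open>k\<close>, and the minimum is
  the quadratic form of the Schur complement.\<close>

lemma psd_kernel_schur_complement:
  assumes "psd_kernel k" shows "psd_kernel (schur_complement p k)"
  unfolding psd_kernel_def
proof (intro allI impI)
  fix F :: "'a set" and c :: "'a \<Rightarrow> complex"
  assume F: "finite F"
  show "0 \<le> (\<Sum>i\<in>F. \<Sum>j\<in>F. c i * cnj (c j) * schur_complement p k i j)"
  proof (cases "k p p = 0")
    case True
    then show ?thesis
      using psd_kernelD[OF assms F, of c] by (simp add: schur_complement_def)
  next
    case False
    define F' where "F' = insert p F"
    have F': "finite F'" "p \<in> F'" "F \<subseteq> F'"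
      using F by (auto simp: F'_def)
    \<comment> \<open>Extending the coefficients by zero puts the pivot \<open>p\<close> into the
      index set even if it is not in \<open>F\<close>.\<close>
    define a where "a i = (if i \<in> F then c i else 0)" for i
    have restrict: "(\<Sum>i\<in>F. \<Sum>j\<in>F. c i * cnj (c j) * K i j) = (\<Sum>i\<in>F'. \<Sum>j\<in>F'. a i * cnj (a j) * K i j)" for K
    proof -
      have "(\<Sum>i\<in>F. \<Sum>j\<in>F. c i * cnj (c j) * K i j) = (\<Sum>i\<in>F. \<Sum>j\<in>F. a i * cnj (a j) * K i j)"
        by (simp add: a_def)
      also have "\<dots> = (\<Sum>i\<in>F. \<Sum>j\<in>F'. a i * cnj (a j) * K i j)"
        by (intro sum.cong refl sum.mono_neutral_left F') (auto simp: a_def)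
      also have "\<dots> = (\<Sum>i\<in>F'. \<Sum>j\<in>F'. a i * cnj (a j) * K i j)"
        by (intro sum.mono_neutral_left F') (auto simp: a_def)
      finally show ?thesis .
    qed
    define \<gamma> where "\<gamma> = (\<Sum>i\<in>F'. a i * k i p)"
    have \<gamma>': "(\<Sum>j\<in>F'. cnj (a j) * k p j) = cnj \<gamma>"
      by (simp add: \<gamma>_def psd_kernel_hermitian[OF assms, of p])
    define d where "d = \<gamma> / k p p"
    have kpp: "cnj (k p p) = k p p"
      using psd_kernel_hermitian[OF assms, of p p] by simp
    let ?b = "\<lambda>i. a i - (if i = p then d else 0)"
    have inner: "(\<Sum>j\<in>F'. cnj (?b j) * k i j) = (\<Sum>j\<in>F'. cnj (a j) * k i j) - cnj d * k i p" for i
    proof -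
      have "(\<Sum>j\<in>F'. cnj (?b j) * k i j) = (\<Sum>j\<in>F'. cnj (a j) * k i j - (if j = p then cnj d * k i p else 0))"
        by (intro sum.cong refl) (simp add: left_diff_distrib)
      then show ?thesis
        using F' by (simp add: sum_subtractf)
    qed
    have "0 \<le> (\<Sum>i\<in>F'. \<Sum>j\<in>F'. ?b i * cnj (?b j) * k i j)"
      by (rule psd_kernelD[OF assms F'(1)])
    also have "\<dots> = (\<Sum>i\<in>F'. ?b i * ((\<Sum>j\<in>F'. cnj (a j) * k i j) - cnj d * k i p))"
      by (simp only: mult.assoc sum_distrib_left[symmetric] inner)
    also have "\<dots> = (\<Sum>i\<in>F'. a i * ((\<Sum>j\<in>F'. cnj (a j) * k i j) - cnj d * k i p))
        - d * ((\<Sum>j\<in>F'. cnj (a j) * k p j) - cnj d * k p p)"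
    proof -
      have *: "?b i * e i = a i * e i - (if i = p then d * e p else 0)" for i and e :: "'a \<Rightarrow> complex"
        by (simp add: left_diff_distrib)
      show ?thesis
        by (simp only: *[where e = "\<lambda>i. (\<Sum>j\<in>F'. cnj (a j) * k i j) - cnj d * k i p"] sum_subtractf
            sum.delta[OF F'(1)] F'(2) if_True)
    qed
    also have "\<dots> = (\<Sum>i\<in>F'. \<Sum>j\<in>F'. a i * cnj (a j) * k i j) - cnj d * \<gamma> - d * (cnj \<gamma> - cnj d * k p p)"
      unfolding \<gamma>'
      by (simp add: right_diff_distrib sum_subtractf sum_distrib_left mult.assoc \<gamma>_def mult.left_commute)
    also have "\<dots> = (\<Sum>i\<in>F'. \<Sum>j\<in>F'. a i * cnj (a j) * k i j) - \<gamma> * cnj \<gamma> / k p p"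
      using False by (simp add: d_def kpp field_simps)
    also have "\<gamma> * cnj \<gamma> / k p p = (\<Sum>i\<in>F'. \<Sum>j\<in>F'. a i * cnj (a j) * (k i p * k p j / k p p))"
    proof -
      have "\<gamma> * cnj \<gamma> = (\<Sum>i\<in>F'. a i * k i p) * (\<Sum>j\<in>F'. cnj (a j) * k p j)"
        by (simp only: \<gamma>' \<gamma>_def)
      then show ?thesis
        by (simp add: sum_product sum_divide_distrib mult_ac)
    qed
    finally show ?thesis
      unfolding restrict schur_complement_def right_diff_distrib sum_subtractf .
  qed
qed

definition ket :: "nat \<Rightarrow> ell2" where
  "ket n = Ell2 (\<lambda>m. if m = n then 1 else 0)"

lemma ell2_nth_Ell2_finite:
  assumes "\<And>n. n \<ge> N \<Longrightarrow> f n = 0" shows "ell2_nth (Ell2 f) = f"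
proof -
  have "summable (\<lambda>n. (cmod (f n))\<^sup>2)"
    by (rule summable_finite[of "{..<N}"]) (use assms in auto)
  then show ?thesis
    by (simp add: Ell2_inverse)
qed

lemma ell2_nth_ket: "ell2_nth (ket n) m = (if m = n then 1 else 0)"
  by (simp add: ket_def ell2_nth_Ell2_finite[of "Suc n"])

lemma ell2_eqI: "(\<And>n. ell2_nth x n = ell2_nth y n) \<Longrightarrow> x = y"
  by (metis ell2_nth_inject ext)

lemma cinner_ket_right: "cinner x (ket n) = ell2_nth x n"
proof -
  have "(\<lambda>m. ell2_nth x m * cnj (ell2_nth (ket n) m)) = (\<lambda>m. if m = n then ell2_nth x m else 0)"
    by (auto simp: ell2_nth_ket)
  then show ?thesis
    using sums_single[of n "ell2_nth x"] by (simp add: cinner_ell2.rep_eq sums_iff)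
qed

lemma cinner_ket_ket: "cinner (ket m) (ket n) = (if m = n then 1 else 0)"
  by (auto simp: cinner_ket_right ell2_nth_ket)

lemma ell2_nth_sum: "ell2_nth (\<Sum>i\<in>I. f i) n = (\<Sum>i\<in>I. ell2_nth (f i) n)"
  by (simp flip: cinner_ket_right add: cinner_sum_left)

text \<open>Division by zero yields zero, so that a vanishing pivot, whose row and column vanish as well,
  contributes a zero column.\<close>

primrec schur_iter :: "(nat \<Rightarrow> nat \<Rightarrow> complex) \<Rightarrow> nat \<Rightarrow> nat \<Rightarrow> nat \<Rightarrow> complex" where
  "schur_iter k 0 = k"
| "schur_iter k (Suc n) = schur_complement n (schur_iter k n)"

definition cholesky :: "(nat \<Rightarrow> nat \<Rightarrow> complex) \<Rightarrow> nat \<Rightarrow> nat \<Rightarrow> complex" where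
  "cholesky k i n = schur_iter k n i n / of_real (sqrt (Re (schur_iter k n n n)))"

context
  fixes k :: "nat \<Rightarrow> nat \<Rightarrow> complex"
  assumes psd: "psd_kernel k"
begin

lemma psd_schur_iter: "psd_kernel (schur_iter k n)"
  by (induction n) (auto simp: psd psd_kernel_schur_complement)

lemma schur_iter_pivot: "schur_iter k n n n = of_real (Re (schur_iter k n n n))" "0 \<le> Re (schur_iter k n n n)"
  using psd_kernel_diag[OF psd_schur_iter[of n], of n]
  by (auto simp: complex_eq_iff less_eq_complex_def)

lemma schur_iter_zero_pivot:
  assumes "Re (schur_iter k n n n) = 0" shows "schur_iter k n i n = 0"
  using psd_kernel_cauchy_schwarz[OF psd_schur_iter[of n], of i n] assms by simp

lemma schur_iter_Suc: "schur_iter k (Suc n) i j = schur_iter k n i j - cholesky k i n * cnj (cholesky k j n)"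
proof -
  define r where "r = Re (schur_iter k n n n)"
  have r: "0 \<le> r" "schur_iter k n n n = of_real r"
    using schur_iter_pivot[of n] by (auto simp: r_def)
  have "complex_of_real (sqrt r) * of_real (sqrt r) = of_real r"
    using r(1) by (simp flip: of_real_mult)
  moreover have "cholesky k i n = schur_iter k n i n / of_real (sqrt r)" for i
    by (simp add: cholesky_def r_def)
  ultimately show ?thesis
    using psd_kernel_hermitian[OF psd_schur_iter[of n], of n j]
    by (simp add: schur_complement_def r(2))
qed

lemma schur_iter_eliminated:
  assumes "n < m" shows "schur_iter k m i n = 0" "schur_iter k m n i = 0"
proof -
  have "schur_iter k m i n = 0 \<and> schur_iter k m n i = 0"
    using assms
  proof (induction m arbitrary: i)
    case (Suc m)
    show ?case
    proof (cases "n = m")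
      case True
      have "schur_iter k (Suc m) i n = 0" for i
        using schur_iter_zero_pivot[of m i] schur_iter_pivot(1)[of m]
        by (cases "schur_iter k m m m = 0") (auto simp: True schur_complement_def)
      then show ?thesis
        using psd_kernel_hermitian[OF psd_schur_iter[of "Suc m"], of n i] by simp
    next
      case False
      then show ?thesis
        using Suc by (simp add: schur_complement_def)
    qed
  qed simp
  then show "schur_iter k m i n = 0" "schur_iter k m n i = 0" by auto
qed

lemma cholesky_lower: "i < n \<Longrightarrow> cholesky k i n = 0"
  by (simp add: cholesky_def schur_iter_eliminated)

text \<open>Each elimination step splits off one product of columns. After step \<open>i\<close> the
  row \<open>i\<close> of the remainder is zero, which makes the sum finite and exact.\<close>

lemma cholesky_factorization: "k i j = (\<Sum>n\<le>i. cholesky k i n * cnj (cholesky k j n))"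
proof -
  have "k i j = (\<Sum>n<m. cholesky k i n * cnj (cholesky k j n)) + schur_iter k m i j" for m
    by (induction m) (auto simp: schur_iter_Suc simp del: schur_iter.simps(2))
  from this[of "Suc i"] show ?thesis
    using schur_iter_eliminated(2)[of i "Suc i" j] by (simp only: lessThan_Suc_atMost) simp
qed

text \<open>\<open>U\<close> is the set of nonzero pivots. The last two conclusions identify the
  closed span of the vectors: it is generated by the kets indexed by \<open>U\<close>, while the
  other kets are orthogonal to it. A unitary operator can therefore be prescribed ket by
  ket.\<close>

lemma kernel_nat_ell2:
  obtains v :: "nat \<Rightarrow> ell2" and U and c where
    "\<And>i j. cinner (v i) (v j) = k i j"
    "\<And>i n. n \<notin> U \<Longrightarrow> ell2_nth (v i) n = 0"
    "\<And>n. n \<in> U \<Longrightarrow> ket n = (\<Sum>i\<le>n. c n i *\<^sub>C v i)"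
proof -
  define v where "v i = Ell2 (cholesky k i)" for i
  define U where "U = {n. cholesky k n n \<noteq> 0}"
  have nth: "ell2_nth (v i) = cholesky k i" for i
    unfolding v_def by (rule ell2_nth_Ell2_finite[of "Suc i"]) (simp add: cholesky_lower)
  have gram: "cinner (v i) (v j) = k i j" for i j
  proof -
    have "(\<lambda>n. ell2_nth (v i) n * cnj (ell2_nth (v j) n)) sums (\<Sum>n\<le>i. ell2_nth (v i) n * cnj (ell2_nth (v j) n))"
      by (rule sums_finite) (auto simp: nth cholesky_lower)
    then show ?thesis
      by (simp add: cinner_ell2.rep_eq sums_iff cholesky_factorization[of i j] nth)
  qed
  have zero: "cholesky k i n = 0" if "n \<notin> U" for i n
  proof -
    have "schur_iter k n n n = 0 \<or> Re (schur_iter k n n n) = 0"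
      using that by (simp add: U_def cholesky_def)
    then have "Re (schur_iter k n n n) = 0"
      by auto
    then show ?thesis by (simp add: cholesky_def)
  qed
  \<comment> \<open>The expansion of \<open>v n\<close> in kets is triangular, and kets outside
    \<open>U\<close> occur in it with coefficient zero. For \<open>n\<close> in \<open>U\<close> the
    diagonal coefficient is nonzero, so it can be solved for \<open>ket n\<close>.\<close>
  have "\<exists>c. n \<in> U \<longrightarrow> ket n = (\<Sum>i\<le>n. c i *\<^sub>C v i)" for n
  proof (induction n rule: less_induct)
    case (less n)
    then have "\<forall>m. \<exists>c. m < n \<longrightarrow> m \<in> U \<longrightarrow> ket m = (\<Sum>i\<le>m. c i *\<^sub>C v i)"
      by simp
    from choice[OF this] obtain d where d: "\<And>m. m < n \<Longrightarrow> m \<in> U \<Longrightarrow> ket m = (\<Sum>i\<le>m. d m i *\<^sub>C v i)"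
      by blast
    show ?case
    proof (cases "n \<in> U")
      case True
      then have nz: "cholesky k n n \<noteq> 0" by (simp add: U_def)
      have expand: "v n = (\<Sum>m\<le>n. cholesky k n m *\<^sub>C ket m)"
      proof (rule ell2_eqI)
        fix j
        have "cholesky k n m * (if j = m then 1 else 0) = (if j = m then cholesky k n j else 0)" for m
          by simp
        then show "ell2_nth (v n) j = ell2_nth (\<Sum>m\<le>n. cholesky k n m *\<^sub>C ket m) j"
          by (simp add: nth ell2_nth_sum scaleC_ell2.rep_eq ell2_nth_ket cholesky_lower)
      qed
      define b where "b i = (\<Sum>m<n. if m \<in> U \<and> i \<le> m then cholesky k n m * d m i else 0)" for i
      have "(\<Sum>m<n. cholesky k n m *\<^sub>C ket m) = (\<Sum>m<n. \<Sum>i<n. (if m \<in> U \<and> i \<le> m then cholesky k n m * d m i else 0) *\<^sub>C v i)"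
      proof (rule sum.cong[OF refl])
        fix m assume m: "m \<in> {..<n}"
        show "cholesky k n m *\<^sub>C ket m = (\<Sum>i<n. (if m \<in> U \<and> i \<le> m then cholesky k n m * d m i else 0) *\<^sub>C v i)"
        proof (cases "m \<in> U")
          case True
          have "cholesky k n m *\<^sub>C ket m = (\<Sum>i\<le>m. (cholesky k n m * d m i) *\<^sub>C v i)"
            using d[of m] m True by (simp add: scaleC_sum_right)
          also have "\<dots> = (\<Sum>i<n. (if m \<in> U \<and> i \<le> m then cholesky k n m * d m i else 0) *\<^sub>C v i)"
            using m True by (intro sum.mono_neutral_cong_left) auto
          finally show ?thesis .
        qed (simp add: zero)
      qed
      also have "\<dots> = (\<Sum>i<n. b i *\<^sub>C v i)"
      proof -
        have sl: "(\<Sum>m\<in>M. f m) *\<^sub>C x = (\<Sum>m\<in>M. f m *\<^sub>C x)" for M and f :: "nat \<Rightarrow> complex" and x :: ell2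
          by (induction M rule: infinite_finite_induct) (auto simp: scaleC_add_left)
        show ?thesis
          unfolding b_def sl by (rule sum.swap)
      qed
      finally have "v n = (\<Sum>i<n. b i *\<^sub>C v i) + cholesky k n n *\<^sub>C ket n"
        using expand by (simp add: lessThan_Suc_atMost[symmetric])
      then have "cholesky k n n *\<^sub>C ket n = v n - (\<Sum>i<n. b i *\<^sub>C v i)"
        by (simp add: algebra_simps)
      then have "(1 / cholesky k n n) *\<^sub>C cholesky k n n *\<^sub>C ket n = (1 / cholesky k n n) *\<^sub>C (v n - (\<Sum>i<n. b i *\<^sub>C v i))"
        by simp
      then have "ket n = (1 / cholesky k n n) *\<^sub>C v n - (\<Sum>i<n. (b i / cholesky k n n) *\<^sub>C v i)"
        using nz by (simp add: scaleC_diff_right scaleC_sum_right)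
      also have "\<dots> = (\<Sum>i\<le>n. (if i = n then 1 / cholesky k n n else - b i / cholesky k n n) *\<^sub>C v i)"
        by (simp add: lessThan_Suc_atMost[symmetric] sum_negf)
      finally show ?thesis
        by (intro exI[of _ "\<lambda>i. if i = n then 1 / cholesky k n n else - b i / cholesky k n n"] impI)
    qed simp
  qed
  then have "\<exists>c. \<forall>n. n \<in> U \<longrightarrow> ket n = (\<Sum>i\<le>n. c n i *\<^sub>C v i)"
    by (intro choice allI)
  then obtain c where c: "\<forall>n. n \<in> U \<longrightarrow> ket n = (\<Sum>i\<le>n. c n i *\<^sub>C v i)"
    by (rule exE)
  show thesis
  proof (rule that[of v U c])
    show "cinner (v i) (v j) = k i j" for i j
      by (rule gram)
    show "ell2_nth (v i) n = 0" if "n \<notin> U" for i n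
      by (simp only: nth zero[OF that])
    show "ket n = (\<Sum>i\<le>n. c n i *\<^sub>C v i)" if "n \<in> U" for n
      using c that by blast
  qed
qed

end

text \<open>The kernel is factored along the dense sequence only. The squared distance of two of the
  resulting vectors is \<phi> of their points, which is continuous and zero on the diagonal, so the
  vectors extend continuously to all points.\<close>

lemma kernel_ell2:
  fixes k :: "'x::metric_space \<Rightarrow> 'x \<Rightarrow> complex" and D :: "nat \<Rightarrow> 'x"
  assumes psd: "psd_kernel k"
    and cont: "continuous_on UNIV (\<lambda>(x, y). k x y)"
    and dense: "\<And>x e. 0 < e \<Longrightarrow> \<exists>n. dist (D n) x < e"
  obtains V :: "'x \<Rightarrow> ell2" and U and c where
    "\<And>x y. cinner (V x) (V y) = k x y" "continuous_on UNIV V"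
    "\<And>x n. n \<notin> U \<Longrightarrow> ell2_nth (V x) n = 0"
    "\<And>n. n \<in> U \<Longrightarrow> ket n = (\<Sum>i\<le>n. c n i *\<^sub>C V (D i))"
proof -
  have psd_D: "psd_kernel (\<lambda>i j. k (D i) (D j))"
    unfolding psd_kernel_def
  proof (intro allI impI)
    fix F :: "nat set" and c :: "nat \<Rightarrow> complex" assume F: "finite F"
    \<comment> \<open>The sequence \<open>D\<close> may repeat points, so coefficients of equal
      points are added up.\<close>
    define b where "b x = (\<Sum>i\<in>{i\<in>F. D i = x}. c i)" for x
    have "(\<Sum>i\<in>F. \<Sum>j\<in>F. c i * cnj (c j) * k (D i) (D j))
        = (\<Sum>x\<in>D ` F. \<Sum>y\<in>D ` F. b x * cnj (b y) * k x y)"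
    proof -
      have collapse: "(\<Sum>i\<in>F. c i * f (D i)) = (\<Sum>x\<in>D ` F. b x * f x)" for f
        unfolding sum.image_gen[OF F, of _ D] b_def sum_distrib_right by (intro sum.cong refl) auto
      have collapse_cnj: "(\<Sum>i\<in>F. cnj (c i) * f (D i)) = (\<Sum>x\<in>D ` F. cnj (b x) * f x)" for f
        using arg_cong[OF collapse[of "\<lambda>x. cnj (f x)"], of cnj] by simp
      show ?thesis
        using collapse[of "\<lambda>x. \<Sum>y\<in>D ` F. cnj (b y) * k x y"]
        by (simp only: mult.assoc sum_distrib_left[symmetric] collapse_cnj)
    qed
    also have "0 \<le> \<dots>"
      using F by (intro psd_kernelD[OF psd]) auto
    finally show "0 \<le> (\<Sum>i\<in>F. \<Sum>j\<in>F. c i * cnj (c j) * k (D i) (D j))" .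
  qed
  obtain v :: "nat \<Rightarrow> ell2" and U and c where v: "\<And>i j. cinner (v i) (v j) = k (D i) (D j)"
    and U: "\<And>i n. n \<notin> U \<Longrightarrow> ell2_nth (v i) n = 0"
    and c: "\<And>n. n \<in> U \<Longrightarrow> ket n = (\<Sum>i\<le>n. c n i *\<^sub>C v i)"
    by (rule kernel_nat_ell2[OF psd_D]) (rule that)
  have lim_k: "(\<lambda>n. k (f n) (g n)) \<longlonglongrightarrow> k x y" if "f \<longlonglongrightarrow> x" "g \<longlonglongrightarrow> y" for f g x y
    using continuous_on_tendsto_compose[OF cont tendsto_Pair[OF that]] by simp
  define \<phi> where "\<phi> x y = Re (k x x - k x y - (k y x - k y y))" for x y
  have norm_v: "(norm (v i - v j))\<^sup>2 = \<phi> (D i) (D j)" for i j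
    by (simp add: power2_norm_eq_inner inner_eq_Re_cinner cinner_simps v \<phi>_def)
  have \<phi>: "(\<lambda>n. \<phi> (f n) (g n)) \<longlonglongrightarrow> \<phi> x y" if "f \<longlonglongrightarrow> x" "g \<longlonglongrightarrow> y" for f g x y
    unfolding \<phi>_def by (intro tendsto_intros lim_k that)
  have \<phi>0: "\<phi> x x = 0" for x
    by (simp add: \<phi>_def)
  have "\<exists>d. (\<lambda>n. D (d n)) \<longlonglongrightarrow> x" for x
  proof -
    have "\<exists>m. dist (D m) x < 1 / real (Suc n)" for n
      by (rule dense) simp
    then obtain d where d: "\<And>n. dist (D (d n)) x < 1 / real (Suc n)"
      by metis
    have "(\<lambda>n. D (d n)) \<longlonglongrightarrow> x"
    proof (rule metric_LIMSEQ_I)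
      fix r :: real assume "0 < r"
      then obtain N where N: "1 / real (Suc N) < r"
        using nat_approx_posE by blast
      have "dist (D (d n)) x < r" if "N \<le> n" for n
      proof -
        have "1 / real (Suc n) \<le> 1 / real (Suc N)"
          using that by (intro divide_left_mono) auto
        then show ?thesis
          using d[of n] N by linarith
      qed
      then show "\<exists>N. \<forall>n\<ge>N. dist (D (d n)) x < r"
        by blast
    qed
    then show ?thesis by blast
  qed
  then have "\<exists>d. \<forall>x. (\<lambda>n. D (d x n)) \<longlonglongrightarrow> x"
    by (intro choice allI)
  then obtain d where d: "\<And>x. (\<lambda>n. D (d x n)) \<longlonglongrightarrow> x"
    by blast
  \<comment> \<open>Otherwise two subsequences stay at distance at least \<open>e\<close>, although
    their points share the limit \<open>x\<close>, where \<phi> vanishes.\<close>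
  have "Cauchy (\<lambda>n. v (d x n))" for x
  proof (rule ccontr)
    assume "\<not> Cauchy (\<lambda>n. v (d x n))"
    then obtain e where e: "0 < e" "\<forall>M. \<exists>m\<ge>M. \<exists>n\<ge>M. \<not> dist (v (d x m)) (v (d x n)) < e"
      unfolding Cauchy_def by blast
    from e(2) have "\<exists>m n. m \<ge> M \<and> n \<ge> M \<and> e \<le> dist (v (d x m)) (v (d x n))" for M
      by (meson linorder_not_less)
    then obtain m n where mn: "\<And>M. m M \<ge> M" "\<And>M. n M \<ge> M" "\<And>M. e \<le> dist (v (d x (m M))) (v (d x (n M)))"
      by metis
    have sub: "(\<lambda>M. D (d x (f M))) \<longlonglongrightarrow> x" if "\<And>M. f M \<ge> M" for f
    proof (rule filterlim_compose[OF d])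
      show "filterlim f at_top sequentially"
        using that by (rule filterlim_at_top_mono[OF filterlim_ident always_eventually[OF allI]])
    qed
    have "(\<lambda>M. \<phi> (D (d x (m M))) (D (d x (n M)))) \<longlonglongrightarrow> 0"
      using \<phi>[OF sub sub, of m n] mn by (simp add: \<phi>0)
    moreover have "e\<^sup>2 \<le> \<phi> (D (d x (m M))) (D (d x (n M)))" for M
      unfolding norm_v[symmetric] using mn(3)[of M] e(1) by (intro power_mono) (auto simp: dist_norm)
    ultimately have "e\<^sup>2 \<le> 0"
      by (intro LIMSEQ_le_const) auto
    then show False using e(1) by simp
  qed
  then have "\<exists>l. (\<lambda>n. v (d x n)) \<longlonglongrightarrow> l" for x
    using Cauchy_convergent convergent_def by blast
  then have "\<exists>V. \<forall>x. (\<lambda>n. v (d x n)) \<longlonglongrightarrow> V x"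
    by (intro choice allI)
  then obtain V where V: "\<And>x. (\<lambda>n. v (d x n)) \<longlonglongrightarrow> V x"
    by blast
  have gram: "cinner (V x) (V y) = k x y" for x y
  proof (rule LIMSEQ_unique)
    show "(\<lambda>n. cinner (v (d x n)) (v (d y n))) \<longlonglongrightarrow> cinner (V x) (V y)"
      by (intro tendsto_intros V)
    show "(\<lambda>n. cinner (v (d x n)) (v (d y n))) \<longlonglongrightarrow> k x y"
      unfolding v by (intro lim_k d)
  qed
  have V_v: "V (D i) = v i" for i
  proof -
    have "(\<lambda>n. norm (v (d (D i) n) - v i)) \<longlonglongrightarrow> norm (V (D i) - v i)"
      by (intro tendsto_intros V)
    moreover have "(\<lambda>n. (norm (v (d (D i) n) - v i))\<^sup>2) \<longlonglongrightarrow> 0"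
      unfolding norm_v using \<phi>[OF d[of "D i"] tendsto_const[of "D i"]] by (simp add: \<phi>0)
    ultimately have "(norm (V (D i) - v i))\<^sup>2 = 0"
      using LIMSEQ_unique tendsto_power by blast
    then show ?thesis by simp
  qed
  have norm_V: "(norm (V x - V y))\<^sup>2 = \<phi> x y" for x y
    by (simp add: power2_norm_eq_inner inner_eq_Re_cinner cinner_simps gram \<phi>_def)
  have cont_V: "continuous_on UNIV V"
    unfolding continuous_on_sequentially comp_def
  proof (intro ballI allI impI, elim conjE)
    fix f :: "nat \<Rightarrow> 'x" and x assume "f \<longlonglongrightarrow> x"
    then have "(\<lambda>n. sqrt ((norm (V (f n) - V x))\<^sup>2)) \<longlonglongrightarrow> sqrt 0"
      unfolding norm_V using \<phi>[of f x "\<lambda>_. x" x] by (intro tendsto_intros) (simp add: \<phi>0)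
    then show "(\<lambda>n. V (f n)) \<longlonglongrightarrow> V x"
      by (simp add: tendsto_norm_zero_iff LIM_zero_iff)
  qed
  have zero: "ell2_nth (V x) n = 0" if "n \<notin> U" for x n
  proof (rule LIMSEQ_unique)
    show "(\<lambda>m. cinner (v (d x m)) (ket n)) \<longlonglongrightarrow> ell2_nth (V x) n"
      unfolding cinner_ket_right[symmetric] by (intro tendsto_intros V)
    show "(\<lambda>m. cinner (v (d x m)) (ket n)) \<longlonglongrightarrow> 0"
      by (simp add: cinner_ket_right U[OF that])
  qed
  show thesis
  proof (rule that[of V U c])
    show "ket n = (\<Sum>i\<le>n. c n i *\<^sub>C V (D i))" if "n \<in> U" for n
      unfolding V_v by (rule c[OF that])
  qed (fact gram cont_V zero)+
qed

text \<open>\<open>W\<close> is obtained as the adjoint of the map sending a vector to its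
  coefficients along \<open>g\<close>, which is bounded by Bessel's inequality; this replaces
  summing an orthogonal series.\<close>

lemma isometry_of_orthonormal:
  fixes g :: "nat \<Rightarrow> ell2"
  assumes on: "\<And>m n. cinner (g m) (g n) = (if m = n then 1 else 0)"
  obtains W :: "ell2 \<Rightarrow>\<^sub>C\<^sub>L ell2" where "\<And>n. W *\<^sub>V ket n = g n" "cadjoint W o\<^sub>C\<^sub>L W = id_cblinfun"
proof -
  define a where "a y n = cinner y (g n)" for y n
  have bessel: "(\<Sum>n<N. (cmod (a y n))\<^sup>2) \<le> (norm y)\<^sup>2" for y N
  proof -
    define p where "p = (\<Sum>n<N. a y n *\<^sub>C g n)"
    have s: "complex_of_real (\<Sum>n<N. (cmod (a y n))\<^sup>2) = (\<Sum>n<N. a y n * cnj (a y n))"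
      by (simp only: of_real_sum complex_norm_square)
    have yp: "cinner y p = (\<Sum>n<N. a y n * cnj (a y n))"
      by (simp add: p_def cinner_sum_right cinner_scaleC_right a_def mult.commute)
    have pp: "cinner p p = (\<Sum>n<N. a y n * cnj (a y n))"
    proof -
      have "cinner p p = (\<Sum>n<N. \<Sum>m<N. if m = n then a y n * cnj (a y n) else 0)"
        unfolding p_def cinner_sum_left cinner_sum_right
        by (intro sum.cong refl) (simp add: cinner_simps on)
      then show ?thesis by simp
    qed
    have "0 \<le> inner (y - p) (y - p)" by simp
    also have "\<dots> = (norm y)\<^sup>2 - 2 * Re (cinner y p) + Re (cinner p p)"
      unfolding power2_norm_eq_inner inner_eq_Re_cinner[symmetric]
      by (simp add: inner_simps inner_commute)
    also have "\<dots> = (norm y)\<^sup>2 - (\<Sum>n<N. (cmod (a y n))\<^sup>2)"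
      unfolding yp pp s[symmetric] by simp
    finally show ?thesis by simp
  qed
  have nth: "ell2_nth (Ell2 (a y)) = a y" for y
  proof -
    have "summable (\<lambda>n. (cmod (a y n))\<^sup>2)"
      by (rule bounded_imp_summable[of _ "(norm y)\<^sup>2"])
        (auto simp: lessThan_Suc_atMost[symmetric] simp del: sum.lessThan_Suc intro: bessel)
    then show ?thesis by (simp add: Ell2_inverse)
  qed
  define Wt where "Wt = CBlinfun (\<lambda>y. Ell2 (a y))"
  have Wt: "Wt *\<^sub>V y = Ell2 (a y)" for y
    unfolding Wt_def
  proof (rule CBlinfun_apply[where K = 1])
    show "norm (Ell2 (a y)) \<le> 1 * norm y" for y
    proof (rule power2_le_imp_le)
      show "(norm (Ell2 (a y)))\<^sup>2 \<le> (1 * norm y)\<^sup>2"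
        unfolding norm_ell2_sq nth using bessel
        by (auto intro!: suminf_le_const bounded_imp_summable[of _ "(norm y)\<^sup>2"]
            simp: lessThan_Suc_atMost[symmetric] simp del: sum.lessThan_Suc)
    qed simp
  qed (rule ell2_eqI, simp add: nth plus_ell2.rep_eq scaleC_ell2.rep_eq a_def cinner_simps)+
  define W where "W = cadjoint Wt"
  have adj: "cadjoint W = Wt"
    unfolding W_def by (rule cadjoint_eqI) (rule cinner_cadjoint_left)
  have ket: "W *\<^sub>V ket n = g n" for n
  proof (rule cinner_eqI_right)
    show "cinner z (W *\<^sub>V ket n) = cinner z (g n)" for z
      by (simp add: W_def cinner_cadjoint[symmetric] cinner_ket_right Wt nth a_def)
  qed
  have "cinner (cadjoint W *\<^sub>V W *\<^sub>V x) (ket n) = cinner x (ket n)" for x n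
  proof -
    have "cadjoint W *\<^sub>V g n = ket n"
      unfolding adj Wt by (rule ell2_eqI) (simp add: nth a_def on ell2_nth_ket eq_commute[of n])
    moreover have "cinner (cadjoint W *\<^sub>V W *\<^sub>V x) (ket n) = cinner x (cadjoint W *\<^sub>V W *\<^sub>V ket n)"
      by (simp only: cinner_cadjoint_left[of W "W *\<^sub>V x"] cinner_cadjoint[of W x])
    ultimately show ?thesis
      by (simp only: ket)
  qed
  then have "cadjoint W o\<^sub>C\<^sub>L W = id_cblinfun"
    by (intro cblinfun_eqI ell2_eqI) (simp add: cinner_ket_right)
  with ket show thesis by (rule that)
qed

lemma cinner_isometry:
  assumes "cadjoint W o\<^sub>C\<^sub>L W = id_cblinfun"
  shows "cinner (W *\<^sub>V x) (W *\<^sub>V y) = cinner x y"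
proof -
  have "cinner (W *\<^sub>V x) (W *\<^sub>V y) = cinner x ((cadjoint W o\<^sub>C\<^sub>L W) *\<^sub>V y)"
    by (simp add: cinner_cadjoint)
  then show ?thesis
    by (simp only: assms id_cblinfun.rep_eq)
qed

lemma cblinfun_ket_eqI:
  fixes A B :: "ell2 \<Rightarrow>\<^sub>C\<^sub>L 'b::chilbert_space"
  assumes "\<And>n. A *\<^sub>V ket n = B *\<^sub>V ket n" shows "A = B"
proof -
  have "cadjoint A *\<^sub>V y = cadjoint B *\<^sub>V y" for y
  proof (rule ell2_eqI)
    show "ell2_nth (cadjoint A *\<^sub>V y) n = ell2_nth (cadjoint B *\<^sub>V y) n" for n
      by (simp add: cinner_ket_right[symmetric] cinner_cadjoint_left assms)
  qed
  then show ?thesis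
    by (intro cblinfun_eqI cinner_eqI) (simp add: cinner_cadjoint)
qed

lemma ell2_truncation_tendsto: "(\<lambda>N. \<Sum>n<N. ell2_nth x n *\<^sub>C ket n) \<longlonglongrightarrow> x"
proof -
  have nth: "ell2_nth (\<Sum>n<N. ell2_nth x n *\<^sub>C ket n) m = (if m < N then ell2_nth x m else 0)" for N m
  proof -
    have "ell2_nth x n * (if m = n then 1 else 0) = (if m = n then ell2_nth x m else 0)" for n
      by simp
    then show ?thesis
      by (simp add: ell2_nth_sum scaleC_ell2.rep_eq ell2_nth_ket)
  qed
  have "(norm (x - (\<Sum>n<N. ell2_nth x n *\<^sub>C ket n)))\<^sup>2 = (norm x)\<^sup>2 - (\<Sum>n<N. (cmod (ell2_nth x n))\<^sup>2)" for N
  proof -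
    have "(\<lambda>m. (cmod (ell2_nth (x - (\<Sum>n<N. ell2_nth x n *\<^sub>C ket n)) m))\<^sup>2)
        = (\<lambda>m. (cmod (ell2_nth x m))\<^sup>2 - (if m \<in> {..<N} then (cmod (ell2_nth x m))\<^sup>2 else 0))"
      by (auto simp: minus_ell2.rep_eq nth)
    also have "\<dots> sums ((norm x)\<^sup>2 - (\<Sum>n<N. (cmod (ell2_nth x n))\<^sup>2))"
      unfolding norm_ell2_sq[of x]
      by (intro sums_diff summable_sums summable_sq_ell2_nth sums_If_finite_set) simp
    finally show ?thesis
      by (simp add: norm_ell2_sq sums_iff)
  qed
  moreover have "(\<lambda>N. (norm x)\<^sup>2 - (\<Sum>n<N. (cmod (ell2_nth x n))\<^sup>2)) \<longlonglongrightarrow> (norm x)\<^sup>2 - (norm x)\<^sup>2"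
    unfolding norm_ell2_sq[of x] by (intro tendsto_diff tendsto_const summable_LIMSEQ summable_sq_ell2_nth)
  ultimately have "(\<lambda>N. sqrt ((norm (x - (\<Sum>n<N. ell2_nth x n *\<^sub>C ket n)))\<^sup>2)) \<longlonglongrightarrow> sqrt 0"
    by (intro tendsto_real_sqrt) simp
  then have "(\<lambda>N. x - (\<Sum>n<N. ell2_nth x n *\<^sub>C ket n)) \<longlonglongrightarrow> 0"
    by (simp add: tendsto_norm_zero_iff)
  from tendsto_diff[OF tendsto_const[of x] this] show ?thesis by simp
qed

lemma countable_dense_prod:
  assumes "separable_space (euclidean :: 'h::real_normed_vector topology)"
  obtains D :: "nat \<Rightarrow> (real^'d::finite) \<times> 'h::real_normed_vector" where "\<And>x e. 0 < e \<Longrightarrow> \<exists>n. dist (D n) x < e"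
proof -
  obtain C :: "'h set" where C: "countable C" "closure C = UNIV"
    using assms by (auto simp: separable_space_def)
  obtain Q :: "(real^'d) set" where Q: "countable Q" "\<And>X. open X \<Longrightarrow> X \<noteq> {} \<Longrightarrow> \<exists>q\<in>Q. q \<in> X"
    by (rule countable_dense_setE) blast
  have near: "\<exists>p\<in>Q \<times> C. dist p x < e" if "0 < e" for x :: "(real^'d) \<times> 'h" and e
  proof -
    have "\<exists>q\<in>Q. q \<in> ball (fst x) (e / 2)"
      using that by (intro Q(2)) auto
    then obtain q where q: "q \<in> Q" "dist q (fst x) < e / 2"
      by (auto simp: dist_commute)
    have "snd x \<in> closure C" by (simp add: C)
    then have "\<exists>c\<in>C. dist c (snd x) < e / 2"
      using that unfolding closure_approachable by (simp only: half_gt_zero)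
    then obtain c where c: "c \<in> C" "dist c (snd x) < e / 2"
      by blast
    have "dist (q, c) x \<le> dist q (fst x) + dist c (snd x)"
      by (cases x) (simp add: dist_Pair_Pair sqrt_sum_squares_le_sum)
    also have "\<dots> < e" using q c by simp
    finally show ?thesis using q c by blast
  qed
  have ne: "Q \<times> C \<noteq> {}" and count: "countable (Q \<times> C)"
    using near[of 1 undefined] Q C by auto
  show thesis
  proof (rule that[of "from_nat_into (Q \<times> C)"])
    show "\<exists>n. dist (from_nat_into (Q \<times> C) n) x < e" if "0 < e" for x :: "(real^'d) \<times> 'h" and e
      using near[OF that, of x] range_from_nat_into[OF ne count] by (metis rangeE)
  qed
qed

text \<open>A dilation theorem of Naimark type. The points (t, x) receive vectors whose Gram matrix
  is the kernel; translation in t preserves the Gram matrix and so acts unitarily on their closed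
  span, and it is completed by the identity on the orthogonal complement.\<close>

theorem unitary_representation_of_positive_definite:
  fixes B :: "real^'d::finite \<Rightarrow> 'h::chilbert_space \<Rightarrow> 'h \<Rightarrow> complex"
  assumes separable: "separable_space (euclidean :: 'h topology)"
    and add_left: "\<And>t x y z. B t (x + y) z = B t x z + B t y z"
    and scale_left: "\<And>t c x z. B t (c *\<^sub>C x) z = c * B t x z"
    and add_right: "\<And>t x y z. B t z (x + y) = B t z x + B t z y"
    and scale_right: "\<And>t c x z. B t z (c *\<^sub>C x) = cnj c * B t z x"
    and psd: "psd_kernel (\<lambda>x y. B (fst x - fst y) (snd x) (snd y))"
    and B0: "\<And>x y. B 0 x y = cinner x y"
    and cont: "\<And>x y. continuous_on UNIV (\<lambda>t. B t x y)"
  obtains \<iota> :: "'h \<Rightarrow>\<^sub>C\<^sub>L ell2" and \<rho> where "isometry_op \<iota>" "unitary_representation \<rho>"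
    "\<And>t x y. cinner (\<rho> t *\<^sub>V \<iota> *\<^sub>V x) (\<iota> *\<^sub>V y) = B t x y"
proof -
  define k where "k x y = B (fst x - fst y) (snd x) (snd y)" for x y :: "(real^'d) \<times> 'h"
  have minus_left: "B t (- x) z = - B t x z" for t x z
    using add_left[of t x "- x" z] scale_left[of t 0 x z] by (simp add: eq_neg_iff_add_eq_0 add.commute)
  have minus_right: "B t z (- x) = - B t z x" for t x z
    using add_right[of t z x "- x"] scale_right[of t z 0 x] by (simp add: eq_neg_iff_add_eq_0 add.commute)
  have diff: "B t (x - y) z = B t x z - B t y z" "B t z (x - y) = B t z x - B t z y" for t x y z
    using add_left[of t x "- y" z] add_right[of t z x "- y"] by (simp_all add: minus_left minus_right)
  \<comment> \<open>Cauchy-Schwarz for the points (t, x) and (0, y): both diagonal values of the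
    kernel are values of \<open>B 0\<close>.\<close>
  have bound: "cmod (B t x y) \<le> norm x * norm y" for t x y
  proof (rule power2_le_imp_le)
    show "(cmod (B t x y))\<^sup>2 \<le> (norm x * norm y)\<^sup>2"
      using psd_kernel_cauchy_schwarz[OF psd, of "(t, x)" "(0, y)"]
      by (simp add: B0 cinner_self power_mult_distrib)
  qed simp
  have cont_k: "continuous_on UNIV (\<lambda>(x, y). k x y)"
    unfolding continuous_on_sequentially comp_def
  proof (intro ballI allI impI, elim conjE)
    fix f :: "nat \<Rightarrow> ((real^'d) \<times> 'h) \<times> (real^'d) \<times> 'h" and p
    assume f: "f \<longlonglongrightarrow> p"
    define t x y where "t n = fst (fst (f n)) - fst (snd (f n))" and "x n = snd (fst (f n))"
      and "y n = snd (snd (f n))" for n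
    define t0 x0 y0 where "t0 = fst (fst p) - fst (snd p)" and "x0 = snd (fst p)" and "y0 = snd (snd p)"
    have lim: "t \<longlonglongrightarrow> t0" "x \<longlonglongrightarrow> x0" "y \<longlonglongrightarrow> y0"
      unfolding t_def x_def y_def t0_def x0_def y0_def by (intro tendsto_intros f)+
    have Bt: "(\<lambda>n. B (t n) x0 y0) \<longlonglongrightarrow> B t0 x0 y0"
      by (rule continuous_on_tendsto_compose[OF cont lim(1)]) auto
    have "(\<lambda>n. B (t n) (x n) (y n)) \<longlonglongrightarrow> B t0 x0 y0"
    proof (rule Lim_null[THEN iffD2], rule Lim_null_comparison)
      show "\<forall>\<^sub>F n in sequentially. norm (B (t n) (x n) (y n) - B t0 x0 y0)
          \<le> norm (x n - x0) * norm (y n) + norm x0 * norm (y n - y0) + cmod (B (t n) x0 y0 - B t0 x0 y0)"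
      proof (intro always_eventually allI)
        fix n
        have "B (t n) (x n) (y n) - B t0 x0 y0
            = B (t n) (x n - x0) (y n) + B (t n) x0 (y n - y0) + (B (t n) x0 y0 - B t0 x0 y0)"
          by (simp add: diff)
        also have "cmod \<dots> \<le> norm (x n - x0) * norm (y n) + norm x0 * norm (y n - y0) + cmod (B (t n) x0 y0 - B t0 x0 y0)"
          by (intro order_trans[OF norm_triangle_ineq] add_mono bound order_refl)
        finally show "norm (B (t n) (x n) (y n) - B t0 x0 y0)
          \<le> norm (x n - x0) * norm (y n) + norm x0 * norm (y n - y0) + cmod (B (t n) x0 y0 - B t0 x0 y0)" .
      qed
      have "(\<lambda>n. norm (x n - x0) * norm (y n) + norm x0 * norm (y n - y0) + cmod (B (t n) x0 y0 - B t0 x0 y0))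
          \<longlonglongrightarrow> norm (x0 - x0) * norm y0 + norm x0 * norm (y0 - y0) + cmod (B t0 x0 y0 - B t0 x0 y0)"
        by (intro tendsto_intros lim Bt)
      then show "(\<lambda>n. norm (x n - x0) * norm (y n) + norm x0 * norm (y n - y0) + cmod (B (t n) x0 y0 - B t0 x0 y0)) \<longlonglongrightarrow> 0"
        by simp
    qed
    then show "(\<lambda>n. case f n of (x, y) \<Rightarrow> k x y) \<longlonglongrightarrow> (case p of (x, y) \<Rightarrow> k x y)"
      by (simp add: k_def case_prod_beta t_def x_def y_def t0_def x0_def y0_def)
  qed
  have psd_k: "psd_kernel k"
    using psd by (simp add: k_def[abs_def])
  obtain D :: "nat \<Rightarrow> (real^'d) \<times> 'h" where D: "\<And>x e. 0 < e \<Longrightarrow> \<exists>n. dist (D n) x < e"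
    by (rule countable_dense_prod[OF separable, where 'd = 'd]) (rule that)
  obtain V :: "(real^'d) \<times> 'h \<Rightarrow> ell2" and U and c where
    gram: "\<And>x y. cinner (V x) (V y) = k x y" and cont_V: "continuous_on UNIV V"
    and zero: "\<And>x n. n \<notin> U \<Longrightarrow> ell2_nth (V x) n = 0"
    and ket: "\<And>n. n \<in> U \<Longrightarrow> ket n = (\<Sum>i\<le>n. c n i *\<^sub>C V (D i))"
    by (rule kernel_ell2[OF psd_k cont_k D]) (assumption, rule that)
  define T where "T s x = (fst x + s, snd x)" for s :: "real^'d" and x :: "(real^'d) \<times> 'h"
  have k_T: "k (T s x) (T s y) = k x y" for s x y
    by (simp add: k_def T_def)
  \<comment> \<open>For \<open>n\<close> in \<open>U\<close> the expansion of \<open>ket n\<close>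
    is translated term by term. The remaining kets stay fixed, which makes the representation
    trivial on the complement.\<close>
  define g where "g s n = (if n \<in> U then \<Sum>i\<le>n. c n i *\<^sub>C V (T s (D i)) else ket n)" for s n
  have g_V: "cinner (g s n) (V (T s y)) = cinner (ket n) (V y)" for s n y
  proof (cases "n \<in> U")
    case True
    then show ?thesis
      by (simp add: g_def ket cinner_sum_left cinner_scaleC_left gram k_T)
  next
    case False
    have "cinner (ket n) (V z) = 0" for z
      using cinner_commute[of "ket n" "V z"] by (simp add: cinner_ket_right zero[OF False])
    with False show ?thesis by (simp add: g_def)
  qed
  have orthonormal: "cinner (g s m) (g s n) = (if m = n then 1 else 0)" for s m n
  proof (cases "n \<in> U")
    case True
    have "cinner (g s m) (g s n) = cinner (ket m) (ket n)"
      using True by (simp add: g_def[of s n] ket[of n] cinner_sum_right cinner_scaleC_right g_V)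
    then show ?thesis by (simp add: cinner_ket_ket)
  next
    case False
    then show ?thesis
      using zero[OF False]
      by (simp add: g_def cinner_ket_right ell2_nth_sum scaleC_ell2.rep_eq ell2_nth_ket)
  qed
  have "\<exists>W. (\<forall>n. W *\<^sub>V ket n = g s n) \<and> cadjoint W o\<^sub>C\<^sub>L W = id_cblinfun" for s
    using isometry_of_orthonormal[of "g s", OF orthonormal] by metis
  then obtain \<rho> where \<rho>_ket: "\<And>s n. \<rho> s *\<^sub>V ket n = g s n" and \<rho>_iso: "\<And>s. cadjoint (\<rho> s) o\<^sub>C\<^sub>L \<rho> s = id_cblinfun"
    by metis
  have adj_V: "cadjoint (\<rho> s) *\<^sub>V V (T s y) = V y" for s y
  proof (rule ell2_eqI)
    fix n
    have "cinner (ket n) (cadjoint (\<rho> s) *\<^sub>V V (T s y)) = cinner (ket n) (V y)"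
      by (simp add: cinner_cadjoint[symmetric] \<rho>_ket g_V)
    then show "ell2_nth (cadjoint (\<rho> s) *\<^sub>V V (T s y)) n = ell2_nth (V y) n"
      unfolding cinner_ket_right[symmetric]
      using cinner_commute[of "cadjoint (\<rho> s) *\<^sub>V V (T s y)" "ket n"] cinner_commute[of "V y" "ket n"]
      by simp
  qed
  \<comment> \<open>The adjoint of the isometry is already known to map the translated vector back.
    All four products in the squared distance then equal the same diagonal value of
    \<open>k\<close>, and the distance is zero.\<close>
  have \<rho>_V: "\<rho> s *\<^sub>V V y = V (T s y)" for s y
  proof -
    define z where "z = V (T s y)"
    have 1: "cinner (\<rho> s *\<^sub>V V y) (\<rho> s *\<^sub>V V y) = k y y"
      by (simp only: cinner_isometry[OF \<rho>_iso] gram)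
    have 2: "cinner (\<rho> s *\<^sub>V V y) z = k y y"
      by (simp add: z_def cinner_cadjoint adj_V gram)
    have 3: "cinner z z = k y y"
      by (simp add: z_def gram k_T)
    have 4: "cinner z (\<rho> s *\<^sub>V V y) = cnj (k y y)"
      using cinner_commute[of z] by (simp only: 2)
    have "cinner (\<rho> s *\<^sub>V V y - z) (\<rho> s *\<^sub>V V y - z) = k y y - cnj (k y y)"
      unfolding cinner_diff_left cinner_diff_right 1 2 3 4 by simp
    moreover have "cnj (k y y) = k y y"
      using psd_kernel_hermitian[OF psd_k, of y y] by simp
    ultimately have "\<rho> s *\<^sub>V V y - z = 0"
      using cinner_self[of "\<rho> s *\<^sub>V V y - z"] by simp
    then show ?thesis by (simp add: z_def)
  qed
  have T_add: "T s (T t x) = T (s + t) x" for s t x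
    by (simp add: T_def algebra_simps)
  have \<rho>_add: "\<rho> (s + t) = \<rho> s o\<^sub>C\<^sub>L \<rho> t" for s t
    by (rule cblinfun_ket_eqI)
      (simp add: \<rho>_ket g_def cblinfun_sum_right cblinfun_scaleC_right \<rho>_V T_add)
  have \<rho>_0: "\<rho> 0 = id_cblinfun"
    by (rule cblinfun_ket_eqI) (simp add: \<rho>_ket g_def T_def ket)
  have unitary: "unitary_op (\<rho> s)" for s
  proof -
    \<comment> \<open>The group law provides a right inverse, so the isometry is onto.\<close>
    have inv: "\<rho> s o\<^sub>C\<^sub>L \<rho> (- s) = id_cblinfun"
      by (simp add: \<rho>_0 flip: \<rho>_add)
    have "cadjoint (\<rho> s) *\<^sub>V x = \<rho> (- s) *\<^sub>V x" for x
    proof -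
      have "cadjoint (\<rho> s) *\<^sub>V x = (cadjoint (\<rho> s) o\<^sub>C\<^sub>L \<rho> s) *\<^sub>V \<rho> (- s) *\<^sub>V x"
        using arg_cong[OF inv, of "\<lambda>A. A *\<^sub>V x"] by simp
      then show ?thesis by (simp add: \<rho>_iso)
    qed
    then have "cadjoint (\<rho> s) = \<rho> (- s)"
      by (rule cblinfun_eqI)
    with inv \<rho>_iso[of s] show ?thesis
      by (simp add: unitary_op_def)
  qed
  have norm_\<rho>: "norm (\<rho> s *\<^sub>V x) = norm x" for s x
  proof -
    have "cinner (\<rho> s *\<^sub>V x) (\<rho> s *\<^sub>V x) = cinner x x"
      by (rule cinner_isometry[OF \<rho>_iso])
    then have "complex_of_real ((norm (\<rho> s *\<^sub>V x))\<^sup>2) = of_real ((norm x)\<^sup>2)"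
      by (simp only: cinner_self)
    then have "(norm (\<rho> s *\<^sub>V x))\<^sup>2 = (norm x)\<^sup>2"
      by (simp only: of_real_eq_iff)
    then show ?thesis by simp
  qed
  \<comment> \<open>The orbit of a ket is a finite combination of translated vectors and hence
    continuous; since every \<open>\<rho> t\<close> is isometric, truncations of \<open>x\<close>
    converge uniformly in t.\<close>
  have cont_\<rho>: "continuous_on UNIV (\<lambda>t. \<rho> t *\<^sub>V x)" for x
  proof (rule uniform_limit_theorem)
    have cont_g: "continuous_on UNIV (\<lambda>s. g s n)" for n
    proof -
      have cont_VT: "continuous_on UNIV (\<lambda>s. V (T s y))" for y
        unfolding T_def by (rule continuous_on_compose2[OF cont_V]) (auto intro!: continuous_intros)
      show ?thesis
        unfolding g_def
        by (cases "n \<in> U")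
          (auto intro!: cont_VT continuous_on_sum bounded_linear.continuous_on[OF bounded_linear_scaleC])
    qed
    show "\<forall>\<^sub>F N in sequentially. continuous_on UNIV (\<lambda>t. \<rho> t *\<^sub>V (\<Sum>n<N. ell2_nth x n *\<^sub>C ket n))"
      by (auto simp: cblinfun_sum_right cblinfun_scaleC_right \<rho>_ket cont_g
          intro!: always_eventually continuous_on_sum bounded_linear.continuous_on[OF bounded_linear_scaleC])
    show "uniform_limit UNIV (\<lambda>N t. \<rho> t *\<^sub>V (\<Sum>n<N. ell2_nth x n *\<^sub>C ket n)) (\<lambda>t. \<rho> t *\<^sub>V x) sequentially"
      unfolding uniform_limit_iff dist_norm cblinfun_diff_right[symmetric] norm_\<rho>
      using ell2_truncation_tendsto[of x] by (simp add: tendsto_iff dist_norm)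
  qed simp
  define \<iota> where "\<iota> = CBlinfun (\<lambda>x. V (0, x))"
  have k0: "k (0, x) (0, y) = cinner x y" for x y
    by (simp add: k_def B0)
  have norm_V0: "norm (V (0, x)) = norm x" for x
  proof -
    have "complex_of_real ((norm (V (0, x)))\<^sup>2) = of_real ((norm x)\<^sup>2)"
      using gram[of "(0, x)" "(0, x)"] by (simp only: k0 cinner_self)
    then have "(norm (V (0, x)))\<^sup>2 = (norm x)\<^sup>2"
      by (simp only: of_real_eq_iff)
    then show ?thesis by simp
  qed
  have \<iota>: "\<iota> *\<^sub>V x = V (0, x)" for x
    unfolding \<iota>_def
  proof (rule CBlinfun_apply[where K = 1])
    \<comment> \<open>The map \<open>V\<close> comes without any linear structure. Its additivity
      and homogeneity at time 0 follow because the Gram matrix gives squared norm zero to the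
      defect.\<close>
    have eqI: "v = w" if "cinner (v - w) (v - w) = 0" for v w :: ell2
      using that by (simp add: cinner_self)
    show "V (0, x + y) = V (0, x) + V (0, y)" for x y
      by (rule eqI) (simp add: cinner_simps gram k0)
    show "V (0, c *\<^sub>C x) = c *\<^sub>C V (0, x)" for c x
      by (rule eqI) (simp add: cinner_simps gram k0)
    show "norm (V (0, x)) \<le> 1 * norm x" for x
      by (simp add: norm_V0)
  qed
  show thesis
  proof (rule that[of \<iota> \<rho>])
    show "isometry_op \<iota>"
      by (simp add: isometry_op_def \<iota> norm_V0)
    show "unitary_representation \<rho>"
      unfolding unitary_representation_def using unitary \<rho>_0 \<rho>_add cont_\<rho> by blast
    show "cinner (\<rho> t *\<^sub>V \<iota> *\<^sub>V x) (\<iota> *\<^sub>V y) = B t x y" for t x y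
      by (simp add: \<iota> \<rho>_V gram k_def T_def)
  qed
qed

section \<open>Very reasonable conditions\<close>

lemma bounded_bilinear_cblinfun_compose: "bounded_bilinear (o\<^sub>C\<^sub>L)"
  by standard
    (auto simp: cblinfun_linear intro!: cblinfun_eqI exI[of _ 1] norm_cblinfun_compose)

interpretation cblinfun_compose: bounded_bilinear "(o\<^sub>C\<^sub>L)"
  by (rule bounded_bilinear_cblinfun_compose)

lemma cblinfun_compose_assoc: "(A o\<^sub>C\<^sub>L B) o\<^sub>C\<^sub>L C = A o\<^sub>C\<^sub>L (B o\<^sub>C\<^sub>L C)"
  by (rule cblinfun_eqI) simp

lemma cblinfun_compose_id [simp]: "id_cblinfun o\<^sub>C\<^sub>L A = A" "A o\<^sub>C\<^sub>L id_cblinfun = A"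
  by (rule cblinfun_eqI, simp)+

lemma cblinfun_compose_scaleC [simp]:
  "(c *\<^sub>C A) o\<^sub>C\<^sub>L B = c *\<^sub>C (A o\<^sub>C\<^sub>L B)" "A o\<^sub>C\<^sub>L (c *\<^sub>C B) = c *\<^sub>C (A o\<^sub>C\<^sub>L B)"
  by (rule cblinfun_eqI, simp add: cblinfun_linear)+

text \<open>The values \<open>b + a * l\<close> of the pencil at the noncommutative point \<open>l\<close>, where \<open>a\<^sub>0 * l + b\<^sub>0\<close> is a
  scalar, commute with \<open>l\<close> and hence with each other.\<close>

lemma pencil_commute:
  fixes a\<^sub>0 :: "'r::ring"
  assumes inv: "p * a\<^sub>0 = e" "e * a = a" "e * a' = a'" "e * b = b" "e * b' = b'" "e * l = l"
    and l: "a\<^sub>0 * l = m" and m: "m * b = b * m" "m * b' = b' * m"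
    and ma: "m * a - a * m = a * b\<^sub>0 - b\<^sub>0 * a" "m * a' - a' * m = a' * b\<^sub>0 - b\<^sub>0 * a'"
    and a0: "a\<^sub>0 * a = a * a\<^sub>0" "a\<^sub>0 * a' = a' * a\<^sub>0" and aa: "a * a' = a' * a"
    and ab0: "a\<^sub>0 * b - b * a\<^sub>0 = a * b\<^sub>0 - b\<^sub>0 * a" "a\<^sub>0 * b' - b' * a\<^sub>0 = a' * b\<^sub>0 - b\<^sub>0 * a'"
    and bb: "b * b' = b' * b" and ab: "a * b' - b' * a = a' * b - b * a'"
  shows "(b + a * l) * (b' + a' * l) = (b' + a' * l) * (b + a * l)"
proof -
  have comm: "(b + a * l) * l = l * (b + a * l)"
    if "m * b = b * m" "m * a - a * m = a * b\<^sub>0 - b\<^sub>0 * a" "a\<^sub>0 * a = a * a\<^sub>0"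
      "a\<^sub>0 * b - b * a\<^sub>0 = a * b\<^sub>0 - b\<^sub>0 * a" "e * a = a" "e * b = b" for a b
  proof -
    have "a\<^sub>0 * ((b + a * l) * l - l * (b + a * l))
        = a\<^sub>0 * b * l + (a\<^sub>0 * a) * l * l - (a\<^sub>0 * l) * b - (a\<^sub>0 * l) * a * l"
      by (simp add: algebra_simps)
    also have "\<dots> = a\<^sub>0 * b * l + a * (a\<^sub>0 * l) * l - m * b - m * a * l"
      by (simp only: l that(3) mult.assoc)
    also have "\<dots> = (a\<^sub>0 * b - (m * a - a * m)) * l - m * b"
      by (simp add: l algebra_simps)
    also have "\<dots> = b * (a\<^sub>0 * l) - m * b"
      unfolding that(2) that(4)[symmetric] by (simp add: algebra_simps)
    also have "\<dots> = 0"
      by (simp add: l that(1))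
    finally have "p * (a\<^sub>0 * ((b + a * l) * l - l * (b + a * l))) = 0"
      by simp
    moreover have "e * ((b + a * l) * l - l * (b + a * l)) = (b + a * l) * l - l * (b + a * l)"
      by (simp add: algebra_simps that(5,6) inv(6) flip: mult.assoc)
    ultimately show ?thesis
      by (simp add: inv(1) flip: mult.assoc)
  qed
  note c = comm[OF m(1) ma(1) a0(1) ab0(1) inv(2,4)] comm[OF m(2) ma(2) a0(2) ab0(2) inv(3,5)]
  have "(b + a * l) * (b' + a' * l) - (b' + a' * l) * (b + a * l)
      = (b * b' - b' * b) + (b * a' - b' * a) * l + a * (l * (b' + a' * l)) - a' * (l * (b + a * l))"
    by (simp add: algebra_simps)
  also have "\<dots> = (b * a' - b' * a) * l + a * ((b' + a' * l) * l) - a' * ((b + a * l) * l)"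
    by (simp only: c bb) simp
  also have "\<dots> = ((a * b' - b' * a) - (a' * b - b * a') + (a * a' - a' * a) * l) * l"
    by (simp add: algebra_simps)
  also have "\<dots> = 0"
    by (simp add: ab aa)
  finally show ?thesis by simp
qed

definition lin_comb :: "('d::finite \<Rightarrow> 'v::real_vector) \<Rightarrow> real^'d \<Rightarrow> 'v" where
  "lin_comb \<sigma> t = (\<Sum>j\<in>UNIV. (t $ j) *\<^sub>R \<sigma> j)"

definition bilin_comb :: "('d::finite \<Rightarrow> 'd \<Rightarrow> 'v::real_vector) \<Rightarrow> real^'d \<Rightarrow> real^'d \<Rightarrow> 'v" where
  "bilin_comb \<gamma> s t = (\<Sum>i\<in>UNIV. \<Sum>l\<in>UNIV. (s $ i * t $ l) *\<^sub>R \<gamma> i l)"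

lemma linear_lin_comb: "linear (lin_comb \<sigma>)"
  by (rule linearI) (auto simp: lin_comb_def algebra_simps sum.distrib scaleR_sum_right)

lemma bilinear_bilin_comb: "bilinear (bilin_comb \<gamma>)"
  unfolding bilinear_def
  by (intro conjI allI linearI)
    (simp_all add: bilin_comb_def algebra_simps sum.distrib scaleR_sum_right)

lemma bilin_comb_antisym:
  assumes "\<And>j k. \<gamma> j k = - \<gamma> k j"
  shows "bilin_comb \<gamma> s t = - bilin_comb \<gamma> t s"
proof -
  have "bilin_comb \<gamma> s t = (\<Sum>l\<in>UNIV. \<Sum>i\<in>UNIV. (s $ i * t $ l) *\<^sub>R \<gamma> i l)"
    unfolding bilin_comb_def by (rule sum.swap)
  also have "\<dots> = (\<Sum>l\<in>UNIV. \<Sum>i\<in>UNIV. - ((t $ l * s $ i) *\<^sub>R \<gamma> l i))"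
    using assms by (intro sum.cong refl) (metis mult.commute scaleR_minus_right)
  finally show ?thesis
    by (simp add: bilin_comb_def sum_negf)
qed

text \<open>The columns of an invertible matrix form a basis. This extends the VR conditions, given
  for the columns of \<open>T\<close>, to all pairs of directions.\<close>

lemma bilinear_eq_0_columns:
  fixes f :: "real^'d \<Rightarrow> real^'d \<Rightarrow> 'v::real_vector" and T :: "real^'d^'d"
  assumes f: "bilinear f" and T: "invertible T" and 0: "\<And>j k. f (column j T) (column k T) = 0"
  shows "f s t = 0"
proof -
  have span: "\<exists>c. t = (\<Sum>j\<in>UNIV. (c $ j) *\<^sub>R column j T)" for t
  proof -
    obtain S where "T ** S = mat 1"
      using T by (auto simp: invertible_def)
    then have "t = T *v (S *v t)"
      by (simp add: matrix_vector_mul_assoc)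
    then show ?thesis
      unfolding matrix_mult_sum scalar_mult_eq_scaleR by blast
  qed
  obtain c where c: "s = (\<Sum>j\<in>UNIV. (c $ j) *\<^sub>R column j T)"
    using span by blast
  obtain d where d: "t = (\<Sum>j\<in>UNIV. (d $ j) *\<^sub>R column j T)"
    using span by blast
  have l: "linear (\<lambda>x. f x y)" and r: "linear (f x)" for x y
    using f by (auto simp: bilinear_def)
  have "f s t = (\<Sum>j\<in>UNIV. (c $ j) *\<^sub>R f (column j T) t)"
    unfolding c by (simp add: linear_sum[OF l] linear_cmul[OF l])
  also have "\<dots> = 0"
    unfolding d by (simp add: linear_sum[OF r] linear_cmul[OF r] 0)
  finally show ?thesis .
qed

lemma inverse_op_eqI:
  assumes "A o\<^sub>C\<^sub>L B = id_cblinfun" "B o\<^sub>C\<^sub>L A = id_cblinfun" shows "inverse_op A = B"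
  unfolding inverse_op_def
proof (rule the_equality)
  fix B' assume B': "A o\<^sub>C\<^sub>L B' = id_cblinfun \<and> B' o\<^sub>C\<^sub>L A = id_cblinfun"
  have "B' = (B o\<^sub>C\<^sub>L A) o\<^sub>C\<^sub>L B'"
    by (simp add: assms)
  then show "B' = B"
    using B' by (simp add: cblinfun_compose_assoc)
qed (use assms in simp)

text \<open>The change of direction. With \<open>a\<close> and \<open>b\<close> normalised at the VR
  direction \<eta>, choose the operator \<open>l\<close> with \<open>a \<xi> o\<^sub>C\<^sub>L l + b
  \<xi> = x *\<^sub>C id_cblinfun\<close>; then \<open>D x t\<close>, which is normalised at \<xi>,
  is the \<eta>-pencil evaluated at \<open>l\<close>, and \<open>pencil_commute\<close>
  applies.\<close>

lemma VR_commuting_pencil: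
  fixes \<sigma> :: "'d::{finite,linorder} \<Rightarrow> ('e::chilbert_space \<Rightarrow>\<^sub>C\<^sub>L 'e)"
  assumes VR: "VR_conditions \<sigma> \<gamma>" and antisym: "\<And>j k. \<gamma> j k = - \<gamma> k j"
    and p: "lin_comb \<sigma> \<xi> o\<^sub>C\<^sub>L p = id_cblinfun" "p o\<^sub>C\<^sub>L lin_comb \<sigma> \<xi> = id_cblinfun"
  defines "D \<equiv> \<lambda>x t. p o\<^sub>C\<^sub>L (x *\<^sub>C lin_comb \<sigma> t + bilin_comb \<gamma> \<xi> t)"
  shows "D x t o\<^sub>C\<^sub>L D x t' = D x t' o\<^sub>C\<^sub>L D x t"
proof -
  obtain T where T: "invertible T" "VR_conditions_at_first (transform_\<sigma> T \<sigma>) (transform_\<gamma> T \<gamma>)"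
    using VR by (auto simp: VR_conditions_def)
  define \<eta> where "\<eta> = column first T"
  let ?c = "\<lambda>j. column j T"
  have tr: "transform_\<sigma> T \<sigma> j = lin_comb \<sigma> (?c j)" "transform_\<gamma> T \<gamma> j k = bilin_comb \<gamma> (?c j) (?c k)" for j k
    by (simp_all add: transform_\<sigma>_def transform_\<gamma>_def lin_comb_def bilin_comb_def column_def)
  define s where "s = lin_comb \<sigma> \<eta>"
  define r where "r = inverse_op s"
  have "invertible_op s"
    using T(2) by (simp add: VR_conditions_at_first_def tr s_def \<eta>_def)
  then have r: "s o\<^sub>C\<^sub>L r = id_cblinfun" "r o\<^sub>C\<^sub>L s = id_cblinfun"
    unfolding r_def invertible_op_def using inverse_op_eqI by blast+
  define a where "a t = r o\<^sub>C\<^sub>L lin_comb \<sigma> t" for t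
  define b where "b t = r o\<^sub>C\<^sub>L bilin_comb \<gamma> \<eta> t" for t
  have g0: "bilin_comb \<gamma> t t = 0" for t
  proof -
    have "2 *\<^sub>R bilin_comb \<gamma> t t = 0"
      unfolding scaleR_2 using bilin_comb_antisym[of \<gamma> t t, OF antisym] by (simp add: eq_neg_iff_add_eq_0)
    then show ?thesis by simp
  qed
  have first: "a (?c first) = id_cblinfun" "b (?c first) = 0"
    by (simp_all add: a_def b_def r g0 cblinfun_compose.zero_right flip: \<eta>_def s_def)
  have VRc: "commutator (a (?c j)) (a (?c k)) = 0" "commutator (b (?c j)) (b (?c k)) = 0"
    "commutator (a (?c k)) (b (?c j)) = commutator (a (?c j)) (b (?c k))"
    "bilin_comb \<gamma> (?c j) (?c k) = lin_comb \<sigma> (?c j) o\<^sub>C\<^sub>L b (?c k) - lin_comb \<sigma> (?c k) o\<^sub>C\<^sub>L b (?c j)"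
    if "j \<noteq> first" "k \<noteq> first" for j k
    using T(2) that unfolding VR_conditions_at_first_def Let_def tr \<eta>_def[symmetric] s_def[symmetric] r_def[symmetric]
    by (auto simp: a_def b_def cblinfun_compose_assoc)
  have \<eta>g: "bilin_comb \<gamma> \<eta> t = s o\<^sub>C\<^sub>L b t" for t
    by (simp add: b_def r flip: cblinfun_compose_assoc)
  \<comment> \<open>In the direction \<open>first\<close> the operator \<open>a\<close> is the
    identity and \<open>b\<close> is zero, so the conditions hold trivially when one of the indices
    is \<open>first\<close>.\<close>
  have VRc': "commutator (a (?c j)) (a (?c k)) = 0" "commutator (b (?c j)) (b (?c k)) = 0"
    "commutator (a (?c k)) (b (?c j)) - commutator (a (?c j)) (b (?c k)) = 0"
    "bilin_comb \<gamma> (?c j) (?c k) - (lin_comb \<sigma> (?c j) o\<^sub>C\<^sub>L b (?c k) - lin_comb \<sigma> (?c k) o\<^sub>C\<^sub>L b (?c j)) = 0"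
    for j k
    using VRc[of j k] first bilin_comb_antisym[of \<gamma> "?c j" \<eta>, OF antisym] \<eta>g
    by (cases "j = first"; cases "k = first"; simp add: commutator_def g0 cblinfun_compose.zero_right cblinfun_compose.zero_left flip: \<eta>_def s_def)+
  have lin_a: "linear a" and lin_b: "linear b"
    unfolding a_def b_def using bilinear_bilin_comb[of \<gamma>]
    by (auto simp: bilinear_def intro!: linear_compose[OF _ bounded_linear.linear[OF cblinfun_compose.bounded_linear_right], unfolded o_def] linear_lin_comb)
  note la = linear_add[OF lin_a] linear_cmul[OF lin_a] linear_add[OF lin_b] linear_cmul[OF lin_b]
    linear_add[OF linear_lin_comb] linear_cmul[OF linear_lin_comb]
    bilinear_ladd[OF bilinear_bilin_comb] bilinear_radd[OF bilinear_bilin_comb]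
    bilinear_lmul[OF bilinear_bilin_comb] bilinear_rmul[OF bilinear_bilin_comb]
  note cs = cblinfun_compose.add_left cblinfun_compose.add_right cblinfun_compose.diff_left
    cblinfun_compose.diff_right cblinfun_compose.scaleR_left cblinfun_compose.scaleR_right
  have aa: "a t o\<^sub>C\<^sub>L a t' = a t' o\<^sub>C\<^sub>L a t" for t t'
    using bilinear_eq_0_columns[OF _ T(1), of "\<lambda>t t'. commutator (a t) (a t')" t t'] VRc'
    by (simp add: bilinear_def linear_iff commutator_def la cs algebra_simps)
  have bb: "b t o\<^sub>C\<^sub>L b t' = b t' o\<^sub>C\<^sub>L b t" for t t'
    using bilinear_eq_0_columns[OF _ T(1), of "\<lambda>t t'. commutator (b t) (b t')" t t'] VRc'
    by (simp add: bilinear_def linear_iff commutator_def la cs algebra_simps)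
  have ab: "a t o\<^sub>C\<^sub>L b t' - b t' o\<^sub>C\<^sub>L a t = a t' o\<^sub>C\<^sub>L b t - b t o\<^sub>C\<^sub>L a t'" for t t'
    using bilinear_eq_0_columns[OF _ T(1), of "\<lambda>t' t. commutator (a t) (b t') - commutator (a t') (b t)" t' t] VRc'
    by (simp add: bilinear_def linear_iff commutator_def la cs algebra_simps)
  have g: "bilin_comb \<gamma> t t' = lin_comb \<sigma> t o\<^sub>C\<^sub>L b t' - lin_comb \<sigma> t' o\<^sub>C\<^sub>L b t" for t t'
    using bilinear_eq_0_columns[OF _ T(1), of "\<lambda>t t'. bilin_comb \<gamma> t t' - (lin_comb \<sigma> t o\<^sub>C\<^sub>L b t' - lin_comb \<sigma> t' o\<^sub>C\<^sub>L b t)" t t'] VRc'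
    by (simp add: bilinear_def linear_iff la cs algebra_simps)
  have sa: "lin_comb \<sigma> t = s o\<^sub>C\<^sub>L a t" for t
    by (simp add: a_def r flip: cblinfun_compose_assoc)
  define m where "m = x *\<^sub>C id_cblinfun - b \<xi>"
  define l where "l = p o\<^sub>C\<^sub>L s o\<^sub>C\<^sub>L m"
  have al: "a \<xi> o\<^sub>C\<^sub>L l = m"
  proof -
    have "a \<xi> o\<^sub>C\<^sub>L l = r o\<^sub>C\<^sub>L (lin_comb \<sigma> \<xi> o\<^sub>C\<^sub>L p) o\<^sub>C\<^sub>L s o\<^sub>C\<^sub>L m"
      by (simp only: a_def l_def cblinfun_compose_assoc)
    then show ?thesis by (simp add: p r)
  qed
  \<comment> \<open>The identity \<open>g\<close> resolves the \<gamma> term, and commutation of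
    \<open>a t\<close> with \<open>a \<xi>\<close> allows the factor
    \<open>s o\<^sub>C\<^sub>L a \<xi>\<close>, which is \<sigma> at \<xi>, to be pulled out on the
    left and cancelled by \<open>p\<close>.\<close>
  have D: "D x t = b t + a t o\<^sub>C\<^sub>L l" for t
  proof -
    have "x *\<^sub>C lin_comb \<sigma> t + bilin_comb \<gamma> \<xi> t = s o\<^sub>C\<^sub>L (a \<xi> o\<^sub>C\<^sub>L b t + a t o\<^sub>C\<^sub>L m)"
      unfolding g[of \<xi> t] sa m_def by (simp add: cs cblinfun_compose_assoc)
    also have "\<dots> = s o\<^sub>C\<^sub>L (a \<xi> o\<^sub>C\<^sub>L b t + a t o\<^sub>C\<^sub>L (a \<xi> o\<^sub>C\<^sub>L l))"
      by (simp only: al)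
    also have "\<dots> = s o\<^sub>C\<^sub>L (a \<xi> o\<^sub>C\<^sub>L b t + a \<xi> o\<^sub>C\<^sub>L (a t o\<^sub>C\<^sub>L l))"
      by (simp only: cblinfun_compose_assoc[symmetric] aa[of t \<xi>])
    also have "\<dots> = lin_comb \<sigma> \<xi> o\<^sub>C\<^sub>L (b t + a t o\<^sub>C\<^sub>L l)"
      unfolding sa by (simp only: cs cblinfun_compose_assoc)
    finally show ?thesis
      unfolding D_def by (simp add: p flip: cblinfun_compose_assoc)
  qed
  \<comment> \<open>The computation is moved into a ring. As \<open>endo_of id_cblinfun\<close> is
    an idempotent and not 1, it plays the role of \<open>e\<close> in
    \<open>pencil_commute\<close>.\<close>
  have "(endo_of (b t) + endo_of (a t) * endo_of l) * (endo_of (b t') + endo_of (a t') * endo_of l)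
      = (endo_of (b t') + endo_of (a t') * endo_of l) * (endo_of (b t) + endo_of (a t) * endo_of l)"
  proof (rule pencil_commute)
    have "p o\<^sub>C\<^sub>L s o\<^sub>C\<^sub>L a \<xi> = id_cblinfun"
      by (simp add: p(2) cblinfun_compose_assoc flip: sa)
    then show "endo_of (p o\<^sub>C\<^sub>L s) * endo_of (a \<xi>) = endo_of id_cblinfun"
      by (simp flip: endo_of_compose)
    have comm_b: "m o\<^sub>C\<^sub>L b t = b t o\<^sub>C\<^sub>L m"
      and comm_a: "m o\<^sub>C\<^sub>L a t - a t o\<^sub>C\<^sub>L m = a t o\<^sub>C\<^sub>L b \<xi> - b \<xi> o\<^sub>C\<^sub>L a t" for t
      by (simp_all add: m_def cs bb)
    show "endo_of m * endo_of (b t) = endo_of (b t) * endo_of m"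
      "endo_of m * endo_of (b t') = endo_of (b t') * endo_of m"
      by (simp_all add: comm_b flip: endo_of_compose)
    show "endo_of m * endo_of (a t) - endo_of (a t) * endo_of m = endo_of (a t) * endo_of (b \<xi>) - endo_of (b \<xi>) * endo_of (a t)"
      "endo_of m * endo_of (a t') - endo_of (a t') * endo_of m = endo_of (a t') * endo_of (b \<xi>) - endo_of (b \<xi>) * endo_of (a t')"
      by (simp_all only: comm_a endo_of_compose[symmetric] endo_of_diff[symmetric])
    show "endo_of (a \<xi>) * endo_of (b t) - endo_of (b t) * endo_of (a \<xi>) = endo_of (a t) * endo_of (b \<xi>) - endo_of (b \<xi>) * endo_of (a t)"
      "endo_of (a \<xi>) * endo_of (b t') - endo_of (b t') * endo_of (a \<xi>) = endo_of (a t') * endo_of (b \<xi>) - endo_of (b \<xi>) * endo_of (a t')"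
      "endo_of (a t) * endo_of (b t') - endo_of (b t') * endo_of (a t) = endo_of (a t') * endo_of (b t) - endo_of (b t) * endo_of (a t')"
      by (simp_all only: endo_of_compose[symmetric] endo_of_diff[symmetric] ab[of \<xi> t] ab[of \<xi> t'] ab[of t t'])
  qed (simp_all add: aa bb al flip: endo_of_compose)
  then show ?thesis
    unfolding D by (intro endo_of_inject) (simp add: endo_of_compose endo_of_add)
qed

section \<open>Means over circles\<close>

definition circle :: "real \<Rightarrow> complex" where
  "circle \<theta> = exp (2 * of_real pi * \<i> * of_real \<theta>)"

lemma norm_circle [simp]: "cmod (circle \<theta>) = 1"
  by (simp add: circle_def)

lemma circle_nonzero [simp]: "circle \<theta> \<noteq> 0"
  by (simp add: circle_def)

lemma cnj_circle: "cnj (circle \<theta>) = 1 / circle \<theta>"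
  using complex_norm_square[of "circle \<theta>"] by (simp add: field_simps)

lemma circle_neq_1: "0 < \<theta> \<Longrightarrow> \<theta> < 1 \<Longrightarrow> circle \<theta> \<noteq> 1"
proof
  assume \<theta>: "0 < \<theta>" "\<theta> < 1" and "circle \<theta> = 1"
  then obtain n :: int where "2 * pi * \<theta> = of_int (2 * n) * pi"
    by (auto simp: circle_def exp_eq_1)
  then have "\<theta> = of_int n" by simp
  with \<theta> show False by simp
qed

lemma radius_circle_neq:
  assumes "0 < \<rho>" "\<rho> < 1" shows "of_real \<rho> * circle \<theta> \<in> - {0, 1}"
proof -
  have "cmod (of_real \<rho> * circle \<theta>) = \<rho>"
    using assms by (simp add: norm_mult)
  then show ?thesis using assms by force
qed

lemma continuous_on_circle [continuous_intros]: "continuous_on S circle"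
  unfolding circle_def by (intro continuous_intros)

text \<open>Normalised arc length. The open interval leaves out the parameters at which
  \<open>circle\<close> takes the value 1, the singular point of \<open>half_plane\<close>.\<close>

definition unit_measure :: "real measure" where
  "unit_measure = restrict_space lborel {0<..<1}"

lemma space_unit_measure [simp]: "space unit_measure = {0<..<1}"
  by (simp add: unit_measure_def space_restrict_space)

interpretation unit_measure: finite_measure unit_measure
  by (rule finite_measureI) (simp add: unit_measure_def emeasure_restrict_space space_restrict_space)

lemma measure_unit_measure [simp]: "measure unit_measure {0<..<1} = 1"
  by (simp add: unit_measure_def measure_restrict_space)

definition circle_mean :: "real \<Rightarrow> (complex \<Rightarrow> complex) \<Rightarrow> complex" where
  "circle_mean \<rho> f = integral\<^sup>L unit_measure (\<lambda>\<theta>. f (of_real \<rho> * circle \<theta>))"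

lemma borel_measurable_unit_measure:
  fixes f :: "real \<Rightarrow> 'b::{banach,second_countable_topology}"
  assumes "continuous_on {0<..<1} f"
  shows "f \<in> borel_measurable unit_measure"
proof -
  have "f \<in> borel_measurable (restrict_space borel {0<..<1})"
    by (rule borel_measurable_continuous_on_restrict[OF assms])
  also have "borel_measurable (restrict_space borel {0<..<1}) = borel_measurable unit_measure"
    unfolding unit_measure_def by (intro measurable_cong_sets sets_restrict_space_cong) simp_all
  finally show ?thesis .
qed

lemma integrable_unit_measure:
  fixes f :: "real \<Rightarrow> 'b::{banach,second_countable_topology}"
  assumes "continuous_on {0<..<1} f" "\<And>\<theta>. 0 < \<theta> \<Longrightarrow> \<theta> < 1 \<Longrightarrow> norm (f \<theta>) \<le> K"
  shows "integrable unit_measure f"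
  by (rule unit_measure.integrable_const_bound[of _ K])
    (use assms in \<open>auto intro: borel_measurable_unit_measure\<close>)

lemma norm_integral_unit_measure_le:
  fixes f :: "real \<Rightarrow> 'b::{banach,second_countable_topology}"
  assumes "integrable unit_measure f" "\<And>\<theta>. 0 < \<theta> \<Longrightarrow> \<theta> < 1 \<Longrightarrow> norm (f \<theta>) \<le> K"
  shows "norm (integral\<^sup>L unit_measure f) \<le> K"
proof -
  have "norm (integral\<^sup>L unit_measure f) \<le> integral\<^sup>L unit_measure (\<lambda>\<theta>. norm (f \<theta>))"
    by (rule integral_norm_bound)
  also have "\<dots> \<le> integral\<^sup>L unit_measure (\<lambda>\<theta>. K)"
    using assms by (intro integral_mono) auto
  finally show ?thesis by simp
qed

lemma circle_integrable:
  assumes "continuous_on (sphere 0 \<rho> - {1}) f" "0 < \<rho>" "\<And>z. cmod z = \<rho> \<Longrightarrow> z \<noteq> 1 \<Longrightarrow> cmod (f z) \<le> K"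
  shows "integrable unit_measure (\<lambda>\<theta>. f (of_real \<rho> * circle \<theta>))"
proof (rule integrable_unit_measure)
  have z: "cmod (of_real \<rho> * circle \<theta>) = \<rho>" "of_real \<rho> * circle \<theta> \<noteq> 1" if "0 < \<theta>" "\<theta> < 1" for \<theta>
  proof -
    show n: "cmod (of_real \<rho> * circle \<theta>) = \<rho>"
      using assms(2) by (simp add: norm_mult)
    show "of_real \<rho> * circle \<theta> \<noteq> 1"
    proof
      assume 1: "of_real \<rho> * circle \<theta> = 1"
      with n have "\<rho> = 1" by simp
      with 1 circle_neq_1[OF that] show False by simp
    qed
  qed
  show "continuous_on {0<..<1} (\<lambda>\<theta>. f (of_real \<rho> * circle \<theta>))"
    by (rule continuous_on_compose2[OF assms(1)]) (use z in \<open>auto intro!: continuous_intros\<close>)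
  show "norm (f (of_real \<rho> * circle \<theta>)) \<le> K" if "0 < \<theta>" "\<theta> < 1" for \<theta>
    using z[OF that] by (rule assms(3))
qed

text \<open>Cauchy's integral formula at the centre: in the parametrisation of
  \<open>circlepath\<close> the weight dz / z is constant, and the two endpoints of the interval do
  not affect the integral.\<close>

lemma circle_mean_holomorphic:
  assumes f: "f holomorphic_on ball 0 1" and \<rho>: "0 < \<rho>" "\<rho> < 1"
  shows "circle_mean \<rho> f = f 0"
proof -
  have hol: "f holomorphic_on cball 0 \<rho>"
    using f by (rule holomorphic_on_subset) (use \<rho> in auto)
  define F where "F \<theta> = f (of_real \<rho> * circle \<theta>)" for \<theta>
  have cont: "continuous_on {0..1} F"
    unfolding F_def
    by (rule continuous_on_compose2[OF holomorphic_on_imp_continuous_on[OF f]])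
      (use \<rho> in \<open>auto simp: norm_mult intro!: continuous_intros\<close>)
  have "((\<lambda>u. f u / (u - 0)) has_contour_integral (2 * of_real pi * \<i> * f 0)) (circlepath 0 \<rho>)"
    by (rule Cauchy_integral_circlepath_simple[OF hol]) (use \<rho> in simp)
  then have "((\<lambda>x. f (circlepath 0 \<rho> x) / circlepath 0 \<rho> x * vector_derivative (circlepath 0 \<rho>) (at x within {0..1}))
      has_integral (2 * of_real pi * \<i> * f 0)) {0..1}"
    by (simp add: has_contour_integral_def)
  moreover have "f (circlepath 0 \<rho> x) / circlepath 0 \<rho> x * vector_derivative (circlepath 0 \<rho>) (at x within {0..1})
      = 2 * of_real pi * \<i> * F x" if "x \<in> {0..1}" for x
  proof -
    have "vector_derivative (circlepath 0 \<rho>) (at x within {0..1})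
        = 2 * of_real pi * \<i> * \<rho> * exp (2 * of_real pi * \<i> * x)"
      using that by (simp add: vector_derivative_circlepath01)
    then show ?thesis
      using \<rho> by (simp only:) (simp add: circlepath F_def circle_def)
  qed
  ultimately have "((\<lambda>x. 2 * of_real pi * \<i> * F x) has_integral (2 * of_real pi * \<i> * f 0)) {0..1}"
    by (rule has_integral_cong[THEN iffD1, rotated])
  then have "((\<lambda>x. 1 / (2 * of_real pi * \<i>) * (2 * of_real pi * \<i> * F x)) has_integral (1 / (2 * of_real pi * \<i>) * (2 * of_real pi * \<i> * f 0))) {0..1}"
    by (rule has_integral_mult_right)
  then have I: "integral {0..1} F = f 0"
    by (simp add: integral_unique)
  have "compact (F ` {0..1})"
    by (intro compact_continuous_image cont) simp
  then have "bounded (F ` {0..1})"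
    by (rule compact_imp_bounded)
  then obtain K where K: "\<forall>x\<in>F ` {0..1}. norm x \<le> K"
    unfolding bounded_iff by blast
  have "integrable unit_measure F"
    by (rule integrable_unit_measure[of _ K]) (use K in \<open>auto intro: continuous_on_subset[OF cont]\<close>)
  then have "set_integrable lborel {0<..<1} F"
    by (simp add: unit_measure_def set_integrable_def integrable_restrict_space)
  then have "integral\<^sup>L unit_measure F = integral {0<..<1} F"
    using set_borel_integral_eq_integral(2)[of "{0<..<1}" F]
    by (simp add: unit_measure_def set_lebesgue_integral_def integral_restrict_space)
  then show ?thesis
    using I by (simp add: circle_mean_def F_def[symmetric] integral_open_interval_real)
qed

text \<open>Nonnegative exponents are covered by the mean value property. On the circle of radius
  \<rho> the inverse of z is its conjugate divided by the square of \<rho>, so negative exponents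
  follow by conjugation.\<close>

lemma circle_mean_powers:
  assumes "0 < \<rho>" "\<rho> < 1"
  shows "circle_mean \<rho> (\<lambda>z. z ^ j * (1 / z) ^ n) = (if j = n then 1 else 0)"
proof -
  have pos: "circle_mean \<rho> (\<lambda>z. z ^ k) = (if k = 0 then 1 else 0)" for k
    using circle_mean_holomorphic[OF _ assms, of "\<lambda>z. z ^ k"] by (simp add: holomorphic_intros)
  show ?thesis
  proof (cases "n \<le> j")
    case True
    have "(of_real \<rho> * circle \<theta>) ^ j * (1 / (of_real \<rho> * circle \<theta>)) ^ n = (of_real \<rho> * circle \<theta>) ^ (j - n)" for \<theta>
      using assms True by (simp add: power_diff divide_simps flip: power_divide)
    then show ?thesis
      using pos[of "j - n"] True by (simp add: circle_mean_def)
  next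
    case False
    define k where "k = n - j"
    have n: "n = j + k" "k \<noteq> 0"
      using False by (auto simp: k_def)
    have eq: "(of_real \<rho> * circle \<theta>) ^ j * (1 / (of_real \<rho> * circle \<theta>)) ^ n
        = of_real (1 / (\<rho> ^ k * \<rho> ^ k)) * cnj ((of_real \<rho> * circle \<theta>) ^ k)" for \<theta>
      using assms by (simp add: n cnj_circle power_add power_divide power_mult_distrib field_simps)
    have "circle_mean \<rho> (\<lambda>z. z ^ j * (1 / z) ^ n) = of_real (1 / (\<rho> ^ k * \<rho> ^ k)) * cnj (circle_mean \<rho> (\<lambda>z. z ^ k))"
      by (simp only: circle_mean_def eq integral_mult_right_zero Bochner_Integration.integral_cnj)
    then show ?thesis
      using pos[of k] n by simp
  qed
qed

text \<open>The mean is homogeneous in the radius, so the unit circle is reduced to a circle inside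
  the disc.\<close>

lemma circle_mean_1_powers: "circle_mean 1 (\<lambda>z. z ^ j * (1 / z) ^ n) = (if j = n then 1 else 0)"
proof -
  have "circle_mean (1/2) (\<lambda>z. z ^ j * (1 / z) ^ n) = (1/2) ^ j * 2 ^ n * circle_mean 1 (\<lambda>z. z ^ j * (1 / z) ^ n)"
    unfolding circle_mean_def integral_mult_right_zero[symmetric]
    by (intro Bochner_Integration.integral_cong refl) (simp add: power_mult_distrib power_divide)
  then show ?thesis
    using circle_mean_powers[of "1/2" j n] by (auto split: if_splits simp: power_one_over)
qed

text \<open>A Cayley transform from the unit disc onto the lower half-plane, taking the circle
  without 1 to the real line; its inverse sends x to \<open>(x + \<i>) / (x - \<i>)\<close>.\<close>

definition half_plane :: "complex \<Rightarrow> complex" where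
  "half_plane z = - \<i> * (1 + z) / (1 - z)"

text \<open>At z = 1 both sides are 0 by the convention on division. Hence \<open>half_plane\<close>
  is real at every point of the unit circle, without exception.\<close>

lemma Im_half_plane: "Im (half_plane z) = ((cmod z)\<^sup>2 - 1) / (cmod (1 - z))\<^sup>2"
  unfolding half_plane_def
  by (simp add: Im_divide cmod_power2) (simp add: power2_eq_square algebra_simps flip: divide_minus_left)

lemma half_plane_0 [simp]: "half_plane 0 = - \<i>"
  by (simp add: half_plane_def)

lemma cmod_half_plane_le:
  assumes "cmod z = \<rho>" "\<rho> < 1" shows "cmod (half_plane z) \<le> 2 / (1 - \<rho>)"
proof -
  have "1 - \<rho> \<le> cmod (1 - z)"
    using norm_triangle_ineq2[of 1 z] assms by simp
  moreover have "cmod (1 + z) \<le> 2"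
    using norm_triangle_ineq[of 1 z] assms by simp
  ultimately show ?thesis
    using assms by (simp add: half_plane_def norm_mult norm_divide frac_le)
qed

lemma Im_half_plane_nonpos: "cmod z \<le> 1 \<Longrightarrow> Im (half_plane z) \<le> 0"
  unfolding Im_half_plane by (intro divide_nonpos_nonneg) (auto simp: power_le_one)

lemma holomorphic_half_plane: "half_plane holomorphic_on ball 0 1"
  unfolding half_plane_def by (intro holomorphic_intros) auto

lemma continuous_on_half_plane: "continuous_on (- {1}) half_plane"
  unfolding half_plane_def by (intro continuous_intros) auto

text \<open>Abel's theorem along a sequence of radii. Summation by parts expresses the error through
  \<open>1 - r m\<close> times the power series of the partial sum errors \<open>s\<close>; finitely
  many of its terms are killed by the factor, and the others are small.\<close>

lemma Abel_mean_limit: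
  fixes f :: "nat \<Rightarrow> complex" and r :: "nat \<Rightarrow> real"
  assumes "f sums l" and r: "r \<longlonglongrightarrow> 1" "\<And>m. 0 < r m" "\<And>m. r m < 1"
    and g: "\<And>m. (\<lambda>n. of_real (r m) ^ n * f n) sums g m"
  shows "g \<longlonglongrightarrow> l"
proof -
  define s where "s n = (\<Sum>i<Suc n. f i) - l" for n
  have s: "s \<longlonglongrightarrow> 0"
    using assms(1) unfolding s_def sums_def by (intro LIM_zero LIMSEQ_Suc)
  obtain K where K: "\<And>n. cmod (s n) \<le> K" "0 < K"
    using convergent_imp_Bseq[OF convergentI[OF s]] by (auto simp: Bseq_def)
  have rep: "g m - l = of_real (1 - r m) * (\<Sum>n. of_real (r m) ^ n * s n)"
    and summ: "summable (\<lambda>n. cmod (of_real (r m) ^ n * s n))" for m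
  proof -
    have geo: "summable (\<lambda>n. r m ^ n * K)"
      using r(2,3)[of m] by (intro summable_mult2 summable_geometric) auto
    show S: "summable (\<lambda>n. cmod (of_real (r m) ^ n * s n))"
      using r(2)[of m] K(1)
      by (intro summable_comparison_test'[OF geo, of 0]) (auto simp: norm_mult norm_power intro: mult_left_mono)
    define z where "z = complex_of_real (r m)"
    have z: "cmod z < 1"
      using r(2,3)[of m] by (simp add: z_def)
    have "summable (\<lambda>n. z ^ n * s n)"
      using summable_norm_cancel[OF S] by (simp add: z_def)
    then have A: "(\<lambda>n. z ^ n * s n) sums (\<Sum>n. z ^ n * s n)"
      by (rule summable_sums)
    \<comment> \<open>The shifted sequence starts with the error of the empty partial sum, which is
      \<open>- l\<close>.\<close>
    have B: "(\<lambda>n. case n of 0 \<Rightarrow> - l | Suc k \<Rightarrow> z ^ n * s k) sums (z * (\<Sum>n. z ^ n * s n) + - l)"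
      using sums_Suc[of "\<lambda>n. case n of 0 \<Rightarrow> - l | Suc k \<Rightarrow> z ^ n * s k"] sums_mult[OF A, of z]
      by (simp add: mult.assoc)
    have "z ^ n * s n - (case n of 0 \<Rightarrow> - l | Suc k \<Rightarrow> z ^ n * s k) = z ^ n * f n" for n
      by (cases n) (auto simp: s_def algebra_simps)
    then have "(\<lambda>n. z ^ n * f n) sums ((\<Sum>n. z ^ n * s n) - (z * (\<Sum>n. z ^ n * s n) + - l))"
      using sums_diff[OF A B] by simp
    then have "g m = (\<Sum>n. z ^ n * s n) - (z * (\<Sum>n. z ^ n * s n) + - l)"
      using g[of m] sums_unique2 by (simp add: z_def)
    then show "g m - l = of_real (1 - r m) * (\<Sum>n. of_real (r m) ^ n * s n)"
      by (simp add: z_def algebra_simps)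
  qed
  have "(\<lambda>m. g m - l) \<longlonglongrightarrow> 0"
  proof (rule LIMSEQ_I)
    fix e :: real assume e: "0 < e"
    obtain M where M: "\<And>n. n \<ge> M \<Longrightarrow> cmod (s n) < e / 2"
      using LIMSEQ_D[OF s, of "e / 2"] e by auto
    have "(\<lambda>m. (1 - r m) * (real M * K)) \<longlonglongrightarrow> (1 - 1) * (real M * K)"
      by (intro tendsto_intros r)
    then obtain m0 where m0: "\<And>m. m \<ge> m0 \<Longrightarrow> \<bar>(1 - r m) * (real M * K)\<bar> < e / 2"
      using LIMSEQ_D[of "\<lambda>m. (1 - r m) * (real M * K)" 0 "e / 2"] e by auto
    have "norm (g m - l - 0) < e" if "m \<ge> m0" for m
    proof -
      have r0: "0 < r m" "r m < 1" by (fact r)+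
      have geo: "summable (\<lambda>n. r m ^ n * (e / 2))"
        using r0 by (intro summable_mult2 summable_geometric) auto
      have fin: "summable (\<lambda>n. if n < M then K else 0)"
        by (rule summable_finite[of "{..<M}"]) auto
      have "cmod (\<Sum>n. of_real (r m) ^ n * s n) \<le> (\<Sum>n. cmod (of_real (r m) ^ n * s n))"
        by (rule summable_norm[OF summ])
      also have "\<dots> \<le> (\<Sum>n. (if n < M then K else 0) + r m ^ n * (e / 2))"
      proof (rule suminf_le[OF _ summ summable_add[OF fin geo]])
        show "cmod (of_real (r m) ^ n * s n) \<le> (if n < M then K else 0) + r m ^ n * (e / 2)" for n
        proof (cases "n < M")
          case True
          have "r m ^ n * cmod (s n) \<le> 1 * K"
            using r0 K by (intro mult_mono power_le_one) auto
          moreover have "0 \<le> r m ^ n * (e / 2)" using r0 e by simp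
          ultimately show ?thesis using True r0 by (simp add: norm_mult norm_power)
        next
          case False
          then show ?thesis
            using M[of n] r0 by (simp add: norm_mult norm_power mult_left_mono)
        qed
      qed
      also have "\<dots> = real M * K + 1 / (1 - r m) * (e / 2)"
      proof -
        have "(\<lambda>n. if n < M then K else 0) sums (\<Sum>n<M. K)"
          using sums_If_finite_set[of "{..<M}" "\<lambda>_. K"] by simp
        moreover have "(\<lambda>n. r m ^ n * (e / 2)) sums (1 / (1 - r m) * (e / 2))"
          using r0 by (intro sums_mult2 geometric_sums) auto
        ultimately show ?thesis
          using sums_add sums_unique by fastforce
      qed
      finally have "(1 - r m) * cmod (\<Sum>n. of_real (r m) ^ n * s n) \<le> (1 - r m) * (real M * K + 1 / (1 - r m) * (e / 2))"
        using r0 by (intro mult_left_mono) auto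
      also have "\<dots> = (1 - r m) * (real M * K) + e / 2"
        using r0 by (simp add: field_simps)
      also have "\<dots> < e"
        using m0[OF that] by simp
      finally show ?thesis
        using r0 unfolding rep by (simp add: norm_mult del: of_real_diff)
    qed
    then show "\<exists>no. \<forall>n\<ge>no. norm (g n - l - 0) < e" by blast
  qed
  then show ?thesis
    by (rule LIM_zero_cancel)
qed

lemma circle_integrable_lt_1:
  fixes f :: "complex \<Rightarrow> complex"
  assumes "continuous_on (- {0, 1}) f" "0 < \<rho>" "\<rho> < 1"
  shows "integrable unit_measure (\<lambda>\<theta>. f (of_real \<rho> * circle \<theta>))"
proof -
  have cont: "continuous_on (sphere 0 \<rho>) f"
    by (rule continuous_on_subset[OF assms(1)]) (use assms in auto)
  then have "bounded (f ` sphere 0 \<rho>)"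
    by (intro compact_imp_bounded compact_continuous_image) auto
  then obtain K where K: "\<forall>x\<in>f ` sphere 0 \<rho>. norm x \<le> K"
    unfolding bounded_iff by blast
  show ?thesis
    by (rule circle_integrable[where K = K and f = f and \<rho> = \<rho>])
      (use K assms(2) in \<open>auto intro: continuous_on_subset[OF cont]\<close>)
qed

lemma circle_mean_add:
  assumes "integrable unit_measure (\<lambda>\<theta>. f (of_real \<rho> * circle \<theta>))"
    "integrable unit_measure (\<lambda>\<theta>. g (of_real \<rho> * circle \<theta>))"
  shows "circle_mean \<rho> (\<lambda>z. f z + g z) = circle_mean \<rho> f + circle_mean \<rho> g"
    "circle_mean \<rho> (\<lambda>z. f z - g z) = circle_mean \<rho> f - circle_mean \<rho> g"
  using assms by (simp_all add: circle_mean_def)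

lemma cmod_circle_mean_le:
  assumes "integrable unit_measure (\<lambda>\<theta>. f (of_real \<rho> * circle \<theta>))" "0 < \<rho>"
    and "\<And>z. cmod z = \<rho> \<Longrightarrow> z \<noteq> 1 \<Longrightarrow> cmod (f z) \<le> K"
  shows "cmod (circle_mean \<rho> f) \<le> K"
  unfolding circle_mean_def
proof (rule norm_integral_unit_measure_le[OF assms(1)])
  fix \<theta> :: real assume \<theta>: "0 < \<theta>" "\<theta> < 1"
  have "of_real \<rho> * circle \<theta> \<noteq> 1"
  proof
    assume 1: "of_real \<rho> * circle \<theta> = 1"
    then have "cmod (of_real \<rho> * circle \<theta>) = cmod 1"
      by (rule arg_cong)
    then have "\<bar>\<rho>\<bar> = 1"
      by (simp add: norm_mult)
    with assms(2) 1 circle_neq_1[OF \<theta>] show False by simp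
  qed
  then show "cmod (f (of_real \<rho> * circle \<theta>)) \<le> K"
    using assms(2) by (intro assms(3)) (auto simp: norm_mult)
qed

section \<open>The dilation\<close>

text \<open>What the analysis uses of a vessel: \<open>N\<close> collects the adjoints of the given
  operators, \<open>P\<close> is \<sigma> at \<xi>, and \<open>a t\<close> and \<open>b t\<close>
  are \<sigma> at t and \<gamma> at (\<xi>, t) multiplied by the inverse of \<open>P\<close>. The
  input condition becomes \<open>\<Phi>_N\<close>, and the colligation condition becomes
  \<open>N_skew\<close>.\<close>

locale dilation_data =
  fixes N :: "real^'d::finite \<Rightarrow> ('h::chilbert_space \<Rightarrow>\<^sub>C\<^sub>L 'h)"
    and \<Phi> :: "'h \<Rightarrow>\<^sub>C\<^sub>L 'e::chilbert_space" and P :: "'e \<Rightarrow>\<^sub>C\<^sub>L 'e"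
    and a b :: "real^'d \<Rightarrow> ('e \<Rightarrow>\<^sub>C\<^sub>L 'e)" and \<xi> :: "real^'d" and \<epsilon> :: real
  assumes linear_N: "linear N" and linear_a: "linear a" and linear_b: "linear b"
    and N_commute: "N s *\<^sub>V N t *\<^sub>V h = N t *\<^sub>V N s *\<^sub>V h"
    and P_herm: "cinner (P *\<^sub>V u) v = cinner u (P *\<^sub>V v)"
    and \<epsilon>: "0 < \<epsilon>" and P_coercive: "\<epsilon> * (norm u)\<^sup>2 \<le> Re (cinner (P *\<^sub>V u) u)"
    and a_sym: "cinner (P *\<^sub>V a t *\<^sub>V u) v = cinner (P *\<^sub>V u) (a t *\<^sub>V v)"
    and b_sym: "cinner (P *\<^sub>V b t *\<^sub>V u) v = cinner (P *\<^sub>V u) (b t *\<^sub>V v)"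
    and a_\<xi>: "a \<xi> = id_cblinfun"
    and \<Phi>_N: "\<Phi> *\<^sub>V N t *\<^sub>V h = a t *\<^sub>V \<Phi> *\<^sub>V N \<xi> *\<^sub>V h + b t *\<^sub>V \<Phi> *\<^sub>V h"
    and N_skew: "cinner (N t *\<^sub>V h) h' - cinner h (N t *\<^sub>V h') = - \<i> * cinner (P *\<^sub>V a t *\<^sub>V \<Phi> *\<^sub>V h) (\<Phi> *\<^sub>V h')"
    and D_commute: "(x *\<^sub>C a s + b s) o\<^sub>C\<^sub>L (x *\<^sub>C a t + b t) = (x *\<^sub>C a t + b t) o\<^sub>C\<^sub>L (x *\<^sub>C a s + b s)"
begin

section \<open>The inner product given by \<open>P\<close>\<close>

definition sp :: "'e \<Rightarrow> 'e \<Rightarrow> complex" where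
  "sp u v = cinner (P *\<^sub>V u) v"

lemma bounded_bilinear_sp: "bounded_bilinear sp"
  unfolding sp_def by (rule bounded_bilinear.comp1[OF bounded_bilinear_cinner bounded_linear_cblinfun_apply])

interpretation sp: bounded_bilinear sp
  by (rule bounded_bilinear_sp)

lemma sp_scaleC_left: "sp (c *\<^sub>C u) v = c * sp u v"
  and sp_scaleC_right: "sp u (c *\<^sub>C v) = cnj c * sp u v"
  by (simp_all add: sp_def cblinfun_linear cinner_simps)

lemma sp_commute: "sp u v = cnj (sp v u)"
  unfolding sp_def by (subst P_herm) (rule cinner_commute)

lemma sp_self: "sp u u = of_real (Re (sp u u))"
  using arg_cong[OF sp_commute[of u u], of Im] by (simp add: complex_eq_iff)

lemma sp_coercive: "\<epsilon> * (norm u)\<^sup>2 \<le> Re (sp u u)"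
  unfolding sp_def by (rule P_coercive)

lemma sp_nonneg: "0 \<le> Re (sp u u)"
  using order_trans[OF _ sp_coercive] \<epsilon> by simp

lemma sp_self_le: "Re (sp u u) \<le> norm P * (norm u)\<^sup>2"
  unfolding sp_def power2_eq_square mult.assoc[symmetric]
  by (rule order_trans[OF complex_Re_le_cmod order_trans[OF cmod_cinner_le mult_right_mono[OF norm_cblinfun_apply]]]) simp

lemma sp_cauchy_schwarz: "(cmod (sp u v))\<^sup>2 \<le> Re (sp u u) * Re (sp v v)"
proof (rule discriminant_bound[OF _ sp_nonneg])
  fix c
  have "0 \<le> Re (sp (u - c *\<^sub>C v) (u - c *\<^sub>C v))"
    by (rule sp_nonneg)
  also have "sp (u - c *\<^sub>C v) (u - c *\<^sub>C v) = sp u u - cnj c * sp u v - (c * cnj (sp u v) - (c * cnj c) * sp v v)"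
    unfolding sp.diff_left sp.diff_right sp_scaleC_left sp_scaleC_right
    by (simp add: algebra_simps flip: sp_commute[of v u])
  also have "Re \<dots> = Re (sp u u) - 2 * Re (cnj c * sp u v) + (cmod c)\<^sup>2 * Re (sp v v)"
    by (simp add: complex_norm_square[symmetric] del: of_real_power)
  finally show "0 \<le> Re (sp u u) - 2 * Re (cnj c * sp u v) + (cmod c)\<^sup>2 * Re (sp v v)" .
qed

lemma sp_young: "cmod (sp u v) \<le> (Re (sp u u) + Re (sp v v)) / 2"
proof (rule power2_le_imp_le)
  have "(cmod (sp u v))\<^sup>2 \<le> Re (sp u u) * Re (sp v v)"
    by (rule sp_cauchy_schwarz)
  also have "\<dots> \<le> ((Re (sp u u) + Re (sp v v)) / 2)\<^sup>2"
    using zero_le_power2[of "Re (sp u u) - Re (sp v v)"] by (simp add: power2_eq_square algebra_simps)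
  finally show "(cmod (sp u v))\<^sup>2 \<le> ((Re (sp u u) + Re (sp v v)) / 2)\<^sup>2" .
qed (use sp_nonneg in simp)

lemma sp_bound: "cmod (sp u v) \<le> norm P * norm u * norm v"
  unfolding sp_def by (rule order_trans[OF cmod_cinner_le mult_right_mono[OF norm_cblinfun_apply]]) simp

lemma N_skew': "cinner (N t *\<^sub>V h) h' - cinner h (N t *\<^sub>V h') = - \<i> * sp (a t *\<^sub>V \<Phi> *\<^sub>V h) (\<Phi> *\<^sub>V h')"
  unfolding sp_def by (rule N_skew)

section \<open>Resolvents and the Cayley transform\<close>

definition is_resolvent :: "real \<Rightarrow> ('h \<Rightarrow>\<^sub>C\<^sub>L 'h) \<Rightarrow> bool" where
  "is_resolvent \<kappa> B \<longleftrightarrow> (\<forall>x. B *\<^sub>V (x + (\<i> * \<kappa>) *\<^sub>C (N \<xi> *\<^sub>V x)) = x) \<and>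
     (\<forall>x. B *\<^sub>V x + (\<i> * \<kappa>) *\<^sub>C (N \<xi> *\<^sub>V B *\<^sub>V x) = x) \<and> norm B \<le> 1"

definition resol :: "real \<Rightarrow> ('h \<Rightarrow>\<^sub>C\<^sub>L 'h)" where
  "resol \<kappa> = (SOME B. is_resolvent \<kappa> B)"

lemma Im_N_\<xi>: "Im (cinner (N \<xi> *\<^sub>V h) h) \<le> 0"
proof -
  have "cinner h (N \<xi> *\<^sub>V h) = cnj (cinner (N \<xi> *\<^sub>V h) h)"
    by (rule cinner_commute)
  then have "2 * Im (cinner (N \<xi> *\<^sub>V h) h) = - Re (sp (\<Phi> *\<^sub>V h) (\<Phi> *\<^sub>V h))"
    using arg_cong[OF N_skew'[of \<xi> h h], of Im] by (simp add: a_\<xi>)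
  then show ?thesis
    using sp_nonneg[of "\<Phi> *\<^sub>V h"] by simp
qed

lemma is_resolvent_resol:
  assumes "0 \<le> \<kappa>" shows "is_resolvent \<kappa> (resol \<kappa>)"
proof -
  let ?A = "id_cblinfun + (\<i> * \<kappa>) *\<^sub>C N \<xi>"
  have "1 * (norm x)\<^sup>2 \<le> Re (cinner (?A *\<^sub>V x) x)" for x
    using mult_nonneg_nonpos[OF assms Im_N_\<xi>[of x]]
    by (simp add: cinner_simps cinner_self)
  from coercive_invertible[OF _ this] obtain B where "\<And>x. ?A *\<^sub>V B *\<^sub>V x = x" "\<And>x. B *\<^sub>V ?A *\<^sub>V x = x" "norm B \<le> 1"
    by auto
  then have "is_resolvent \<kappa> B"
    by (simp add: is_resolvent_def)
  then show ?thesis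
    unfolding resol_def by (rule someI)
qed

lemma resol_left: "0 \<le> \<kappa> \<Longrightarrow> resol \<kappa> *\<^sub>V (x + (\<i> * \<kappa>) *\<^sub>C (N \<xi> *\<^sub>V x)) = x"
  and resol_right: "0 \<le> \<kappa> \<Longrightarrow> resol \<kappa> *\<^sub>V x + (\<i> * \<kappa>) *\<^sub>C (N \<xi> *\<^sub>V resol \<kappa> *\<^sub>V x) = x"
  and norm_resol: "0 \<le> \<kappa> \<Longrightarrow> norm (resol \<kappa>) \<le> 1"
  using is_resolvent_resol[of \<kappa>] by (auto simp: is_resolvent_def)

lemma resol_commute:
  assumes "0 \<le> \<kappa>" shows "N t *\<^sub>V resol \<kappa> *\<^sub>V x = resol \<kappa> *\<^sub>V N t *\<^sub>V x"
proof -
  define y where "y = resol \<kappa> *\<^sub>V x"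
  have x: "x = y + (\<i> * \<kappa>) *\<^sub>C (N \<xi> *\<^sub>V y)"
    unfolding y_def by (rule resol_right[OF assms, symmetric])
  have "N t *\<^sub>V x = N t *\<^sub>V y + (\<i> * \<kappa>) *\<^sub>C (N \<xi> *\<^sub>V N t *\<^sub>V y)"
    by (simp add: x cblinfun_linear N_commute[of t \<xi>])
  then show ?thesis
    using resol_left[OF assms, of "N t *\<^sub>V y"] by (simp add: y_def)
qed

text \<open>Algebraically this is \<open>N \<xi> + \<i>\<close> times the inverse of
  \<open>N \<xi> - \<i>\<close>, that is, the inverse of \<open>half_plane\<close> evaluated at
  \<open>N \<xi>\<close>.\<close>

definition G :: "'h \<Rightarrow>\<^sub>C\<^sub>L 'h" where
  "G = id_cblinfun - 2 *\<^sub>R resol 1"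

text \<open>The factor is chosen so that \<open>G_defect\<close> holds without a constant.\<close>

definition \<Psi> :: "'h \<Rightarrow>\<^sub>C\<^sub>L 'e" where
  "\<Psi> = sqrt 2 *\<^sub>R (\<Phi> o\<^sub>C\<^sub>L resol 1)"

lemma N_G: "N t *\<^sub>V G *\<^sub>V x = G *\<^sub>V N t *\<^sub>V x"
  by (simp add: G_def cblinfun_linear resol_commute)

lemma N_G_power: "N t *\<^sub>V cpower G n *\<^sub>V x = cpower G n *\<^sub>V N t *\<^sub>V x"
  by (induction n) (auto simp: N_G)

lemma \<Psi>_N: "\<Psi> *\<^sub>V N t *\<^sub>V h = a t *\<^sub>V \<Psi> *\<^sub>V N \<xi> *\<^sub>V h + b t *\<^sub>V \<Psi> *\<^sub>V h"
  using \<Phi>_N[of t "resol 1 *\<^sub>V h"]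
  by (simp add: \<Psi>_def cblinfun_linear resol_commute scaleR_add_right)

text \<open>With \<open>k = resol 1 *\<^sub>V h\<close> the vectors h and \<open>G h\<close> are
  \<open>\<i> N \<xi> k + k\<close> and \<open>\<i> N \<xi> k - k\<close>. In the difference of the
  products only the cross terms survive, and these form the skew part of
  \<open>N \<xi>\<close>.\<close>

lemma G_defect: "cinner h h' - cinner (G *\<^sub>V h) (G *\<^sub>V h') = sp (\<Psi> *\<^sub>V h) (\<Psi> *\<^sub>V h')"
proof -
  define k k' where "k = resol 1 *\<^sub>V h" and "k' = resol 1 *\<^sub>V h'"
  have h: "h = k + \<i> *\<^sub>C (N \<xi> *\<^sub>V k)" "h' = k' + \<i> *\<^sub>C (N \<xi> *\<^sub>V k')"
    using resol_right[of 1 h] resol_right[of 1 h'] by (simp_all add: k_def k'_def)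
  have "cinner h h' - cinner (G *\<^sub>V h) (G *\<^sub>V h') = 2 * cinner k h' + 2 * cinner h k' - 4 * cinner k k'"
    by (simp add: G_def cinner_simps flip: k_def k'_def)
  also have "\<dots> = 2 * \<i> * (cinner (N \<xi> *\<^sub>V k) k' - cinner k (N \<xi> *\<^sub>V k'))"
    unfolding h by (simp add: cinner_simps algebra_simps)
  also have "\<dots> = 2 * sp (\<Phi> *\<^sub>V k) (\<Phi> *\<^sub>V k')"
    unfolding N_skew' by (simp add: a_\<xi>)
  also have "\<dots> = sp (\<Psi> *\<^sub>V h) (\<Psi> *\<^sub>V h')"
  proof -
    have "complex_of_real (sqrt 2) * of_real (sqrt 2) = 2"
      by (simp flip: of_real_mult)
    then show ?thesis
      by (simp add: \<Psi>_def sp.scaleR_left sp.scaleR_right scaleR_conv_of_real mult.assoc[symmetric] flip: k_def k'_def)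
  qed
  finally show ?thesis .
qed

lemma G_power_defect:
  "(\<Sum>i<n. sp (\<Psi> *\<^sub>V cpower G i *\<^sub>V h) (\<Psi> *\<^sub>V cpower G i *\<^sub>V h'))
    = cinner h h' - cinner (cpower G n *\<^sub>V h) (cpower G n *\<^sub>V h')"
  by (induction n) (simp_all add: G_defect[symmetric])

section \<open>The pencil on the disc and its action on the series\<close>

definition D :: "complex \<Rightarrow> real^'d \<Rightarrow> ('e \<Rightarrow>\<^sub>C\<^sub>L 'e)" where
  "D x t = x *\<^sub>C a t + b t"

lemma continuous_on_D: "continuous_on S f \<Longrightarrow> continuous_on S (\<lambda>z. D (f z) t)"
  unfolding D_def by (intro continuous_intros continuous_on_scaleC_cblinfun)

lemma norm_D_le: "norm (D x t) \<le> cmod x * norm (a t) + norm (b t)"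
  unfolding D_def by (intro norm_triangle_le add_mono norm_scaleC_cblinfun_le order_refl)

lemma holomorphic_D_power: "(\<lambda>z. sp (cpower (D (half_plane z) t) k *\<^sub>V u) v) holomorphic_on ball 0 1"
proof (induction k arbitrary: u)
  case (Suc k)
  have "sp (cpower (D (half_plane z) t) (Suc k) *\<^sub>V u) v
      = half_plane z * sp (cpower (D (half_plane z) t) k *\<^sub>V a t *\<^sub>V u) v + sp (cpower (D (half_plane z) t) k *\<^sub>V b t *\<^sub>V u) v" for z
    unfolding cpower_Suc_right by (simp add: D_def cblinfun_linear sp.add_left sp_scaleC_left)
  then show ?case
    by (simp only:) (intro holomorphic_intros Suc holomorphic_half_plane)
qed (simp add: holomorphic_on_const)

text \<open>This is \<open>half_plane\<close> evaluated at \<open>r G\<close>; for r = 1 it would be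
  \<open>N \<xi>\<close>.\<close>

definition \<Lambda> :: "real \<Rightarrow> ('h \<Rightarrow>\<^sub>C\<^sub>L 'h)" where
  "\<Lambda> r = (N \<xi> - (\<i> * ((1 - r) / (1 + r))) *\<^sub>C id_cblinfun) o\<^sub>C\<^sub>L resol ((1 - r) / (1 + r))"

text \<open>This is the inverse of \<open>id_cblinfun - r *\<^sub>R G\<close>, written with a
  resolvent of \<open>N \<xi>\<close>.\<close>

definition Mop :: "real \<Rightarrow> ('h \<Rightarrow>\<^sub>C\<^sub>L 'h)" where
  "Mop r = (1 / (1 + r)) *\<^sub>R ((id_cblinfun + \<i> *\<^sub>C N \<xi>) o\<^sub>C\<^sub>L resol ((1 - r) / (1 + r)))"

text \<open>The operator form, with w = r G, of the scalar identity h(z) - h(w) = (h(z) + \<i>) (1 -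
  w / z) / (1 - w) for h = \<open>half_plane\<close>. The factor 1 - w / z is what telescopes along
  the powers of \<open>r G\<close>.\<close>

lemma half_plane_minus_\<Lambda>:
  assumes r: "0 < r" "r < 1" and z: "z \<noteq> 0" "z \<noteq> 1"
  shows "half_plane z *\<^sub>C x - \<Lambda> r *\<^sub>V x = (half_plane z + \<i>) *\<^sub>C (Mop r *\<^sub>V (x - (r / z) *\<^sub>C (G *\<^sub>V x)))"
proof -
  define \<kappa> where "\<kappa> = (1 - r) / (1 + r)"
  have \<kappa>: "0 \<le> \<kappa>" using r by (simp add: \<kappa>_def)
  define u where "u = resol \<kappa> *\<^sub>V x"
  define n where "n = \<i> *\<^sub>C (N \<xi> *\<^sub>V u)"
  have x: "x = u + \<kappa> *\<^sub>C n"
    using resol_right[OF \<kappa>, of x] by (simp add: u_def n_def mult.commute)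
  have Nu: "N \<xi> *\<^sub>V u = (- \<i>) *\<^sub>C n"
    by (simp add: n_def)
  have \<Lambda>: "\<Lambda> r *\<^sub>V x = (- \<i>) *\<^sub>C n - (\<i> * \<kappa>) *\<^sub>C u"
    by (simp add: \<Lambda>_def Nu flip: \<kappa>_def u_def)
  have Mx: "Mop r *\<^sub>V x = (1 / (1 + r)) *\<^sub>R (u + n)"
    by (simp add: Mop_def flip: \<kappa>_def u_def n_def)
  have "Mop r *\<^sub>V G *\<^sub>V x = (1 / (1 + r)) *\<^sub>R (n - u)"
  proof -
    define y where "y = resol \<kappa> *\<^sub>V resol 1 *\<^sub>V x"
    have "y + \<i> *\<^sub>C (N \<xi> *\<^sub>V y) = resol \<kappa> *\<^sub>V (resol 1 *\<^sub>V x + \<i> *\<^sub>C (N \<xi> *\<^sub>V resol 1 *\<^sub>V x))"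
      by (simp add: y_def cblinfun_linear resol_commute[OF \<kappa>])
    also have "\<dots> = u"
      using resol_right[of 1 x] by (simp add: u_def)
    finally have y: "y + \<i> *\<^sub>C (N \<xi> *\<^sub>V y) = u" .
    define v where "v = resol \<kappa> *\<^sub>V G *\<^sub>V x"
    have v: "v = u - 2 *\<^sub>R y"
      by (simp add: v_def G_def cblinfun_linear y_def u_def)
    have "Mop r *\<^sub>V G *\<^sub>V x = (1 / (1 + r)) *\<^sub>R (v + \<i> *\<^sub>C (N \<xi> *\<^sub>V v))"
      by (simp add: Mop_def flip: \<kappa>_def v_def)
    also have "v + \<i> *\<^sub>C (N \<xi> *\<^sub>V v) = (u + n) - 2 *\<^sub>R (y + \<i> *\<^sub>C (N \<xi> *\<^sub>V y))"
      unfolding v by (simp add: cblinfun_linear scaleC_diff_right scaleC_scaleR n_def algebra_simps)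
    finally show ?thesis
      by (simp add: y scaleR_2)
  qed
  then have "Mop r *\<^sub>V (x - (r / z) *\<^sub>C (G *\<^sub>V x)) = (1 / (1 + r)) *\<^sub>R (u + n) - (r / z) *\<^sub>C (1 / (1 + r)) *\<^sub>R (n - u)"
    by (simp only: cblinfun_linear Mx)
  also have "\<dots> = (1 / (1 + r) * (1 + r / z)) *\<^sub>C u + (1 / (1 + r) * (1 - r / z)) *\<^sub>C n"
  proof -
    have "q *\<^sub>C (u + n) - p *\<^sub>C q *\<^sub>C (n - u) = (q * (1 + p)) *\<^sub>C u + (q * (1 - p)) *\<^sub>C n" for p q
      by (simp add: scaleC_add_right scaleC_diff_right distrib_left right_diff_distrib
          scaleC_add_left scaleC_diff_left mult.commute[of p])
    from this[of "1 / (1 + r)" "r / z"] show ?thesis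
      by (simp add: scaleR_scaleC)
  qed
  finally have M: "Mop r *\<^sub>V (x - (r / z) *\<^sub>C (G *\<^sub>V x)) = (1 / (1 + r) * (1 + r / z)) *\<^sub>C u + (1 / (1 + r) * (1 - r / z)) *\<^sub>C n" .
  have r1: "complex_of_real r + 1 \<noteq> 0" "1 + complex_of_real r \<noteq> 0" and z1: "1 - z \<noteq> 0"
    using r z(2) by (auto simp: complex_eq_iff)
  have 1: "(half_plane z + \<i>) * (1 / (1 + r) * (1 + r / z)) = half_plane z + \<i> * \<kappa>"
    "(half_plane z + \<i>) * (1 / (1 + r) * (1 - r / z)) = half_plane z * \<kappa> + \<i>"
    using r1 z1 z(1) by (simp_all add: half_plane_def \<kappa>_def divide_simps) (simp_all add: algebra_simps)
  show ?thesis
    unfolding M scaleC_add_right scaleC_scaleC 1 \<Lambda> by (subst x) (simp add: scaleC_add_right scaleC_add_left algebra_simps)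
qed

text \<open>The effect of one application of the pencil on the coefficient operator \<open>Y\<close>
  of the series, with \<open>half_plane z\<close> traded for \<open>\<Lambda> r\<close>. By
  \<open>\<Psi>_N\<close>, for r = 1 it would multiply \<Psi> on the right by
  \<open>N t\<close>.\<close>

definition Lop :: "real^'d \<Rightarrow> real \<Rightarrow> ('h \<Rightarrow>\<^sub>C\<^sub>L 'e) \<Rightarrow> ('h \<Rightarrow>\<^sub>C\<^sub>L 'e)" where
  "Lop t r Y = a t o\<^sub>C\<^sub>L Y o\<^sub>C\<^sub>L \<Lambda> r + b t o\<^sub>C\<^sub>L Y"

lemma norm_G_power_le: "norm (cpower G n *\<^sub>V h) \<le> norm h"
proof (induction n)
  case (Suc n)
  have "norm (G *\<^sub>V x) \<le> norm x" for x
  proof (rule power2_le_imp_le)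
    have "Re (cinner x x - cinner (G *\<^sub>V x) (G *\<^sub>V x)) \<ge> 0"
      unfolding G_defect by (rule sp_nonneg)
    then show "(norm (G *\<^sub>V x))\<^sup>2 \<le> (norm x)\<^sup>2"
      by (simp add: cinner_self del: of_real_power)
  qed simp
  then show ?case
    using Suc order_trans by simp blast
qed simp

lemma continuous_on_D_power:
  "continuous_on (- {0, 1}) (\<lambda>z. z ^ j * (1 / z) ^ n * sp (cpower (D (half_plane z) t) k *\<^sub>V u) v)"
  by (intro continuous_intros sp.continuous_on continuous_on_cpower continuous_on_D
      continuous_on_subset[OF continuous_on_half_plane]) auto

lemma integrable_D_power:
  assumes "0 < \<rho>" "\<rho> < 1"
  shows "integrable unit_measure (\<lambda>\<theta>. (\<lambda>z. z ^ j * (1 / z) ^ n * sp (cpower (D (half_plane z) t) k *\<^sub>V u) v) (of_real \<rho> * circle \<theta>))"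
  by (rule circle_integrable_lt_1[OF continuous_on_D_power assms])

text \<open>Induction on \<open>k\<close>: by \<open>half_plane_minus_\<Lambda>\<close>, replacing \<open>half_plane z\<close> by \<open>\<Lambda> r\<close> changes
  the series by a telescoping sum.\<close>

lemma D_power_sums:
  assumes r: "0 < r" "r < \<rho>" "\<rho> < 1"
  shows "(\<lambda>n. circle_mean \<rho> (\<lambda>z. z ^ j * (1 / z) ^ n *
      sp (cpower (D (half_plane z) t) k *\<^sub>V Y *\<^sub>V (r ^ n *\<^sub>R (cpower G n *\<^sub>V h))) v))
    sums sp ((Lop t r ^^ k) Y *\<^sub>V (r ^ j *\<^sub>R (cpower G j *\<^sub>V h))) v"
proof (induction k arbitrary: Y)
  case 0
  have "(\<lambda>n. circle_mean \<rho> (\<lambda>z. z ^ j * (1 / z) ^ n *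
      sp (cpower (D (half_plane z) t) 0 *\<^sub>V Y *\<^sub>V (r ^ n *\<^sub>R (cpower G n *\<^sub>V h))) v))
    = (\<lambda>n. if n = j then sp (Y *\<^sub>V (r ^ n *\<^sub>R (cpower G n *\<^sub>V h))) v else 0)"
  proof
    fix n
    have "circle_mean \<rho> (\<lambda>z. z ^ j * (1 / z) ^ n * c) = circle_mean \<rho> (\<lambda>z. z ^ j * (1 / z) ^ n) * c" for c
      unfolding circle_mean_def by (rule integral_mult_left_zero)
    then show "circle_mean \<rho> (\<lambda>z. z ^ j * (1 / z) ^ n *
      sp (cpower (D (half_plane z) t) 0 *\<^sub>V Y *\<^sub>V (r ^ n *\<^sub>R (cpower G n *\<^sub>V h))) v)
      = (if n = j then sp (Y *\<^sub>V (r ^ n *\<^sub>R (cpower G n *\<^sub>V h))) v else 0)"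
      using circle_mean_powers[of \<rho> j n] r by auto
  qed
  then show ?case
    using sums_single[of j "\<lambda>n. sp (Y *\<^sub>V (r ^ n *\<^sub>R (cpower G n *\<^sub>V h))) v"] by simp
next
  case (Suc k)
  define x where "x n = r ^ n *\<^sub>R (cpower G n *\<^sub>V h)" for n
  have x_Suc: "x (Suc n) = r *\<^sub>R (G *\<^sub>V x n)" for n
    by (simp add: x_def cblinfun_linear)
  have x_le: "norm (x n) \<le> r ^ n * norm h" for n
    using norm_G_power_le[of n h] r by (simp add: x_def mult_left_mono)
  have \<rho>: "0 < \<rho>" using r by simp
  define Z where "Z = a t o\<^sub>C\<^sub>L Y o\<^sub>C\<^sub>L Mop r"
  define f where "f n z = z ^ j * (1 / z) ^ n * sp (cpower (D (half_plane z) t) k *\<^sub>V Lop t r Y *\<^sub>V x n) v" for n z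
  define g where "g n z = (half_plane z + \<i>) * (z ^ j * (1 / z) ^ n * sp (cpower (D (half_plane z) t) k *\<^sub>V Z *\<^sub>V x n) v)" for n z
  have cont_g: "continuous_on (- {0, 1}) (g n)" for n
    unfolding g_def
    by (intro continuous_on_mult continuous_on_D_power continuous_on_add continuous_on_const
        continuous_on_subset[OF continuous_on_half_plane]) auto
  have int_g: "integrable unit_measure (\<lambda>\<theta>. g n (of_real \<rho> * circle \<theta>))" for n
    by (rule circle_integrable_lt_1[OF cont_g \<rho> r(3)])
  have int_f: "integrable unit_measure (\<lambda>\<theta>. f n (of_real \<rho> * circle \<theta>))" for n
    unfolding f_def by (rule integrable_D_power[OF \<rho> r(3)])
  have split: "z ^ j * (1 / z) ^ n * sp (cpower (D (half_plane z) t) (Suc k) *\<^sub>V Y *\<^sub>V x n) v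
      = f n z + (g n z - g (Suc n) z)" if "z \<noteq> 0" "z \<noteq> 1" for n z
  proof -
    define y where "y = x n - (1 / z) *\<^sub>C x (Suc n)"
    have "half_plane z *\<^sub>C x n = \<Lambda> r *\<^sub>V x n + (half_plane z + \<i>) *\<^sub>C (Mop r *\<^sub>V y)"
      using half_plane_minus_\<Lambda>[of r z "x n"] r that by (simp add: y_def x_Suc scaleR_scaleC algebra_simps)
    then have "D (half_plane z) t *\<^sub>V Y *\<^sub>V x n = Lop t r Y *\<^sub>V x n + (half_plane z + \<i>) *\<^sub>C (Z *\<^sub>V y)"
      by (simp add: D_def Lop_def Z_def cblinfun_add_right flip: cblinfun_scaleC_right)
    then show ?thesis
      unfolding cpower_Suc_right f_def g_def y_def
      by (simp add: cblinfun_linear sp.add_left sp.diff_left sp_scaleC_left algebra_simps)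
  qed
  have mean: "circle_mean \<rho> (\<lambda>z. z ^ j * (1 / z) ^ n * sp (cpower (D (half_plane z) t) (Suc k) *\<^sub>V Y *\<^sub>V x n) v)
      = circle_mean \<rho> (f n) + (circle_mean \<rho> (g n) - circle_mean \<rho> (g (Suc n)))" for n
  proof -
    have "of_real \<rho> * circle \<theta> \<noteq> 0 \<and> of_real \<rho> * circle \<theta> \<noteq> 1" for \<theta>
    proof -
      have "cmod (of_real \<rho> * circle \<theta>) = \<rho>"
        using \<rho> by (simp add: norm_mult)
      then show ?thesis using \<rho> r(3) by force
    qed
    then have "circle_mean \<rho> (\<lambda>z. z ^ j * (1 / z) ^ n * sp (cpower (D (half_plane z) t) (Suc k) *\<^sub>V Y *\<^sub>V x n) v)
        = circle_mean \<rho> (\<lambda>z. f n z + (g n z - g (Suc n) z))"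
      unfolding circle_mean_def by (intro Bochner_Integration.integral_cong refl split) auto
    also have "\<dots> = circle_mean \<rho> (f n) + (circle_mean \<rho> (g n) - circle_mean \<rho> (g (Suc n)))"
      by (simp only: circle_mean_add int_f int_g Bochner_Integration.integrable_diff)
    finally show ?thesis .
  qed
  \<comment> \<open>The function \<open>g 0\<close> is holomorphic up to the origin, and its factor
    \<open>half_plane z + \<i>\<close> vanishes there.\<close>
  have "circle_mean \<rho> (g 0) = 0"
  proof -
    have "(\<lambda>z. (half_plane z + \<i>) * (z ^ j * sp (cpower (D (half_plane z) t) k *\<^sub>V Z *\<^sub>V x 0) v)) holomorphic_on ball 0 1"
      by (intro holomorphic_intros holomorphic_half_plane holomorphic_D_power)
    from circle_mean_holomorphic[OF this \<rho> r(3)] show ?thesis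
      by (simp add: g_def[abs_def])
  qed
  \<comment> \<open>Here r < \<rho> matters: \<open>x n\<close> decays like the n-th power of r,
    while the factor \<open>(1 / z) ^ n\<close> grows like the n-th power of 1 / \<rho>.\<close>
  moreover have "(\<lambda>n. circle_mean \<rho> (g n)) \<longlonglongrightarrow> 0"
  proof (rule Lim_null_comparison)
    define C where "C = 2 / (1 - \<rho>)"
    define E where "E = C * norm (a t) + norm (b t)"
    define K where "K = (C + 1) * (norm P * (E ^ k * (norm Z * norm h)) * norm v)"
    have "0 \<le> C" "0 \<le> E"
      using r by (auto simp: C_def E_def)
    show "\<forall>\<^sub>F n in sequentially. norm (circle_mean \<rho> (g n)) \<le> K * (r / \<rho>) ^ n"
    proof (intro always_eventually allI cmod_circle_mean_le int_g \<rho>)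
      fix n z assume z: "cmod z = \<rho>" "z \<noteq> 1"
      have C: "cmod (half_plane z) \<le> C"
        unfolding C_def by (rule cmod_half_plane_le[OF z(1) r(3)])
      then have "norm (D (half_plane z) t) \<le> E"
        unfolding E_def by (intro order_trans[OF norm_D_le] add_mono mult_right_mono) auto
      then have "norm (cpower (D (half_plane z) t) k *\<^sub>V Z *\<^sub>V x n) \<le> E ^ k * (norm Z * (r ^ n * norm h))"
        by (intro order_trans[OF norm_cpower_le] mult_mono power_mono order_trans[OF norm_cblinfun_apply] x_le)
          (use \<open>0 \<le> E\<close> in auto)
      then have "cmod (sp (cpower (D (half_plane z) t) k *\<^sub>V Z *\<^sub>V x n) v) \<le> norm P * (E ^ k * (norm Z * (r ^ n * norm h))) * norm v"
        by (intro order_trans[OF sp_bound] mult_right_mono mult_left_mono) auto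
      moreover have "cmod (half_plane z + \<i>) \<le> C + 1"
        using norm_triangle_ineq[of "half_plane z" \<i>] C by simp
      moreover have "cmod (z ^ j * (1 / z) ^ n) \<le> 1 * (1 / \<rho>) ^ n"
        unfolding norm_mult norm_power using z \<rho> r(3)
        by (intro mult_mono power_le_one) (auto simp: norm_divide norm_power)
      ultimately have "cmod (g n z) \<le> (C + 1) * (1 * (1 / \<rho>) ^ n * (norm P * (E ^ k * (norm Z * (r ^ n * norm h))) * norm v))"
        unfolding g_def norm_mult[of "half_plane z + \<i>"] norm_mult[of "z ^ j * (1 / z) ^ n"]
        using \<rho> \<open>0 \<le> C\<close> by (intro mult_mono) auto
      also have "\<dots> = K * (r / \<rho>) ^ n"
        by (simp add: K_def power_divide)
      finally show "cmod (g n z) \<le> K * (r / \<rho>) ^ n" .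
    qed
    have "(\<lambda>n. K * (r / \<rho>) ^ n) \<longlonglongrightarrow> K * 0"
      using r by (intro tendsto_intros LIMSEQ_power_zero) auto
    then show "(\<lambda>n. K * (r / \<rho>) ^ n) \<longlonglongrightarrow> 0" by simp
  qed
  ultimately have "(\<lambda>n. circle_mean \<rho> (g n) - circle_mean \<rho> (g (Suc n))) sums 0"
    using telescope_sums'[of "\<lambda>n. circle_mean \<rho> (g n)" 0] by simp
  moreover have "(\<lambda>n. circle_mean \<rho> (f n)) sums sp ((Lop t r ^^ k) (Lop t r Y) *\<^sub>V x j) v"
    using Suc.IH[of "Lop t r Y"] unfolding f_def x_def by simp
  ultimately have "(\<lambda>n. circle_mean \<rho> (f n) + (circle_mean \<rho> (g n) - circle_mean \<rho> (g (Suc n)))) sums (sp ((Lop t r ^^ k) (Lop t r Y) *\<^sub>V x j) v + 0)"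
    by (intro sums_add)
  then show ?case
    unfolding mean[symmetric] funpow_Suc_right comp_def by (simp add: x_def)
qed

section \<open>Exponentials of the pencil, up to the unit circle\<close>

definition expL :: "real^'d \<Rightarrow> real \<Rightarrow> ('h \<Rightarrow>\<^sub>C\<^sub>L 'e) \<Rightarrow> 'h \<Rightarrow> 'e \<Rightarrow> complex" where
  "expL t r Y h v = (\<Sum>k. (- \<i>) ^ k / fact k * sp ((Lop t r ^^ k) Y *\<^sub>V h) v)"

lemma norm_Lop_power_le:
  assumes "norm (\<Lambda> r) \<le> l"
  shows "norm ((Lop t r ^^ k) Y) \<le> (norm (a t) * l + norm (b t)) ^ k * norm Y"
proof (induction k)
  case (Suc k)
  have l: "0 \<le> l" using assms norm_ge_zero order_trans by blast
  have "norm (Lop t r Z) \<le> (norm (a t) * l + norm (b t)) * norm Z" for Z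
  proof -
    have "norm (a t o\<^sub>C\<^sub>L Z o\<^sub>C\<^sub>L \<Lambda> r) \<le> norm (a t) * norm Z * l"
      using assms by (intro order_trans[OF norm_cblinfun_compose] mult_mono norm_cblinfun_compose) auto
    then show ?thesis
      unfolding Lop_def using norm_triangle_ineq[of "a t o\<^sub>C\<^sub>L Z o\<^sub>C\<^sub>L \<Lambda> r" "b t o\<^sub>C\<^sub>L Z"] norm_cblinfun_compose[of "b t" Z]
      by (simp add: algebra_simps)
  qed
  then have "norm ((Lop t r ^^ Suc k) Y) \<le> (norm (a t) * l + norm (b t)) * norm ((Lop t r ^^ k) Y)"
    by simp
  also have "\<dots> \<le> (norm (a t) * l + norm (b t)) * ((norm (a t) * l + norm (b t)) ^ k * norm Y)"
    using l by (intro mult_left_mono Suc) auto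
  finally show ?case by (simp add: mult.assoc)
qed simp

lemma summable_expL: "summable (\<lambda>k. (- \<i>) ^ k / fact k * sp ((Lop t r ^^ k) Y *\<^sub>V h) v)"
proof (rule summable_norm_cancel, rule summable_comparison_test')
  define E where "E = norm (a t) * norm (\<Lambda> r) + norm (b t)"
  have "summable (\<lambda>k. (norm P * norm Y * norm h * norm v) * (E ^ k / fact k))"
    using summable_exp_generic[of E] by (intro summable_mult) (simp add: divide_inverse mult.commute)
  then show "summable (\<lambda>k. norm P * norm Y * norm h * norm v * (E ^ k / fact k))" .
  fix k :: nat
  have "cmod (sp ((Lop t r ^^ k) Y *\<^sub>V h) v) \<le> norm P * (E ^ k * norm Y * norm h) * norm v"
    unfolding E_def
    by (intro order_trans[OF sp_bound] mult_right_mono mult_left_mono order_trans[OF norm_cblinfun_apply] norm_Lop_power_le) auto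
  then have "cmod (sp ((Lop t r ^^ k) Y *\<^sub>V h) v) / fact k \<le> norm P * (E ^ k * norm Y * norm h) * norm v / fact k"
    by (rule divide_right_mono) simp
  then show "norm (norm ((- \<i>) ^ k / fact k * sp ((Lop t r ^^ k) Y *\<^sub>V h) v)) \<le> norm P * norm Y * norm h * norm v * (E ^ k / fact k)"
    by (simp add: norm_mult norm_divide norm_power mult_ac)
qed

lemma continuous_on_exp_D:
  "continuous_on (- {0, 1}) (\<lambda>z. z ^ j * (1 / z) ^ n * sp (exp_op ((- \<i>) *\<^sub>C D (half_plane z) t) *\<^sub>V u) v)"
  by (intro continuous_intros sp.continuous_on continuous_on_apply_cblinfun continuous_on_exp_op
      continuous_on_scaleC_cblinfun continuous_on_D continuous_on_subset[OF continuous_on_half_plane]) auto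

text \<open>On a circle of radius below 1 the pencil is bounded, so the exponential series can be
  inserted into the means. Its partial sums have a majorant \<open>M n\<close> that is geometric in
  n and uniform in the number of terms, and Tannery's theorem exchanges the limits.\<close>

lemma exp_D_sums_lt_1:
  assumes r: "0 < r" "r < \<rho>" "\<rho> < 1"
  shows "(\<lambda>n. circle_mean \<rho> (\<lambda>z. z ^ j * (1 / z) ^ n *
      sp (exp_op ((- \<i>) *\<^sub>C D (half_plane z) t) *\<^sub>V Y *\<^sub>V (r ^ n *\<^sub>R (cpower G n *\<^sub>V h))) v))
    sums expL t r Y (r ^ j *\<^sub>R (cpower G j *\<^sub>V h)) v"
proof -
  define x where "x n = r ^ n *\<^sub>R (cpower G n *\<^sub>V h)" for n
  have x_le: "norm (x n) \<le> r ^ n * norm h" for n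
    using norm_G_power_le[of n h] r by (simp add: x_def mult_left_mono)
  have \<rho>: "0 < \<rho>" using r by simp
  define A where "A z = (- \<i>) *\<^sub>C D (half_plane z) t" for z
  define C where "C = 2 / (1 - \<rho>) * norm (a t) + norm (b t)"
  define M where "M n = norm P * (exp C * (norm Y * norm h)) * norm v * (r / \<rho>) ^ n" for n
  have norm_A: "norm (A z) \<le> C" if "cmod z = \<rho>" for z
  proof -
    have "norm (A z) \<le> norm (D (half_plane z) t)"
      using norm_scaleC_cblinfun_le[of "- \<i>" "D (half_plane z) t"] by (simp add: A_def)
    also have "\<dots> \<le> C"
      unfolding C_def using cmod_half_plane_le[OF that r(3)]
      by (intro order_trans[OF norm_D_le] add_mono mult_right_mono) auto
    finally show ?thesis .
  qed
  define e where "e K n z = z ^ j * (1 / z) ^ n * sp (\<Sum>k<K. (cpower (A z) k *\<^sub>V Y *\<^sub>V x n) /\<^sub>R fact k) v" for K n z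
  define f where "f n z = z ^ j * (1 / z) ^ n * sp (exp_op (A z) *\<^sub>V Y *\<^sub>V x n) v" for n z
  have pow: "cmod (z ^ j * (1 / z) ^ n) \<le> 1 * (1 / \<rho>) ^ n" if "cmod z = \<rho>" for z n
    unfolding norm_mult norm_power using that \<rho> r(3)
    by (intro mult_mono power_le_one) (auto simp: norm_divide norm_power)
  have e_le: "cmod (e K n z) \<le> M n" if z: "cmod z = \<rho>" for K n z
  proof -
    have "norm (\<Sum>k<K. (cpower (A z) k *\<^sub>V Y *\<^sub>V x n) /\<^sub>R fact k) \<le> exp C * (norm Y * (r ^ n * norm h))"
      by (intro order_trans[OF partial_exp_le] mult_mono order_trans[OF norm_cblinfun_apply] x_le)
        (use norm_A[OF z] in auto)
    then have "cmod (sp (\<Sum>k<K. (cpower (A z) k *\<^sub>V Y *\<^sub>V x n) /\<^sub>R fact k) v) \<le> norm P * (exp C * (norm Y * (r ^ n * norm h))) * norm v"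
      by (intro order_trans[OF sp_bound] mult_right_mono mult_left_mono) auto
    then have "cmod (e K n z) \<le> 1 * (1 / \<rho>) ^ n * (norm P * (exp C * (norm Y * (r ^ n * norm h))) * norm v)"
      unfolding e_def norm_mult[of "z ^ j * (1 / z) ^ n"] using \<rho>
      by (intro mult_mono pow[OF z]) auto
    then show ?thesis by (simp add: M_def power_divide mult_ac)
  qed
  have e_eq: "e K n z = (\<Sum>k<K. (- \<i>) ^ k / fact k * (z ^ j * (1 / z) ^ n * sp (cpower (D (half_plane z) t) k *\<^sub>V Y *\<^sub>V x n) v))" for K n z
    unfolding e_def A_def sp.sum_left cpower_scaleC sp.scaleR_left sp_scaleC_left sum_distrib_left
    by (intro sum.cong refl) (simp add: scaleR_conv_of_real divide_inverse mult_ac)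
  have int_term: "integrable unit_measure (\<lambda>\<theta>. (of_real \<rho> * circle \<theta>) ^ j * (1 / (of_real \<rho> * circle \<theta>)) ^ n
      * sp (cpower (D (half_plane (of_real \<rho> * circle \<theta>)) t) k *\<^sub>V u) v)" for n k u
    by (rule integrable_D_power[OF \<rho> r(3)])
  have int_e: "integrable unit_measure (\<lambda>\<theta>. e K n (of_real \<rho> * circle \<theta>))" for K n
    unfolding e_eq by (intro Bochner_Integration.integrable_sum integrable_mult_right int_term)
  have int_f: "integrable unit_measure (\<lambda>\<theta>. f n (of_real \<rho> * circle \<theta>))" for n
    unfolding f_def A_def by (rule circle_integrable_lt_1[OF continuous_on_exp_D \<rho> r(3)])
  have e_sums: "(\<lambda>n. circle_mean \<rho> (e K n)) sums (\<Sum>k<K. (- \<i>) ^ k / fact k * sp ((Lop t r ^^ k) Y *\<^sub>V x j) v)" for K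
  proof -
    have "circle_mean \<rho> (e K n) = (\<Sum>k<K. (- \<i>) ^ k / fact k * circle_mean \<rho> (\<lambda>z. z ^ j * (1 / z) ^ n * sp (cpower (D (half_plane z) t) k *\<^sub>V Y *\<^sub>V x n) v))" for n
      unfolding circle_mean_def e_eq
      by (subst Bochner_Integration.integral_sum) (auto intro!: integrable_mult_right int_term simp only: integral_mult_right_zero)
    then show ?thesis
      using D_power_sums[OF r, of j t _ Y h v, folded x_def]
      by (simp only:) (intro sums_sum sums_mult)
  qed
  have e_lim: "(\<lambda>K. circle_mean \<rho> (e K n)) \<longlonglongrightarrow> circle_mean \<rho> (f n)" for n
    unfolding circle_mean_def
  proof (rule integral_dominated_convergence)
    show "integrable unit_measure (\<lambda>\<theta>. M n)" by simp
    show "AE \<theta> in unit_measure. (\<lambda>K. e K n (of_real \<rho> * circle \<theta>)) \<longlonglongrightarrow> f n (of_real \<rho> * circle \<theta>)"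
      unfolding e_def f_def using exp_op_sums unfolding sums_def
      by (intro AE_I2 tendsto_intros sp.tendsto) blast
    show "AE \<theta> in unit_measure. norm (e K n (of_real \<rho> * circle \<theta>)) \<le> M n" for K
      using \<rho> by (intro AE_I2 e_le) (simp add: norm_mult)
  qed (use int_e int_f borel_measurable_integrable in blast)+
  have "eventually (\<lambda>K. summable (\<lambda>n. norm (circle_mean \<rho> (e K n)))) sequentially \<and>
      summable (\<lambda>n. norm (circle_mean \<rho> (f n))) \<and>
      (\<lambda>K. \<Sum>n. circle_mean \<rho> (e K n)) \<longlonglongrightarrow> (\<Sum>n. circle_mean \<rho> (f n))"
  proof (rule tannerys_theorem[where M = M])
    show "\<forall>\<^sub>F (n, K) in sequentially \<times>\<^sub>F sequentially. norm (circle_mean \<rho> (e K n)) \<le> M n"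
      by (intro always_eventually) (auto intro!: cmod_circle_mean_le int_e \<rho> e_le)
    show "summable M"
      unfolding M_def using r by (intro summable_mult summable_geometric) auto
  qed (auto intro: e_lim)
  then have sf: "summable (\<lambda>n. norm (circle_mean \<rho> (f n)))"
    and lim: "(\<lambda>K. \<Sum>k<K. (- \<i>) ^ k / fact k * sp ((Lop t r ^^ k) Y *\<^sub>V x j) v) \<longlonglongrightarrow> (\<Sum>n. circle_mean \<rho> (f n))"
    using sums_unique[OF e_sums] by auto
  have "(\<Sum>n. circle_mean \<rho> (f n)) = expL t r Y (x j) v"
    unfolding expL_def by (rule LIMSEQ_unique[OF lim summable_LIMSEQ[OF summable_expL]])
  then have "(\<lambda>n. circle_mean \<rho> (f n)) sums expL t r Y (x j) v"
    using summable_sums[OF summable_norm_cancel[OF sf]] by simp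
  then show ?thesis
    by (simp add: f_def[abs_def] A_def x_def)
qed

text \<open>For x in the closed lower half-plane the operator
  \<open>(- \<i>) *\<^sub>C D x t\<close> has nonpositive real part for \<open>sp\<close>, because
  \<open>a t\<close> is nonnegative and \<open>b t\<close> symmetric. The bound is independent of x
  and hence survives near z = 1, where the pencil itself blows up.\<close>

lemma sp_exp_D_le:
  assumes a_pos: "\<And>u. 0 \<le> Re (sp (a t *\<^sub>V u) u)" and x: "Im x \<le> 0"
  shows "cmod (sp (exp_op ((- \<i>) *\<^sub>C D x t) *\<^sub>V u) v) \<le> norm P * norm u * norm v"
proof -
  have real_a: "Im (sp (a t *\<^sub>V u) u) = 0" and real_b: "Im (sp (b t *\<^sub>V u) u) = 0" for u
  proof -
    have "sp (a t *\<^sub>V u) u = cnj (sp (a t *\<^sub>V u) u)" "sp (b t *\<^sub>V u) u = cnj (sp (b t *\<^sub>V u) u)"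
      using sp_commute[of u "a t *\<^sub>V u"] sp_commute[of u "b t *\<^sub>V u"] a_sym[of t u u] b_sym[of t u u]
      by (simp_all add: sp_def)
    then show "Im (sp (a t *\<^sub>V u) u) = 0" "Im (sp (b t *\<^sub>V u) u) = 0"
      by (auto dest: arg_cong[of _ _ Im])
  qed
  have "Re (sp (exp_op ((- \<i>) *\<^sub>C D x t) *\<^sub>V u) (exp_op ((- \<i>) *\<^sub>C D x t) *\<^sub>V u)) \<le> Re (sp u u)"
  proof (rule exp_op_contraction[OF bounded_bilinear_sp sp_commute])
    show "Re (sp (((- \<i>) *\<^sub>C D x t) *\<^sub>V u) u) \<le> 0" for u
      using mult_nonpos_nonneg[OF x a_pos[of u]] real_a[of u] real_b[of u]
      by (simp add: D_def sp.add_left sp.minus_left sp_scaleC_left algebra_simps)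
  qed
  then have "Re (sp (exp_op ((- \<i>) *\<^sub>C D x t) *\<^sub>V u) (exp_op ((- \<i>) *\<^sub>C D x t) *\<^sub>V u)) * Re (sp v v)
      \<le> (norm P * (norm u)\<^sup>2) * (norm P * (norm v)\<^sup>2)"
    by (intro mult_mono sp_self_le sp_nonneg) (auto intro: order_trans[OF _ sp_self_le])
  then have "(cmod (sp (exp_op ((- \<i>) *\<^sub>C D x t) *\<^sub>V u) v))\<^sup>2 \<le> (norm P * norm u * norm v)\<^sup>2"
    using sp_cauchy_schwarz[of "exp_op ((- \<i>) *\<^sub>C D x t) *\<^sub>V u" v] by (simp add: power2_eq_square mult_ac)
  then show ?thesis
    by (rule power2_le_imp_le) simp
qed

text \<open>For fixed r the value of the sum is the same for all radii between r and 1. The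
  contraction bound dominates the means uniformly in the radius, so the radius may tend to
  1.\<close>

lemma exp_D_sums_1:
  assumes a_pos: "\<And>u. 0 \<le> Re (sp (a t *\<^sub>V u) u)" and r: "0 < r" "r < 1"
  shows "(\<lambda>n. circle_mean 1 (\<lambda>z. z ^ j * (1 / z) ^ n *
      sp (exp_op ((- \<i>) *\<^sub>C D (half_plane z) t) *\<^sub>V Y *\<^sub>V (r ^ n *\<^sub>R (cpower G n *\<^sub>V h))) v))
    sums expL t r Y (r ^ j *\<^sub>R (cpower G j *\<^sub>V h)) v"
proof -
  define x where "x n = r ^ n *\<^sub>R (cpower G n *\<^sub>V h)" for n
  have x_le: "norm (x n) \<le> r ^ n * norm h" for n
    using norm_G_power_le[of n h] r by (simp add: x_def mult_left_mono)
  define f where "f n z = z ^ j * (1 / z) ^ n * sp (exp_op ((- \<i>) *\<^sub>C D (half_plane z) t) *\<^sub>V Y *\<^sub>V x n) v" for n z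
  \<comment> \<open>All radii are kept above the midpoint of r and 1; then r / \<rho>0 < 1 makes the
    majorant \<open>M\<close> summable.\<close>
  define \<rho>0 where "\<rho>0 = (1 + r) / 2"
  have \<rho>0: "0 < \<rho>0" "r < \<rho>0" "\<rho>0 < 1"
    using r by (auto simp: \<rho>0_def)
  define \<rho> where "\<rho> m = 1 - (1 - \<rho>0) / real (Suc m)" for m
  have \<rho>: "\<rho>0 \<le> \<rho> m" "\<rho> m < 1" for m
  proof -
    have "(1 - \<rho>0) / real (Suc m) \<le> (1 - \<rho>0) / 1"
      using \<rho>0 by (intro divide_left_mono) auto
    then show "\<rho>0 \<le> \<rho> m" by (simp add: \<rho>_def)
    show "\<rho> m < 1" using \<rho>0 by (simp add: \<rho>_def)
  qed
  have \<rho>_lim: "\<rho> \<longlonglongrightarrow> 1"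
  proof -
    have "\<rho> \<longlonglongrightarrow> 1 - (1 - \<rho>0) * 0"
      unfolding \<rho>_def[abs_def] divide_inverse
      by (intro tendsto_intros LIMSEQ_inverse_real_of_nat)
    then show ?thesis by simp
  qed
  define M where "M n = norm P * (norm Y * norm h) * norm v * (r / \<rho>0) ^ n" for n
  have f_le: "cmod (f n z) \<le> M n" if z: "\<rho>0 \<le> cmod z" "cmod z \<le> 1" for n z
  proof -
    have "cmod (z ^ j * (1 / z) ^ n) \<le> 1 * (1 / \<rho>0) ^ n"
      unfolding norm_mult norm_power using z \<rho>0
      by (intro mult_mono power_le_one power_mono) (auto simp: norm_divide norm_power intro!: divide_left_mono mult_pos_pos)
    moreover have "cmod (sp (exp_op ((- \<i>) *\<^sub>C D (half_plane z) t) *\<^sub>V Y *\<^sub>V x n) v) \<le> norm P * (norm Y * (r ^ n * norm h)) * norm v"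
      by (intro order_trans[OF sp_exp_D_le[OF a_pos Im_half_plane_nonpos[OF z(2)]]] mult_right_mono mult_left_mono
          order_trans[OF norm_cblinfun_apply] x_le) auto
    ultimately have "cmod (f n z) \<le> 1 * (1 / \<rho>0) ^ n * (norm P * (norm Y * (r ^ n * norm h)) * norm v)"
      unfolding f_def norm_mult[of "z ^ j * (1 / z) ^ n"] using \<rho>0 by (intro mult_mono) auto
    then show ?thesis by (simp add: M_def power_divide mult_ac)
  qed
  have cont_f: "continuous_on (- {0, 1}) (f n)" for n
    unfolding f_def by (rule continuous_on_exp_D)
  have int_f: "integrable unit_measure (\<lambda>\<theta>. f n (of_real (\<rho> m) * circle \<theta>))" for n m
    using \<rho>[of m] \<rho>0 by (intro circle_integrable_lt_1 cont_f) auto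
  have int_f1: "integrable unit_measure (\<lambda>\<theta>. f n (of_real 1 * circle \<theta>))" for n
    by (rule circle_integrable[where K = "M n"])
      (use \<rho>0 in \<open>auto intro: continuous_on_subset[OF cont_f] f_le\<close>)
  have f_lim: "(\<lambda>m. circle_mean (\<rho> m) (f n)) \<longlonglongrightarrow> circle_mean 1 (f n)" for n
    unfolding circle_mean_def
  proof (rule integral_dominated_convergence)
    show "integrable unit_measure (\<lambda>\<theta>. M n)" by simp
    show "AE \<theta> in unit_measure. (\<lambda>m. f n (of_real (\<rho> m) * circle \<theta>)) \<longlonglongrightarrow> f n (of_real 1 * circle \<theta>)"
    proof (rule AE_I2)
      fix \<theta> assume "\<theta> \<in> space unit_measure"
      then have "circle \<theta> \<noteq> 1"
        by (simp add: circle_neq_1)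
      show "(\<lambda>m. f n (of_real (\<rho> m) * circle \<theta>)) \<longlonglongrightarrow> f n (of_real 1 * circle \<theta>)"
      proof (rule continuous_on_tendsto_compose[OF cont_f])
        show "(\<lambda>m. of_real (\<rho> m) * circle \<theta>) \<longlonglongrightarrow> of_real 1 * circle \<theta>"
          by (intro tendsto_intros \<rho>_lim)
        show "of_real 1 * circle \<theta> \<in> - {0, 1}"
          using \<open>circle \<theta> \<noteq> 1\<close> by simp
        show "\<forall>\<^sub>F m in sequentially. of_real (\<rho> m) * circle \<theta> \<in> - {0, 1}"
          using \<rho> \<rho>0 order_less_le_trans[OF \<rho>0(1) \<rho>(1)] by (intro always_eventually allI radius_circle_neq) auto
      qed
    qed
    show "AE \<theta> in unit_measure. norm (f n (of_real (\<rho> m) * circle \<theta>)) \<le> M n" for m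
      using \<rho>[of m] \<rho>0 by (intro AE_I2 f_le) (auto simp: norm_mult)
  qed (use int_f int_f1 borel_measurable_integrable in blast)+
  have "eventually (\<lambda>m. summable (\<lambda>n. norm (circle_mean (\<rho> m) (f n)))) sequentially \<and>
      summable (\<lambda>n. norm (circle_mean 1 (f n))) \<and>
      (\<lambda>m. \<Sum>n. circle_mean (\<rho> m) (f n)) \<longlonglongrightarrow> (\<Sum>n. circle_mean 1 (f n))"
  proof (rule tannerys_theorem[where M = M])
    show "\<forall>\<^sub>F (n, m) in sequentially \<times>\<^sub>F sequentially. norm (circle_mean (\<rho> m) (f n)) \<le> M n"
    proof (intro always_eventually allI, simp only: split_paired_all prod.case)
      fix n m
      show "norm (circle_mean (\<rho> m) (f n)) \<le> M n"
      proof (rule cmod_circle_mean_le[OF int_f])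
        show "0 < \<rho> m"
          using \<rho>(1)[of m] \<rho>0(1) by simp
        show "cmod (f n z) \<le> M n" if "cmod z = \<rho> m" for z
          using \<rho>[of m] that by (intro f_le) auto
      qed
    qed
    show "summable M"
      unfolding M_def using \<rho>0 r by (intro summable_mult summable_geometric) auto
  qed (auto intro: f_lim)
  moreover have "(\<Sum>n. circle_mean (\<rho> m) (f n)) = expL t r Y (x j) v" for m
    using sums_unique[OF exp_D_sums_lt_1[of r "\<rho> m" j t Y h v]] \<rho>[of m] \<rho>0 r
    by (simp add: f_def[abs_def] x_def)
  ultimately have sf: "summable (\<lambda>n. norm (circle_mean 1 (f n)))"
    and lim: "(\<lambda>m::nat. expL t r Y (x j) v) \<longlonglongrightarrow> (\<Sum>n. circle_mean 1 (f n))"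
    by auto
  have "(\<Sum>n. circle_mean 1 (f n)) = expL t r Y (x j) v"
    by (rule LIMSEQ_unique[OF lim tendsto_const])
  then have "(\<lambda>n. circle_mean 1 (f n)) sums expL t r Y (x j) v"
    using summable_sums[OF summable_norm_cancel[OF sf]] by simp
  then show ?thesis
    by (simp add: f_def[abs_def] x_def)
qed

text \<open>The difference is \<open>- \<i> \<kappa>\<close> times
  \<open>id_cblinfun + N \<xi> o\<^sub>C\<^sub>L N \<xi>\<close> applied after
  \<open>resol \<kappa>\<close>, where \<kappa> = (1 - r) / (1 + r).\<close>

lemma norm_\<Lambda>_diff_le:
  assumes r: "0 < r" "r < 1"
  shows "norm (\<Lambda> r - N \<xi>) \<le> (1 - r) / (1 + r) * (1 + norm (N \<xi>) * norm (N \<xi>))"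
proof (rule norm_cblinfun_bound)
  define \<kappa> where "\<kappa> = (1 - r) / (1 + r)"
  have \<kappa>: "0 \<le> \<kappa>" using r by (simp add: \<kappa>_def)
  then show "0 \<le> (1 - r) / (1 + r) * (1 + norm (N \<xi>) * norm (N \<xi>))"
    unfolding \<kappa>_def by (intro mult_nonneg_nonneg) auto
  fix x
  define u where "u = resol \<kappa> *\<^sub>V x"
  have x: "x = u + (\<i> * \<kappa>) *\<^sub>C (N \<xi> *\<^sub>V u)"
    using resol_right[OF \<kappa>, of x] by (simp add: u_def)
  have "\<Lambda> r *\<^sub>V x = N \<xi> *\<^sub>V u - (\<i> * \<kappa>) *\<^sub>C u"
    by (simp add: \<Lambda>_def flip: \<kappa>_def u_def)
  moreover have "N \<xi> *\<^sub>V x = N \<xi> *\<^sub>V u + (\<i> * \<kappa>) *\<^sub>C (N \<xi> *\<^sub>V N \<xi> *\<^sub>V u)"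
    by (subst x) (simp add: cblinfun_linear)
  ultimately have "(\<Lambda> r - N \<xi>) *\<^sub>V x = - ((\<i> * \<kappa>) *\<^sub>C (u + N \<xi> *\<^sub>V N \<xi> *\<^sub>V u))"
    by (simp add: scaleC_add_right)
  then have "norm ((\<Lambda> r - N \<xi>) *\<^sub>V x) = \<kappa> * norm (u + N \<xi> *\<^sub>V N \<xi> *\<^sub>V u)"
    using \<kappa> by (simp only: norm_minus_cancel norm_scaleC) (simp add: norm_mult)
  also have "\<dots> \<le> \<kappa> * (norm u + norm (N \<xi>) * (norm (N \<xi>) * norm u))"
    using \<kappa> by (intro mult_left_mono norm_triangle_le add_mono order_refl
        order_trans[OF norm_cblinfun_apply] norm_cblinfun_apply) auto
  also have "\<dots> = \<kappa> * (1 + norm (N \<xi>) * norm (N \<xi>)) * norm u"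
    by (simp add: algebra_simps)
  also have "\<dots> \<le> \<kappa> * (1 + norm (N \<xi>) * norm (N \<xi>)) * norm x"
  proof (rule mult_left_mono)
    show "norm u \<le> norm x"
      unfolding u_def
      using order_trans[OF norm_cblinfun_apply mult_right_mono[OF norm_resol[OF \<kappa>]], of x] by simp
  qed (use \<kappa> in simp)
  finally show "norm ((\<Lambda> r - N \<xi>) *\<^sub>V x) \<le> (1 - r) / (1 + r) * (1 + norm (N \<xi>) * norm (N \<xi>)) * norm x"
    by (simp add: \<kappa>_def)
qed

text \<open>On the circle itself \<open>G\<close> may fail to be a strict contraction.  Replacing \<open>G\<close> by \<open>r G\<close> with
  \<open>r < 1\<close> gives the Abel means of the series, and the limit follows from Abel's theorem.\<close>

lemma boundary_sum:
  assumes a_pos: "\<And>u. 0 \<le> Re (sp (a t *\<^sub>V u) u)"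
    and sums: "(\<lambda>n. circle_mean 1 (\<lambda>z. z ^ j * (1 / z) ^ n *
      sp (exp_op ((- \<i>) *\<^sub>C D (half_plane z) t) *\<^sub>V \<Psi> *\<^sub>V cpower G n *\<^sub>V h) v)) sums \<beta>"
  shows "\<beta> = sp (\<Psi> *\<^sub>V exp_op ((- \<i>) *\<^sub>C N t) *\<^sub>V cpower G j *\<^sub>V h) v"
proof -
  \<comment> \<open>The shift by 2 keeps already \<open>r 0\<close> strictly between 0 and
    1.\<close>
  define r where "r m = 1 - 1 / real (m + 2)" for m
  have r: "0 < r m" "r m < 1" for m
    by (auto simp: r_def)
  have r_lim: "r \<longlonglongrightarrow> 1"
  proof -
    have "(\<lambda>m. 1 - 1 / real (m + 2)) \<longlonglongrightarrow> 1 - 0"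
      by (intro tendsto_intros LIMSEQ_ignore_initial_segment[OF lim_1_over_n])
    then show ?thesis by (simp add: r_def[abs_def])
  qed
  define y where "y = cpower G j *\<^sub>V h"
  have "(\<lambda>n. of_real (r m) ^ n * circle_mean 1 (\<lambda>z. z ^ j * (1 / z) ^ n *
      sp (exp_op ((- \<i>) *\<^sub>C D (half_plane z) t) *\<^sub>V \<Psi> *\<^sub>V cpower G n *\<^sub>V h) v)) sums expL t (r m) \<Psi> (r m ^ j *\<^sub>R y) v" for m
  proof -
    have "circle_mean 1 (\<lambda>z. z ^ j * (1 / z) ^ n *
        sp (exp_op ((- \<i>) *\<^sub>C D (half_plane z) t) *\<^sub>V \<Psi> *\<^sub>V (r m ^ n *\<^sub>R (cpower G n *\<^sub>V h))) v)
      = of_real (r m) ^ n * circle_mean 1 (\<lambda>z. z ^ j * (1 / z) ^ n *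
        sp (exp_op ((- \<i>) *\<^sub>C D (half_plane z) t) *\<^sub>V \<Psi> *\<^sub>V cpower G n *\<^sub>V h) v)" for n
      unfolding circle_mean_def integral_mult_right_zero[symmetric]
      by (intro Bochner_Integration.integral_cong refl)
        (simp add: cblinfun_linear sp.scaleR_left scaleR_conv_of_real mult_ac)
    then show ?thesis
      using exp_D_sums_1[OF a_pos r(1)[of m] r(2), where j = j and Y = \<Psi> and h = h and v = v] unfolding y_def by (simp only:)
  qed
  from Abel_mean_limit[OF sums r_lim r this]
  have lim1: "(\<lambda>m. expL t (r m) \<Psi> (r m ^ j *\<^sub>R y) v) \<longlonglongrightarrow> \<beta>" .
  have \<Lambda>_lim: "(\<lambda>m. \<Lambda> (r m)) \<longlonglongrightarrow> N \<xi>"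
  proof (rule Lim_null[THEN iffD2], rule Lim_null_comparison)
    show "\<forall>\<^sub>F m in sequentially. norm (\<Lambda> (r m) - N \<xi>) \<le> (1 - r m) / (1 + r m) * (1 + norm (N \<xi>) * norm (N \<xi>))"
      by (intro always_eventually allI norm_\<Lambda>_diff_le r)
    have "(\<lambda>m. (1 - r m) / (1 + r m) * (1 + norm (N \<xi>) * norm (N \<xi>))) \<longlonglongrightarrow> (1 - 1) / (1 + 1) * (1 + norm (N \<xi>) * norm (N \<xi>))"
      by (intro tendsto_intros r_lim) simp
    then show "(\<lambda>m. (1 - r m) / (1 + r m) * (1 + norm (N \<xi>) * norm (N \<xi>))) \<longlonglongrightarrow> 0"
      by simp
  qed
  \<comment> \<open>Once \<open>\<Lambda>\<close> has become \<open>N \<xi>\<close>, the relation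
    \<open>\<Psi>_N\<close> applied to \<open>cpower (N t) k\<close> absorbs \<open>a t\<close> and
    \<open>b t\<close> into one more factor \<open>N t\<close>.\<close>
  have Lop_lim: "(\<lambda>m. (Lop t (r m) ^^ k) \<Psi>) \<longlonglongrightarrow> \<Psi> o\<^sub>C\<^sub>L cpower (N t) k" for k
  proof (induction k)
    case (Suc k)
    have "(\<lambda>m. a t o\<^sub>C\<^sub>L (Lop t (r m) ^^ k) \<Psi> o\<^sub>C\<^sub>L \<Lambda> (r m) + b t o\<^sub>C\<^sub>L (Lop t (r m) ^^ k) \<Psi>)
        \<longlonglongrightarrow> a t o\<^sub>C\<^sub>L (\<Psi> o\<^sub>C\<^sub>L cpower (N t) k) o\<^sub>C\<^sub>L N \<xi> + b t o\<^sub>C\<^sub>L (\<Psi> o\<^sub>C\<^sub>L cpower (N t) k)"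
      by (intro tendsto_add cblinfun_compose.tendsto tendsto_const Suc \<Lambda>_lim)
    also have "a t o\<^sub>C\<^sub>L (\<Psi> o\<^sub>C\<^sub>L cpower (N t) k) o\<^sub>C\<^sub>L N \<xi> + b t o\<^sub>C\<^sub>L (\<Psi> o\<^sub>C\<^sub>L cpower (N t) k) = \<Psi> o\<^sub>C\<^sub>L cpower (N t) (Suc k)"
    proof (rule cblinfun_eqI)
      fix x
      have "cpower (N t) k *\<^sub>V N \<xi> *\<^sub>V x = N \<xi> *\<^sub>V cpower (N t) k *\<^sub>V x"
        by (induction k) (auto simp: N_commute)
      then show "(a t o\<^sub>C\<^sub>L (\<Psi> o\<^sub>C\<^sub>L cpower (N t) k) o\<^sub>C\<^sub>L N \<xi> + b t o\<^sub>C\<^sub>L (\<Psi> o\<^sub>C\<^sub>L cpower (N t) k)) *\<^sub>V x = (\<Psi> o\<^sub>C\<^sub>L cpower (N t) (Suc k)) *\<^sub>V x"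
        by (simp add: \<Psi>_N[of t])
    qed
    finally show ?case
      by (simp add: Lop_def)
  qed (simp add: cblinfun_compose_id)
  define l where "l = norm (N \<xi>) + (1 + norm (N \<xi>) * norm (N \<xi>))"
  have norm_\<Lambda>: "norm (\<Lambda> (r m)) \<le> l" for m
  proof -
    have "(1 - r m) / (1 + r m) \<le> 1"
      using r[of m] by simp
    then have "(1 - r m) / (1 + r m) * (1 + norm (N \<xi>) * norm (N \<xi>)) \<le> 1 * (1 + norm (N \<xi>) * norm (N \<xi>))"
      by (intro mult_right_mono) auto
    then have "norm (\<Lambda> (r m) - N \<xi>) \<le> 1 + norm (N \<xi>) * norm (N \<xi>)"
      using norm_\<Lambda>_diff_le[OF r, of m] by simp
    then show ?thesis
      unfolding l_def using norm_triangle_sub[of "\<Lambda> (r m)" "N \<xi>"] by simp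
  qed
  define E where "E = norm (a t) * l + norm (b t)"
  have "(\<lambda>m. \<Sum>k. (- \<i>) ^ k / fact k * sp ((Lop t (r m) ^^ k) \<Psi> *\<^sub>V (r m ^ j *\<^sub>R y)) v)
      \<longlonglongrightarrow> (\<Sum>k. (- \<i>) ^ k / fact k * sp ((\<Psi> o\<^sub>C\<^sub>L cpower (N t) k) *\<^sub>V y) v)"
  proof (rule tannerys_theorem[where M = "\<lambda>k. norm P * norm \<Psi> * norm y * norm v * (E ^ k / fact k)",
        THEN conjunct2, THEN conjunct2])
    show "(\<lambda>m. (- \<i>) ^ k / fact k * sp ((Lop t (r m) ^^ k) \<Psi> *\<^sub>V (r m ^ j *\<^sub>R y)) v)
        \<longlonglongrightarrow> (- \<i>) ^ k / fact k * sp ((\<Psi> o\<^sub>C\<^sub>L cpower (N t) k) *\<^sub>V y) v" for k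
    proof -
      have "(\<lambda>m. (- \<i>) ^ k / fact k * sp ((Lop t (r m) ^^ k) \<Psi> *\<^sub>V (r m ^ j *\<^sub>R y)) v)
        \<longlonglongrightarrow> (- \<i>) ^ k / fact k * sp ((\<Psi> o\<^sub>C\<^sub>L cpower (N t) k) *\<^sub>V (1 ^ j *\<^sub>R y)) v"
        by (intro tendsto_mult tendsto_const sp.tendsto bounded_bilinear.tendsto[OF bounded_bilinear_cblinfun_apply]
            Lop_lim tendsto_scaleR tendsto_power r_lim)
      then show ?thesis by simp
    qed
    have "norm ((- \<i>) ^ k / fact k * sp ((Lop t (r m) ^^ k) \<Psi> *\<^sub>V (r m ^ j *\<^sub>R y)) v)
        \<le> norm P * norm \<Psi> * norm y * norm v * (E ^ k / fact k)" for k m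
    proof -
      have "norm (r m ^ j *\<^sub>R y) \<le> norm y"
        using r[of m] by (simp add: power_le_one mult_left_le_one_le)
      then have "cmod (sp ((Lop t (r m) ^^ k) \<Psi> *\<^sub>V (r m ^ j *\<^sub>R y)) v) \<le> norm P * (E ^ k * norm \<Psi> * norm y) * norm v"
        unfolding E_def
        by (intro order_trans[OF sp_bound] mult_right_mono mult_left_mono order_trans[OF norm_cblinfun_apply]
            mult_mono norm_Lop_power_le norm_\<Lambda>) (auto simp: l_def)
      then have "cmod (sp ((Lop t (r m) ^^ k) \<Psi> *\<^sub>V (r m ^ j *\<^sub>R y)) v) / fact k \<le> norm P * (E ^ k * norm \<Psi> * norm y) * norm v / fact k"
        by (rule divide_right_mono) simp
      then show ?thesis
        by (simp add: norm_mult norm_divide norm_power mult_ac)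
    qed
    then show "\<forall>\<^sub>F (k, m) in sequentially \<times>\<^sub>F sequentially.
        norm ((- \<i>) ^ k / fact k * sp ((Lop t (r m) ^^ k) \<Psi> *\<^sub>V (r m ^ j *\<^sub>R y)) v) \<le> norm P * norm \<Psi> * norm y * norm v * (E ^ k / fact k)"
      by (intro always_eventually) auto
    have "summable (\<lambda>k. (norm P * norm \<Psi> * norm y * norm v) * (E ^ k / fact k))"
      using summable_exp_generic[of E] by (intro summable_mult) (simp add: divide_inverse mult.commute)
    then show "summable (\<lambda>k. norm P * norm \<Psi> * norm y * norm v * (E ^ k / fact k))" .
  qed simp
  then have "\<beta> = (\<Sum>k. (- \<i>) ^ k / fact k * sp ((\<Psi> o\<^sub>C\<^sub>L cpower (N t) k) *\<^sub>V y) v)"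
    using lim1 LIMSEQ_unique unfolding expL_def by blast
  also have "\<dots> = sp (\<Psi> *\<^sub>V exp_op ((- \<i>) *\<^sub>C N t) *\<^sub>V y) v"
  proof -
    have "bounded_linear (\<lambda>u. sp (\<Psi> *\<^sub>V u) v)"
      by (rule bounded_linear_compose[OF sp.bounded_linear_left bounded_linear_cblinfun_apply])
    from bounded_linear.sums[OF this exp_op_sums[of "(- \<i>) *\<^sub>C N t" y]]
    have "(\<lambda>k. (- \<i>) ^ k / fact k * sp ((\<Psi> o\<^sub>C\<^sub>L cpower (N t) k) *\<^sub>V y) v) sums sp (\<Psi> *\<^sub>V exp_op ((- \<i>) *\<^sub>C N t) *\<^sub>V y) v"
      unfolding cpower_scaleC cblinfun_linear sp.scaleR_left sp_scaleC_left
      by (simp add: scaleR_conv_of_real divide_inverse mult_ac)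
    then show ?thesis by (rule sums_unique[symmetric])
  qed
  finally show ?thesis by (simp add: y_def)
qed

section \<open>The unitary groups over the circle and their integrals\<close>

definition E :: "real^'d \<Rightarrow> real \<Rightarrow> ('e \<Rightarrow>\<^sub>C\<^sub>L 'e)" where
  "E t \<theta> = exp_op (\<i> *\<^sub>C D (half_plane (circle \<theta>)) t)"

lemma D_diff: "D x (s - t) = D x s - D x t"
  by (simp add: D_def linear_diff[OF linear_a] linear_diff[OF linear_b] scaleC_diff_right)

lemma D_zero: "D x 0 = 0"
  using D_diff[of x 0 0] by simp

lemma E_zero: "E 0 \<theta> = id_cblinfun"
  by (simp add: E_def D_zero)

lemma E_minus: "E (- t) \<theta> = exp_op ((- \<i>) *\<^sub>C D (half_plane (circle \<theta>)) t)"
  using D_diff[of "half_plane (circle \<theta>)" 0 t] by (simp add: E_def D_zero)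

text \<open>At a point of the circle the parameter x is real, so the pencil is symmetric for
  \<open>sp\<close>; as its values at s and t commute, the exponentials form a group of
  \<open>sp\<close>-isometries at each angle.\<close>

lemma sp_E_diff: "sp (E (s - t) \<theta> *\<^sub>V u) v = sp (E s \<theta> *\<^sub>V u) (E t \<theta> *\<^sub>V v)"
proof -
  define x where "x = half_plane (circle \<theta>)"
  have "Im x = 0"
    by (simp add: x_def Im_half_plane)
  then have x: "cnj x = x"
    by (simp add: complex_eq_iff)
  have adj: "sp (D x t *\<^sub>V u) v = sp u (D x t *\<^sub>V v)" for t u v
    using a_sym[of t u v] b_sym[of t u v]
    by (simp add: D_def sp.add_left sp.add_right sp_scaleC_left sp_scaleC_right x) (simp add: sp_def)
  have "\<i> *\<^sub>C D x (s - t) = (- \<i>) *\<^sub>C D x t + \<i> *\<^sub>C D x s"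
    by (simp add: D_diff scaleC_diff_right)
  then have "exp_op (\<i> *\<^sub>C D x (s - t)) = exp_op ((- \<i>) *\<^sub>C D x t + \<i> *\<^sub>C D x s)"
    by (rule arg_cong)
  also have "\<dots> = exp_op ((- \<i>) *\<^sub>C D x t) o\<^sub>C\<^sub>L exp_op (\<i> *\<^sub>C D x s)"
    using D_commute[of x t s] by (intro exp_op_add) (simp only: cblinfun_compose_scaleC D_def scaleC_scaleC mult.commute)
  finally have "sp (exp_op (\<i> *\<^sub>C D x (s - t)) *\<^sub>V u) v = sp (exp_op ((- \<i>) *\<^sub>C D x t) *\<^sub>V exp_op (\<i> *\<^sub>C D x s) *\<^sub>V u) v"
    by simp
  also have "\<dots> = sp (exp_op (\<i> *\<^sub>C D x s) *\<^sub>V u) (exp_op (\<i> *\<^sub>C D x t) *\<^sub>V v)"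
    by (rule exp_op_adjoint[OF bounded_bilinear_sp])
      (simp only: scaleC_cblinfun.rep_eq sp_scaleC_left sp_scaleC_right adj, simp)
  finally show ?thesis
    by (simp add: E_def x_def)
qed

lemma sp_E_E: "sp (E t \<theta> *\<^sub>V u) (E t \<theta> *\<^sub>V v) = sp u v"
  using sp_E_diff[of t t \<theta> u v] by (simp add: E_zero)

lemma sp_E_le: "cmod (sp (E t \<theta> *\<^sub>V u) v) \<le> norm P * norm u * norm v"
proof (rule power2_le_imp_le)
  have "Re (sp u u) * Re (sp v v) \<le> (norm P * (norm u)\<^sup>2) * (norm P * (norm v)\<^sup>2)"
    by (intro mult_mono sp_self_le sp_nonneg) (auto intro: order_trans[OF _ sp_self_le])
  then show "(cmod (sp (E t \<theta> *\<^sub>V u) v))\<^sup>2 \<le> (norm P * norm u * norm v)\<^sup>2"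
    using sp_cauchy_schwarz[of "E t \<theta> *\<^sub>V u" v] by (simp add: sp_E_E power2_eq_square mult_ac)
qed simp

lemma continuous_on_E: "continuous_on {0<..<1} (E t)"
proof -
  have "continuous_on {0<..<1} (\<lambda>\<theta>. half_plane (circle \<theta>))"
    by (rule continuous_on_compose2[OF continuous_on_half_plane])
      (auto intro!: continuous_intros simp: circle_neq_1)
  then show ?thesis
    unfolding E_def by (intro continuous_on_exp_op continuous_on_scaleC_cblinfun continuous_on_D continuous_intros)
qed

lemma continuous_on_E_time: "continuous_on UNIV (\<lambda>t. E t \<theta>)"
proof -
  have "continuous_on UNIV a" "continuous_on UNIV b"
    using linear_a linear_b by (simp_all add: linear_continuous_on linear_conv_bounded_linear)
  then show ?thesis
    unfolding E_def D_def by (intro continuous_on_exp_op continuous_on_scaleC_cblinfun continuous_intros)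
qed

text \<open>Finite pieces of the series. The whole series is controlled only in mean square, so
  limits are taken of the integrals \<open>J\<close> and not of \<open>f\<close>.\<close>

definition f :: "nat set \<Rightarrow> 'h \<Rightarrow> real \<Rightarrow> 'e" where
  "f S h \<theta> = (\<Sum>n\<in>S. (1 / circle \<theta>) ^ n *\<^sub>C (\<Psi> *\<^sub>V cpower G n *\<^sub>V h))"

lemma f_add: "f S (g + h) \<theta> = f S g \<theta> + f S h \<theta>"
  and f_scaleC: "f S (c *\<^sub>C h) \<theta> = c *\<^sub>C f S h \<theta>"
  by (simp_all add: f_def cblinfun_linear scaleC_add_right sum.distrib scaleC_sum_right mult.commute)

lemma f_Un: "finite S \<Longrightarrow> finite T \<Longrightarrow> S \<inter> T = {} \<Longrightarrow> f (S \<union> T) h \<theta> = f S h \<theta> + f T h \<theta>"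
  unfolding f_def by (rule sum.union_disjoint)

lemma continuous_on_f: "continuous_on A (f S h)"
  unfolding f_def by (intro continuous_on_sum continuous_on_scaleC continuous_intros) auto

lemma norm_f_le: "norm (f S h \<theta>) \<le> (\<Sum>n\<in>S. norm (\<Psi> *\<^sub>V cpower G n *\<^sub>V h))"
  unfolding f_def by (rule order_trans[OF norm_sum]) (simp add: norm_scaleC norm_power norm_divide)

definition J :: "nat set \<Rightarrow> nat set \<Rightarrow> real^'d \<Rightarrow> 'h \<Rightarrow> 'h \<Rightarrow> complex" where
  "J S S' t h h' = integral\<^sup>L unit_measure (\<lambda>\<theta>. sp (E t \<theta> *\<^sub>V f S h \<theta>) (f S' h' \<theta>))"

lemma sp_E_f_le:
  "cmod (sp (E t \<theta> *\<^sub>V f S h \<theta>) (f S' h' \<theta>))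
    \<le> norm P * (\<Sum>n\<in>S. norm (\<Psi> *\<^sub>V cpower G n *\<^sub>V h)) * (\<Sum>n\<in>S'. norm (\<Psi> *\<^sub>V cpower G n *\<^sub>V h'))"
  by (intro order_trans[OF sp_E_le] mult_mono norm_f_le) (auto intro!: mult_nonneg_nonneg sum_nonneg)

lemma integrable_J: "integrable unit_measure (\<lambda>\<theta>. sp (E t \<theta> *\<^sub>V f S h \<theta>) (f S' h' \<theta>))"
  by (rule integrable_unit_measure[OF _ sp_E_f_le])
    (intro sp.continuous_on continuous_on_apply_cblinfun continuous_on_E continuous_on_f)

lemma J_add_left: "J S S' t (g + h) h' = J S S' t g h' + J S S' t h h'"
  and J_add_right: "J S S' t h' (g + h) = J S S' t h' g + J S S' t h' h"
  unfolding J_def by (simp_all add: f_add cblinfun_linear sp.add_left sp.add_right integrable_J)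

lemma J_scaleC_left: "J S S' t (c *\<^sub>C h) h' = c * J S S' t h h'"
  and J_scaleC_right: "J S S' t h (c *\<^sub>C h') = cnj c * J S S' t h h'"
  unfolding J_def by (simp_all add: f_scaleC cblinfun_linear sp_scaleC_left sp_scaleC_right)

lemma J_Un_left: "finite S \<Longrightarrow> finite T \<Longrightarrow> S \<inter> T = {} \<Longrightarrow> J (S \<union> T) S' t h h' = J S S' t h h' + J T S' t h h'"
  and J_Un_right: "finite S \<Longrightarrow> finite T \<Longrightarrow> S \<inter> T = {} \<Longrightarrow> J S' (S \<union> T) t h h' = J S' S t h h' + J S' T t h h'"
  unfolding J_def by (simp_all add: f_Un cblinfun_linear sp.add_left sp.add_right integrable_J)

lemma J_expand:
  assumes "finite S" "finite S'"
  shows "J S S' t h h' = (\<Sum>j\<in>S'. \<Sum>n\<in>S. integral\<^sup>L unit_measure (\<lambda>\<theta>. circle \<theta> ^ j * (1 / circle \<theta>) ^ n *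
    sp (E t \<theta> *\<^sub>V \<Psi> *\<^sub>V cpower G n *\<^sub>V h) (\<Psi> *\<^sub>V cpower G j *\<^sub>V h')))"
proof -
  have 1: "f {n} h \<theta> = (1 / circle \<theta>) ^ n *\<^sub>C (\<Psi> *\<^sub>V cpower G n *\<^sub>V h)" for n h \<theta>
    by (simp add: f_def)
  have trm: "sp (E t \<theta> *\<^sub>V f {n} h \<theta>) (f {j} h' \<theta>) = circle \<theta> ^ j * (1 / circle \<theta>) ^ n *
    sp (E t \<theta> *\<^sub>V \<Psi> *\<^sub>V cpower G n *\<^sub>V h) (\<Psi> *\<^sub>V cpower G j *\<^sub>V h')" for n j \<theta>
    by (simp add: 1 cblinfun_linear sp_scaleC_left sp_scaleC_right cnj_circle)
  have "sp (E t \<theta> *\<^sub>V f S h \<theta>) (f S' h' \<theta>) = (\<Sum>j\<in>S'. \<Sum>n\<in>S. sp (E t \<theta> *\<^sub>V f {n} h \<theta>) (f {j} h' \<theta>))" for \<theta>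
    unfolding 1 f_def[of S] f_def[of S'] cblinfun_sum_right sp.sum_left sp.sum_right
    by (rule refl | rule sum.swap)
  then show ?thesis
    unfolding J_def trm[symmetric] by (simp add: integrable_J)
qed

lemma J_diagonal:
  assumes "finite S"
  shows "J S S 0 h h = of_real (\<Sum>n\<in>S. Re (sp (\<Psi> *\<^sub>V cpower G n *\<^sub>V h) (\<Psi> *\<^sub>V cpower G n *\<^sub>V h)))"
proof -
  have "integral\<^sup>L unit_measure (\<lambda>\<theta>. circle \<theta> ^ j * (1 / circle \<theta>) ^ n * c) = (if j = n then c else 0)" for j n c
    using circle_mean_1_powers[of j n] by (auto simp: circle_mean_def)
  then show ?thesis
    using assms sp_self by (simp add: J_expand E_zero)
qed

text \<open>The square of \<open>?g\<close> for \<open>sp\<close> is integrated over the circle;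
  since \<open>E t\<close> preserves \<open>sp\<close>, the diagonal terms are those at time
  0.\<close>

lemma J_cauchy_schwarz:
  assumes S: "finite S" "finite S'"
  shows "(cmod (J S S' t h h'))\<^sup>2 \<le> Re (J S S 0 h h) * Re (J S' S' 0 h' h')"
proof (rule discriminant_bound)
  fix c
  let ?g = "\<lambda>\<theta>. E t \<theta> *\<^sub>V f S h \<theta> - c *\<^sub>C f S' h' \<theta>"
  have eq: "Re (sp (?g \<theta>) (?g \<theta>)) = Re (sp (E 0 \<theta> *\<^sub>V f S h \<theta>) (f S h \<theta>))
      - 2 * Re (cnj c * sp (E t \<theta> *\<^sub>V f S h \<theta>) (f S' h' \<theta>)) + (cmod c)\<^sup>2 * Re (sp (E 0 \<theta> *\<^sub>V f S' h' \<theta>) (f S' h' \<theta>))" for \<theta>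
  proof -
    define u v where "u = E t \<theta> *\<^sub>V f S h \<theta>" and "v = f S' h' \<theta>"
    have "sp (u - c *\<^sub>C v) (u - c *\<^sub>C v) = sp u u - cnj c * sp u v - (c * cnj (sp u v) - (c * cnj c) * sp v v)"
      unfolding sp.diff_left sp.diff_right sp_scaleC_left sp_scaleC_right
      by (simp add: algebra_simps flip: sp_commute[of v u])
    also have "Re \<dots> = Re (sp u u) - 2 * Re (cnj c * sp u v) + (cmod c)\<^sup>2 * Re (sp v v)"
      by (simp add: complex_norm_square[symmetric] del: of_real_power)
    finally show ?thesis
      by (simp add: E_zero u_def v_def sp_E_E)
  qed
  have "0 \<le> integral\<^sup>L unit_measure (\<lambda>\<theta>. Re (sp (?g \<theta>) (?g \<theta>)))"
    by (intro Bochner_Integration.integral_nonneg sp_nonneg)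
  also have "\<dots> = Re (J S S 0 h h) - 2 * Re (cnj c * J S S' t h h') + (cmod c)\<^sup>2 * Re (J S' S' 0 h' h')"
  proof -
    have re: "integrable unit_measure (\<lambda>\<theta>. Re (d * sp (E s \<theta> *\<^sub>V f A x \<theta>) (f A' x' \<theta>)))"
      "integral\<^sup>L unit_measure (\<lambda>\<theta>. Re (d * sp (E s \<theta> *\<^sub>V f A x \<theta>) (f A' x' \<theta>))) = Re (d * J A A' s x x')"
      for d A A' s x x'
      using integrable_J[of s A x A' x']
      by (simp_all only: J_def integrable_mult_right Bochner_Integration.integrable_Re
          Bochner_Integration.integral_Re integral_mult_right_zero)
    note re1 = re[where d = 1, unfolded mult_1]
    show ?thesis
      unfolding eq by (simp only: re re1 Bochner_Integration.integral_add Bochner_Integration.integral_diff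
        Bochner_Integration.integrable_add Bochner_Integration.integrable_diff
        integrable_mult_right integral_mult_right_zero)
  qed
  finally show "0 \<le> Re (J S S 0 h h) - 2 * Re (cnj c * J S S' t h h') + (cmod c)\<^sup>2 * Re (J S' S' 0 h' h')" .
qed (simp add: J_diagonal S sum_nonneg sp_nonneg)

text \<open>By \<open>sp_E_diff\<close> the double sum is, at each angle, the square for
  \<open>sp\<close> of the single vector \<open>g\<close>.\<close>

lemma J_psd:
  assumes S: "finite S"
  shows "psd_kernel (\<lambda>x y. J S S (fst x - fst y) (snd x) (snd y))"
  unfolding psd_kernel_def
proof (intro allI impI)
  fix F :: "((real^'d) \<times> 'h) set" and c :: "(real^'d) \<times> 'h \<Rightarrow> complex" assume F: "finite F"
  define g where "g \<theta> = (\<Sum>x\<in>F. c x *\<^sub>C (E (fst x) \<theta> *\<^sub>V f S (snd x) \<theta>))" for \<theta>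
  have g: "sp (g \<theta>) (g \<theta>) = (\<Sum>x\<in>F. \<Sum>y\<in>F. c x * cnj (c y) * sp (E (fst x - fst y) \<theta> *\<^sub>V f S (snd x) \<theta>) (f S (snd y) \<theta>))" for \<theta>
    unfolding g_def sp.sum_left sp.sum_right sp_scaleC_left sp_scaleC_right sp_E_diff
    by (subst sum.swap) (simp add: sum_distrib_left mult_ac)
  have "(\<Sum>x\<in>F. \<Sum>y\<in>F. c x * cnj (c y) * J S S (fst x - fst y) (snd x) (snd y)) = integral\<^sup>L unit_measure (\<lambda>\<theta>. sp (g \<theta>) (g \<theta>))"
    unfolding g J_def by (simp add: integrable_J)
  also have "\<dots> = integral\<^sup>L unit_measure (\<lambda>\<theta>. of_real (Re (sp (g \<theta>) (g \<theta>))))"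
    using sp_self by (intro Bochner_Integration.integral_cong refl) auto
  also have "\<dots> = of_real (integral\<^sup>L unit_measure (\<lambda>\<theta>. Re (sp (g \<theta>) (g \<theta>))))"
    by (rule integral_complex_of_real)
  also have "0 \<le> \<dots>"
  proof -
    have "0 \<le> integral\<^sup>L unit_measure (\<lambda>\<theta>. Re (sp (g \<theta>) (g \<theta>)))"
      by (intro Bochner_Integration.integral_nonneg sp_nonneg)
    then show ?thesis
      by (simp only: less_eq_complex_def Re_complex_of_real Im_complex_of_real zero_complex.sel)
  qed
  finally show "0 \<le> (\<Sum>x\<in>F. \<Sum>y\<in>F. c x * cnj (c y) * J S S (fst x - fst y) (snd x) (snd y))" .
qed

lemma continuous_on_J: "continuous_on UNIV (\<lambda>t. J S S' t h h')"
  unfolding continuous_on_sequentially comp_def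
proof (intro ballI allI impI, elim conjE)
  fix s :: "nat \<Rightarrow> real^'d" and t assume s: "s \<longlonglongrightarrow> t"
  show "(\<lambda>n. J S S' (s n) h h') \<longlonglongrightarrow> J S S' t h h'"
    unfolding J_def
  proof (rule integral_dominated_convergence)
    show "AE \<theta> in unit_measure. (\<lambda>n. sp (E (s n) \<theta> *\<^sub>V f S h \<theta>) (f S' h' \<theta>)) \<longlonglongrightarrow> sp (E t \<theta> *\<^sub>V f S h \<theta>) (f S' h' \<theta>)"
      by (intro AE_I2 sp.tendsto bounded_bilinear.tendsto[OF bounded_bilinear_cblinfun_apply] tendsto_const
          continuous_on_tendsto_compose[OF continuous_on_E_time s]) auto
    show "AE \<theta> in unit_measure. norm (sp (E (s n) \<theta> *\<^sub>V f S h \<theta>) (f S' h' \<theta>))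
        \<le> norm P * (\<Sum>n\<in>S. norm (\<Psi> *\<^sub>V cpower G n *\<^sub>V h)) * (\<Sum>n\<in>S'. norm (\<Psi> *\<^sub>V cpower G n *\<^sub>V h'))" for n
      by (intro AE_I2 sp_E_f_le)
  qed (rule borel_measurable_integrable[OF integrable_J] | simp)+
qed

section \<open>Energy estimates for blocks of the series\<close>

definition \<tau> :: "'h \<Rightarrow> nat \<Rightarrow> real" where
  "\<tau> h n = (norm (cpower G n *\<^sub>V h))\<^sup>2"

lemma decseq_\<tau>: "decseq (\<tau> h)"
proof (rule decseq_SucI)
  have "norm (G *\<^sub>V x) \<le> norm x" for x
    using norm_G_power_le[of 1 x] by simp
  then show "\<tau> h (Suc n) \<le> \<tau> h n" for n
    by (simp add: \<tau>_def power_mono)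
qed

lemma \<tau>_le: "\<tau> h n \<le> (norm h)\<^sup>2"
  unfolding \<tau>_def by (intro power_mono norm_G_power_le) simp

definition \<tau>_inf :: "'h \<Rightarrow> real" where
  "\<tau>_inf h = lim (\<tau> h)"

lemma \<tau>_lim: "\<tau> h \<longlonglongrightarrow> \<tau>_inf h"
proof -
  have "\<forall>i. 0 \<le> \<tau> h i"
    by (simp add: \<tau>_def)
  from decseq_convergent[OF decseq_\<tau> this] obtain L where "\<tau> h \<longlonglongrightarrow> L"
    by blast
  then show ?thesis
    by (simp add: \<tau>_inf_def limI)
qed

lemma \<tau>_inf_le: "\<tau>_inf h \<le> \<tau> h n"
  by (rule decseq_ge[OF decseq_\<tau> \<tau>_lim])

lemma energy:
  assumes "m \<le> n"
  shows "(\<Sum>i\<in>{m..<n}. Re (sp (\<Psi> *\<^sub>V cpower G i *\<^sub>V h) (\<Psi> *\<^sub>V cpower G i *\<^sub>V h))) = \<tau> h m - \<tau> h n"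
proof -
  have "Re (sp (\<Psi> *\<^sub>V cpower G i *\<^sub>V h) (\<Psi> *\<^sub>V cpower G i *\<^sub>V h)) = - (\<tau> h (Suc i) - \<tau> h i)" for i
    by (simp add: \<tau>_def cinner_self del: of_real_power flip: G_defect)
  then show ?thesis
    using sum_Suc_diff'[OF assms, of "\<tau> h"] by (simp only: sum_negf)
qed

text \<open>Powers of \<open>circle\<close> are orthogonal, so the energy of a block of the series
  is the decrease of \<tau> across it. Late blocks are therefore small, uniformly in t.\<close>

lemma J_interval_bound:
  assumes "m \<le> n" "m' \<le> n'"
  shows "cmod (J {m..<n} {m'..<n'} t h h') \<le> sqrt (\<tau> h m - \<tau> h n) * sqrt (\<tau> h' m' - \<tau> h' n')"
  using J_cauchy_schwarz[of "{m..<n}" "{m'..<n'}" t h h'] assms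
  by (simp add: J_diagonal energy real_le_rsqrt flip: real_sqrt_mult)

lemma sqrt_\<tau>_le: "sqrt (\<tau> h m - \<tau> h n) \<le> norm h"
proof -
  have "0 \<le> \<tau> h n"
    by (simp add: \<tau>_def)
  then have "\<tau> h m - \<tau> h n \<le> (norm h)\<^sup>2"
    using \<tau>_le[of h m] by linarith
  from real_sqrt_le_mono[OF this] show ?thesis
    by simp
qed

lemma J_split_left: "m \<le> n \<Longrightarrow> J {0..<n} S t h h' = J {0..<m} S t h h' + J {m..<n} S t h h'"
  and J_split_right: "m \<le> n \<Longrightarrow> J S {0..<n} t h h' = J S {0..<m} t h h' + J S {m..<n} t h h'"
  by (subst ivl_disj_un_two(3)[of 0 m n, symmetric]; simp add: J_Un_left J_Un_right)+

text \<open>The difference of the two index squares is an L-shaped region, which is cut into two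
  rectangles; each has one side beyond \<open>m\<close>.\<close>

lemma J_diff_bound:
  assumes "m \<le> n"
  shows "cmod (J {0..<n} {0..<n} t h h' - J {0..<m} {0..<m} t h h')
    \<le> sqrt (\<tau> h m - \<tau>_inf h) * norm h' + norm h * sqrt (\<tau> h' m - \<tau>_inf h')"
proof -
  have "J {0..<n} {0..<n} t h h' - J {0..<m} {0..<m} t h h' = J {m..<n} {0..<n} t h h' + J {0..<m} {m..<n} t h h'"
    using J_split_left[OF assms, of "{0..<n}" t h h'] J_split_right[OF assms, of "{0..<m}" t h h'] by simp
  also have "cmod \<dots> \<le> sqrt (\<tau> h m - \<tau> h n) * sqrt (\<tau> h' 0 - \<tau> h' n) + sqrt (\<tau> h 0 - \<tau> h m) * sqrt (\<tau> h' m - \<tau> h' n)"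
    using assms by (intro norm_triangle_le add_mono J_interval_bound) auto
  also have "\<dots> \<le> sqrt (\<tau> h m - \<tau>_inf h) * norm h' + norm h * sqrt (\<tau> h' m - \<tau>_inf h')"
    using \<tau>_inf_le[of h n] \<tau>_inf_le[of h' n] \<tau>_inf_le[of h m] \<tau>_inf_le[of h' m] decseqD[OF decseq_\<tau> assms]
      decseqD[OF decseq_\<tau>, of 0 n h'] decseqD[OF decseq_\<tau>, of 0 m h]
    by (intro add_mono mult_mono sqrt_\<tau>_le) auto
  finally show ?thesis .
qed

lemma \<delta>_lim: "(\<lambda>m. sqrt (\<tau> h m - \<tau>_inf h)) \<longlonglongrightarrow> 0"
proof -
  have "(\<lambda>m. sqrt (\<tau> h m - \<tau>_inf h)) \<longlonglongrightarrow> sqrt (\<tau>_inf h - \<tau>_inf h)"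
    by (intro tendsto_intros \<tau>_lim)
  then show ?thesis by simp
qed

section \<open>The form carried by the circle\<close>

definition B\<^sub>1 :: "real^'d \<Rightarrow> 'h \<Rightarrow> 'h \<Rightarrow> complex" where
  "B\<^sub>1 t h h' = lim (\<lambda>n. J {0..<n} {0..<n} t h h')"

lemma B\<^sub>1_uniform_limit: "uniform_limit UNIV (\<lambda>n t. J {0..<n} {0..<n} t h h') (\<lambda>t. B\<^sub>1 t h h') sequentially"
proof -
  have "uniformly_Cauchy_on UNIV (\<lambda>n t. J {0..<n} {0..<n} t h h')"
  proof (rule uniformly_Cauchy_onI)
    fix e :: real assume e: "0 < e"
    have "(\<lambda>m. sqrt (\<tau> h m - \<tau>_inf h) * norm h' + norm h * sqrt (\<tau> h' m - \<tau>_inf h')) \<longlonglongrightarrow> 0 * norm h' + norm h * 0"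
      by (intro tendsto_intros \<delta>_lim)
    then obtain M where M: "\<bar>sqrt (\<tau> h M - \<tau>_inf h) * norm h' + norm h * sqrt (\<tau> h' M - \<tau>_inf h')\<bar> < e / 2"
      using LIMSEQ_D[of _ 0 "e / 2"] e by fastforce
    show "\<exists>M. \<forall>t\<in>UNIV. \<forall>m\<ge>M. \<forall>n\<ge>M. dist (J {0..<m} {0..<m} t h h') (J {0..<n} {0..<n} t h h') < e"
    proof (intro exI[of _ M] ballI allI impI)
      fix t m n assume "M \<le> m" "M \<le> n"
      then have "dist (J {0..<m} {0..<m} t h h') (J {0..<M} {0..<M} t h h') < e / 2"
        "dist (J {0..<n} {0..<n} t h h') (J {0..<M} {0..<M} t h h') < e / 2"
        unfolding dist_norm using J_diff_bound[of M _ t h h'] M by (smt (verit))+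
      then show "dist (J {0..<m} {0..<m} t h h') (J {0..<n} {0..<n} t h h') < e"
        using dist_triangle_half_l by blast
    qed
  qed
  then obtain l where l: "uniform_limit UNIV (\<lambda>n t. J {0..<n} {0..<n} t h h') l sequentially"
    using Cauchy_uniformly_convergent uniformly_convergent_on_def by blast
  have "l t = B\<^sub>1 t h h'" for t
    unfolding B\<^sub>1_def using tendsto_uniform_limitI[OF l] by (intro limI[symmetric]) auto
  then have "l = (\<lambda>t. B\<^sub>1 t h h')"
    by (rule ext)
  with l show ?thesis by simp
qed

lemma B\<^sub>1_lim: "(\<lambda>n. J {0..<n} {0..<n} t h h') \<longlonglongrightarrow> B\<^sub>1 t h h'"
  using tendsto_uniform_limitI[OF B\<^sub>1_uniform_limit] by blast

text \<open>The terms are dominated by averages of the two diagonal series, whose sums are bounded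
  by the energy. \<open>G_power_defect\<close> turns convergence of the series into existence of the
  limit of the products.\<close>

lemma sums_defect: "(\<lambda>n. sp (\<Psi> *\<^sub>V cpower G n *\<^sub>V h) (\<Psi> *\<^sub>V cpower G n *\<^sub>V h'))
    sums (cinner h h' - lim (\<lambda>n. cinner (cpower G n *\<^sub>V h) (cpower G n *\<^sub>V h')))"
  and q_lim: "(\<lambda>n. cinner (cpower G n *\<^sub>V h) (cpower G n *\<^sub>V h')) \<longlonglongrightarrow> lim (\<lambda>n. cinner (cpower G n *\<^sub>V h) (cpower G n *\<^sub>V h'))"
proof -
  have en: "summable (\<lambda>n. Re (sp (\<Psi> *\<^sub>V cpower G n *\<^sub>V h) (\<Psi> *\<^sub>V cpower G n *\<^sub>V h)))" for h
  proof (rule bounded_imp_summable[where B = "(norm h)\<^sup>2"])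
    fix n
    have "(\<Sum>k<Suc n. Re (sp (\<Psi> *\<^sub>V cpower G k *\<^sub>V h) (\<Psi> *\<^sub>V cpower G k *\<^sub>V h))) \<le> (norm h)\<^sup>2"
      using energy[of 0 "Suc n" h] \<tau>_le[of h 0] by (simp add: \<tau>_def atLeast0LessThan del: sum.lessThan_Suc)
    then show "(\<Sum>k\<le>n. Re (sp (\<Psi> *\<^sub>V cpower G k *\<^sub>V h) (\<Psi> *\<^sub>V cpower G k *\<^sub>V h))) \<le> (norm h)\<^sup>2"
      by (simp only: lessThan_Suc_atMost)
  qed (rule sp_nonneg)
  have "summable (\<lambda>n. sp (\<Psi> *\<^sub>V cpower G n *\<^sub>V h) (\<Psi> *\<^sub>V cpower G n *\<^sub>V h'))"
    by (rule summable_norm_cancel, rule summable_comparison_test'[OF summable_divide[OF summable_add[OF en[of h] en[of h']], of 2], of 0])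
      (use sp_young in simp)
  then have S: "(\<lambda>n. \<Sum>i<n. sp (\<Psi> *\<^sub>V cpower G i *\<^sub>V h) (\<Psi> *\<^sub>V cpower G i *\<^sub>V h'))
      \<longlonglongrightarrow> (\<Sum>n. sp (\<Psi> *\<^sub>V cpower G n *\<^sub>V h) (\<Psi> *\<^sub>V cpower G n *\<^sub>V h'))" (is "_ \<longlonglongrightarrow> ?s")
    by (rule summable_LIMSEQ)
  have "(\<lambda>n. cinner h h' - (\<Sum>i<n. sp (\<Psi> *\<^sub>V cpower G i *\<^sub>V h) (\<Psi> *\<^sub>V cpower G i *\<^sub>V h'))) \<longlonglongrightarrow> cinner h h' - ?s"
    by (intro tendsto_intros S)
  then have q: "(\<lambda>n. cinner (cpower G n *\<^sub>V h) (cpower G n *\<^sub>V h')) \<longlonglongrightarrow> cinner h h' - ?s"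
    by (simp add: G_power_defect)
  then show "(\<lambda>n. cinner (cpower G n *\<^sub>V h) (cpower G n *\<^sub>V h')) \<longlonglongrightarrow> lim (\<lambda>n. cinner (cpower G n *\<^sub>V h) (cpower G n *\<^sub>V h'))"
    by (simp add: limI)
  show "(\<lambda>n. sp (\<Psi> *\<^sub>V cpower G n *\<^sub>V h) (\<Psi> *\<^sub>V cpower G n *\<^sub>V h'))
    sums (cinner h h' - lim (\<lambda>n. cinner (cpower G n *\<^sub>V h) (cpower G n *\<^sub>V h')))"
    using S by (simp add: limI[OF q] sums_def)
qed

section \<open>The asymptotic form of the powers of \<open>G\<close>\<close>

definition q :: "'h \<Rightarrow> 'h \<Rightarrow> complex" where
  "q h h' = lim (\<lambda>n. cinner (cpower G n *\<^sub>V h) (cpower G n *\<^sub>V h'))"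

lemma q_tendsto: "(\<lambda>n. cinner (cpower G n *\<^sub>V h) (cpower G n *\<^sub>V h')) \<longlonglongrightarrow> q h h'"
  unfolding q_def by (rule q_lim)

lemma q_add_left: "q (g + h) h' = q g h' + q h h'"
  and q_add_right: "q h' (g + h) = q h' g + q h' h"
  by (rule LIMSEQ_unique[OF q_tendsto], simp add: cblinfun_linear cinner_simps, intro tendsto_intros q_tendsto)+

lemma q_scaleC_left: "q (c *\<^sub>C h) h' = c * q h h'"
  and q_scaleC_right: "q h (c *\<^sub>C h') = cnj c * q h h'"
  by (rule LIMSEQ_unique[OF q_tendsto], simp add: cblinfun_linear cinner_simps, intro tendsto_intros q_tendsto)+

lemma bounded_bilinear_q: "bounded_bilinear q"
proof
  show "\<exists>K. \<forall>a b. norm (q a b) \<le> norm a * norm b * K"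
  proof (intro exI[of _ 1] allI)
    fix x y
    have "cmod (q x y) \<le> norm x * norm y"
      by (rule Lim_bounded[OF tendsto_norm[OF q_tendsto], of 0])
        (auto intro!: order_trans[OF cmod_cinner_le] mult_mono norm_G_power_le)
    then show "norm (q x y) \<le> norm x * norm y * 1" by simp
  qed
qed (auto simp: q_add_left q_add_right scaleR_scaleC[where 'a = 'h] scaleR_conv_of_real q_scaleC_left q_scaleC_right)

text \<open>As \<open>G\<close> commutes with \<open>N \<xi>\<close>, these vectors are multiples of
  \<open>\<Psi> *\<^sub>V cpower G n *\<^sub>V g\<close> for
  \<open>g = h + \<i> *\<^sub>C (N \<xi> *\<^sub>V h)\<close>. Their energies form a convergent
  series, and coercivity of \<open>P\<close> bounds the norms by the energies.\<close>

lemma \<Phi>_G_power_tendsto: "(\<lambda>n. \<Phi> *\<^sub>V cpower G n *\<^sub>V h) \<longlonglongrightarrow> 0"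
proof -
  define g where "g = h + \<i> *\<^sub>C (N \<xi> *\<^sub>V h)"
  have "resol 1 *\<^sub>V cpower G n *\<^sub>V g = cpower G n *\<^sub>V h" for n
    using resol_left[of 1 "cpower G n *\<^sub>V h"] by (simp add: g_def cblinfun_linear N_G_power)
  then have \<Phi>: "\<Phi> *\<^sub>V cpower G n *\<^sub>V h = (1 / sqrt 2) *\<^sub>R (\<Psi> *\<^sub>V cpower G n *\<^sub>V g)" for n
    by (simp add: \<Psi>_def)
  have "(\<lambda>n. Re (sp (\<Psi> *\<^sub>V cpower G n *\<^sub>V g) (\<Psi> *\<^sub>V cpower G n *\<^sub>V g)) / \<epsilon>) \<longlonglongrightarrow> Re 0 / \<epsilon>"
    using summable_LIMSEQ_zero[OF sums_summable[OF sums_defect]] \<epsilon> by (intro tendsto_intros) auto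
  then have "(\<lambda>n. sqrt (Re (sp (\<Psi> *\<^sub>V cpower G n *\<^sub>V g) (\<Psi> *\<^sub>V cpower G n *\<^sub>V g)) / \<epsilon>)) \<longlonglongrightarrow> sqrt (Re 0 / \<epsilon>)"
    by (rule tendsto_real_sqrt)
  then have "(\<lambda>n. \<Psi> *\<^sub>V cpower G n *\<^sub>V g) \<longlonglongrightarrow> 0"
  proof (rule Lim_null_comparison[rotated, OF tendsto_eq_rhs])
    show "\<forall>\<^sub>F n in sequentially. norm (\<Psi> *\<^sub>V cpower G n *\<^sub>V g)
        \<le> sqrt (Re (sp (\<Psi> *\<^sub>V cpower G n *\<^sub>V g) (\<Psi> *\<^sub>V cpower G n *\<^sub>V g)) / \<epsilon>)"
      using sp_coercive \<epsilon> by (intro always_eventually allI real_le_rsqrt) (simp add: field_simps)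
  qed simp
  then have "(\<lambda>n. (1 / sqrt 2) *\<^sub>R (\<Psi> *\<^sub>V cpower G n *\<^sub>V g)) \<longlonglongrightarrow> (1 / sqrt 2) *\<^sub>R 0"
    by (intro tendsto_intros)
  then show ?thesis by (simp add: \<Phi>)
qed

text \<open>The defect of symmetry of \<open>N t\<close> is a form in \<Phi>, which tends to 0 along
  the powers of \<open>G\<close>. Consequently \<open>exp_op (\<i> *\<^sub>C N t)\<close> preserves
  \<open>q\<close> for every t, whatever its sign.\<close>

lemma q_N: "q (N t *\<^sub>V h) h' = q h (N t *\<^sub>V h')"
proof -
  have "(\<lambda>n. - \<i> * sp (a t *\<^sub>V \<Phi> *\<^sub>V cpower G n *\<^sub>V h) (\<Phi> *\<^sub>V cpower G n *\<^sub>V h')) \<longlonglongrightarrow> - \<i> * sp (a t *\<^sub>V 0) 0"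
    by (intro tendsto_intros sp.tendsto \<Phi>_G_power_tendsto)
  then have "(\<lambda>n. cinner (cpower G n *\<^sub>V N t *\<^sub>V h) (cpower G n *\<^sub>V h') - cinner (cpower G n *\<^sub>V h) (cpower G n *\<^sub>V N t *\<^sub>V h')) \<longlonglongrightarrow> 0"
    by (simp only: N_skew'[symmetric] N_G_power cblinfun_zero_right sp.zero_left mult_zero_right)
  moreover have "(\<lambda>n. cinner (cpower G n *\<^sub>V N t *\<^sub>V h) (cpower G n *\<^sub>V h') - cinner (cpower G n *\<^sub>V h) (cpower G n *\<^sub>V N t *\<^sub>V h'))
      \<longlonglongrightarrow> q (N t *\<^sub>V h) h' - q h (N t *\<^sub>V h')"
    by (intro tendsto_intros q_tendsto)
  ultimately show ?thesis
    using LIMSEQ_unique by fastforce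
qed

lemma q_exp_N: "q (exp_op ((- \<i>) *\<^sub>C N t) *\<^sub>V h) h' = q h (exp_op (\<i> *\<^sub>C N t) *\<^sub>V h')"
  "q (exp_op (\<i> *\<^sub>C N t) *\<^sub>V h) h' = q h (exp_op ((- \<i>) *\<^sub>C N t) *\<^sub>V h')"
  by (rule exp_op_adjoint[OF bounded_bilinear_q],
      simp only: scaleC_cblinfun.rep_eq q_scaleC_left q_scaleC_right q_N, simp)+

definition B\<^sub>2 :: "real^'d \<Rightarrow> 'h \<Rightarrow> 'h \<Rightarrow> complex" where
  "B\<^sub>2 t h h' = q h (exp_op ((- \<i>) *\<^sub>C N t) *\<^sub>V h')"

lemma B\<^sub>2_diff: "B\<^sub>2 (s - t) h h' = q (exp_op (\<i> *\<^sub>C N s) *\<^sub>V h) (exp_op (\<i> *\<^sub>C N t) *\<^sub>V h')"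
proof -
  have comm: "N s o\<^sub>C\<^sub>L N t = N t o\<^sub>C\<^sub>L N s"
    by (rule cblinfun_eqI) (simp add: N_commute)
  have "(- \<i>) *\<^sub>C N (s - t) = (- \<i>) *\<^sub>C N s + \<i> *\<^sub>C N t"
    by (simp add: linear_diff[OF linear_N] scaleC_diff_right)
  then have "exp_op ((- \<i>) *\<^sub>C N (s - t)) = exp_op ((- \<i>) *\<^sub>C N s + \<i> *\<^sub>C N t)"
    by (rule arg_cong)
  also have "\<dots> = exp_op ((- \<i>) *\<^sub>C N s) o\<^sub>C\<^sub>L exp_op (\<i> *\<^sub>C N t)"
    by (rule exp_op_add) (simp only: cblinfun_compose_scaleC comm scaleC_scaleC mult.commute)
  finally show ?thesis
    by (simp add: B\<^sub>2_def q_exp_N(2))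
qed

lemma q_self: "0 \<le> q h h"
proof -
  have re: "(\<lambda>n. of_real (\<tau> h n)) \<longlonglongrightarrow> q h h"
    using q_tendsto[of h h] by (simp add: \<tau>_def cinner_self)
  have "(\<lambda>n. complex_of_real (\<tau> h n)) \<longlonglongrightarrow> of_real (\<tau>_inf h)"
    by (intro tendsto_intros \<tau>_lim)
  with re have "q h h = of_real (\<tau>_inf h)"
    by (rule LIMSEQ_unique)
  moreover have "0 \<le> \<tau>_inf h"
    by (rule LIMSEQ_le_const[OF \<tau>_lim]) (auto simp: \<tau>_def)
  ultimately show ?thesis by (simp add: less_eq_complex_def)
qed

lemma B\<^sub>2_psd: "psd_kernel (\<lambda>x y. B\<^sub>2 (fst x - fst y) (snd x) (snd y))"
  unfolding psd_kernel_def
proof (intro allI impI)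
  fix F :: "((real^'d) \<times> 'h) set" and c :: "(real^'d) \<times> 'h \<Rightarrow> complex" assume "finite F"
  interpret q: bounded_bilinear q by (rule bounded_bilinear_q)
  define g where "g = (\<Sum>x\<in>F. c x *\<^sub>C (exp_op (\<i> *\<^sub>C N (fst x)) *\<^sub>V snd x))"
  have "q g g = (\<Sum>x\<in>F. \<Sum>y\<in>F. c x * cnj (c y) * B\<^sub>2 (fst x - fst y) (snd x) (snd y))"
    unfolding g_def q.sum_left q.sum_right q_scaleC_left q_scaleC_right B\<^sub>2_diff
    by (subst sum.swap) (simp add: sum_distrib_left mult_ac)
  then show "0 \<le> (\<Sum>x\<in>F. \<Sum>y\<in>F. c x * cnj (c y) * B\<^sub>2 (fst x - fst y) (snd x) (snd y))"
    using q_self[of g] by simp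
qed

lemma continuous_on_B\<^sub>2: "continuous_on UNIV (\<lambda>t. B\<^sub>2 t h h')"
proof -
  have "continuous_on UNIV N"
    using linear_N by (simp add: linear_continuous_on linear_conv_bounded_linear)
  then show ?thesis
    unfolding B\<^sub>2_def
    by (intro bounded_bilinear.continuous_on[OF bounded_bilinear_q] continuous_on_apply_cblinfun
        continuous_on_exp_op continuous_on_scaleC_cblinfun continuous_intros)
qed

text \<open>The form is a limit over index squares, while \<open>boundary_sum\<close> evaluates one
  column index at a time with the row sum already complete. The estimate \<open>close\<close>
  compares squares with rectangles of fixed width uniformly in n, which reconciles the two limits;
  the columns then add up to the defect of \<open>G\<close> between \<open>g\<close> and
  \<open>h'\<close>.\<close>

lemma B\<^sub>1_minus:
  assumes a_pos: "\<And>u. 0 \<le> Re (sp (a t *\<^sub>V u) u)"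
  shows "B\<^sub>1 (- t) h h' = cinner (exp_op ((- \<i>) *\<^sub>C N t) *\<^sub>V h) h' - q (exp_op ((- \<i>) *\<^sub>C N t) *\<^sub>V h) h'"
proof -
  define g where "g = exp_op ((- \<i>) *\<^sub>C N t) *\<^sub>V h"
  define \<beta> where "\<beta> j = sp (\<Psi> *\<^sub>V cpower G j *\<^sub>V g) (\<Psi> *\<^sub>V cpower G j *\<^sub>V h')" for j
  have row: "(\<lambda>n. J {0..<n} {j} (- t) h h') \<longlonglongrightarrow> \<beta> j" for j
  proof -
    \<comment> \<open>\<open>boundary_sum\<close> takes convergence as a hypothesis. It comes from
      the energy bound for a late block of rows against the single column \<open>j\<close>.\<close>
    have conv: "convergent (\<lambda>n. J {0..<n} {j} (- t) h h')"
    proof (rule Cauchy_convergent, rule CauchyI')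
      fix e :: real assume e: "0 < e"
      have "(\<lambda>m. sqrt (\<tau> h m - \<tau>_inf h) * norm h') \<longlonglongrightarrow> 0 * norm h'"
        by (intro tendsto_intros \<delta>_lim)
      then obtain M where M: "\<And>m. m \<ge> M \<Longrightarrow> \<bar>sqrt (\<tau> h m - \<tau>_inf h) * norm h'\<bar> < e"
        using LIMSEQ_D[of _ 0 e] e by fastforce
      show "\<exists>M. \<forall>m\<ge>M. \<forall>n>m. dist (J {0..<m} {j} (- t) h h') (J {0..<n} {j} (- t) h h') < e"
      proof (intro exI[of _ M] allI impI)
        fix m n assume mn: "M \<le> m" "m < n"
        have "dist (J {0..<m} {j} (- t) h h') (J {0..<n} {j} (- t) h h') = cmod (J {m..<n} {j..<Suc j} (- t) h h')"
          using J_split_left[of m n "{j}" "- t" h h'] mn by (simp add: dist_norm norm_minus_commute)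
        also have "\<dots> \<le> sqrt (\<tau> h m - \<tau> h n) * sqrt (\<tau> h' j - \<tau> h' (Suc j))"
          using mn by (intro J_interval_bound) auto
        also have "\<dots> \<le> sqrt (\<tau> h m - \<tau>_inf h) * norm h'"
          using \<tau>_inf_le[of h n] decseqD[OF decseq_\<tau>, of j "Suc j" h'] \<tau>_inf_le[of h m]
          by (intro mult_mono sqrt_\<tau>_le) auto
        also have "\<dots> < e"
          using M[OF mn(1)] by simp
        finally show "dist (J {0..<m} {j} (- t) h h') (J {0..<n} {j} (- t) h h') < e" .
      qed
    qed
    then obtain l where l: "(\<lambda>n. J {0..<n} {j} (- t) h h') \<longlonglongrightarrow> l"
      by (auto simp: convergent_def)
    have "(\<lambda>n. circle_mean 1 (\<lambda>z. z ^ j * (1 / z) ^ n *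
        sp (exp_op ((- \<i>) *\<^sub>C D (half_plane z) t) *\<^sub>V \<Psi> *\<^sub>V cpower G n *\<^sub>V h) (\<Psi> *\<^sub>V cpower G j *\<^sub>V h'))) sums l"
      using l by (simp add: J_expand E_minus sums_def circle_mean_def atLeast0LessThan)
    from boundary_sum[OF a_pos this] have "l = sp (\<Psi> *\<^sub>V exp_op ((- \<i>) *\<^sub>C N t) *\<^sub>V cpower G j *\<^sub>V h) (\<Psi> *\<^sub>V cpower G j *\<^sub>V h')" .
    also have "exp_op ((- \<i>) *\<^sub>C N t) *\<^sub>V cpower G j *\<^sub>V h = cpower G j *\<^sub>V g"
      unfolding g_def by (rule exp_op_intertwine[symmetric]) (simp add: cblinfun_linear N_G_power)
    finally show ?thesis
      using l by (simp add: \<beta>_def)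
  qed
  have cols: "(\<lambda>n. J {0..<n} {0..<m} (- t) h h') \<longlonglongrightarrow> (\<Sum>j<m. \<beta> j)" for m
  proof (induction m)
    case 0
    then show ?case by (simp add: J_expand)
  next
    case (Suc m)
    have "J {0..<n} {0..<Suc m} (- t) h h' = J {0..<n} {0..<m} (- t) h h' + J {0..<n} {m} (- t) h h'" for n
      using J_split_right[of m "Suc m" "{0..<n}" "- t" h h'] by simp
    then show ?case
      using tendsto_add[OF Suc row[of m]] by simp
  qed
  have close: "cmod (B\<^sub>1 (- t) h h' - (\<Sum>j<m. \<beta> j)) \<le> norm h * sqrt (\<tau> h' m - \<tau>_inf h')" for m
  proof (rule Lim_bounded[where M = m])
    show "(\<lambda>n. cmod (J {0..<n} {0..<n} (- t) h h' - J {0..<n} {0..<m} (- t) h h')) \<longlonglongrightarrow> cmod (B\<^sub>1 (- t) h h' - (\<Sum>j<m. \<beta> j))"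
      by (intro tendsto_intros B\<^sub>1_lim cols)
    show "\<forall>n\<ge>m. cmod (J {0..<n} {0..<n} (- t) h h' - J {0..<n} {0..<m} (- t) h h') \<le> norm h * sqrt (\<tau> h' m - \<tau>_inf h')"
    proof (intro allI impI)
      fix n assume n: "m \<le> n"
      have "cmod (J {0..<n} {0..<n} (- t) h h' - J {0..<n} {0..<m} (- t) h h') = cmod (J {0..<n} {m..<n} (- t) h h')"
        using J_split_right[OF n, of "{0..<n}" "- t" h h'] by simp
      also have "\<dots> \<le> sqrt (\<tau> h 0 - \<tau> h n) * sqrt (\<tau> h' m - \<tau> h' n)"
        using n by (intro J_interval_bound) auto
      also have "\<dots> \<le> norm h * sqrt (\<tau> h' m - \<tau>_inf h')"
        using \<tau>_inf_le[of h' n] decseqD[OF decseq_\<tau> n, of h'] by (intro mult_mono sqrt_\<tau>_le) auto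
      finally show "cmod (J {0..<n} {0..<n} (- t) h h' - J {0..<n} {0..<m} (- t) h h') \<le> norm h * sqrt (\<tau> h' m - \<tau>_inf h')" .
    qed
  qed
  have "(\<lambda>m. B\<^sub>1 (- t) h h' - (\<Sum>j<m. \<beta> j)) \<longlonglongrightarrow> 0"
  proof (rule Lim_null_comparison[OF always_eventually])
    show "\<forall>m. norm (B\<^sub>1 (- t) h h' - (\<Sum>j<m. \<beta> j)) \<le> norm h * sqrt (\<tau> h' m - \<tau>_inf h')"
      using close by blast
    have "(\<lambda>m. norm h * sqrt (\<tau> h' m - \<tau>_inf h')) \<longlonglongrightarrow> norm h * 0"
      by (intro tendsto_intros \<delta>_lim)
    then show "(\<lambda>m. norm h * sqrt (\<tau> h' m - \<tau>_inf h')) \<longlonglongrightarrow> 0" by simp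
  qed
  then have "(\<lambda>m. B\<^sub>1 (- t) h h' - (B\<^sub>1 (- t) h h' - (\<Sum>j<m. \<beta> j))) \<longlonglongrightarrow> B\<^sub>1 (- t) h h' - 0"
    by (intro tendsto_diff tendsto_const)
  then have "(\<lambda>m. \<Sum>j<m. \<beta> j) \<longlonglongrightarrow> B\<^sub>1 (- t) h h'"
    by simp
  moreover have "(\<lambda>m. \<Sum>j<m. \<beta> j) \<longlonglongrightarrow> cinner g h' - q g h'"
    using sums_defect[of g h'] by (simp add: sums_def \<beta>_def q_def)
  ultimately show ?thesis
    unfolding g_def by (rule LIMSEQ_unique)
qed

text \<open>At \<open>- t\<close> the circle contributes the compressed exponential minus its
  \<open>q\<close> part, and the asymptotic form restores exactly this part. The formula at t itself
  follows from the hermitian symmetry of the positive definite kernel.\<close>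

theorem unitary_dilation:
  assumes separable: "separable_space (euclidean :: 'h topology)"
  obtains \<iota> :: "'h \<Rightarrow>\<^sub>C\<^sub>L ell2" and \<rho> where "isometry_op \<iota>" "unitary_representation \<rho>"
    "\<And>t x y. \<forall>u. 0 \<le> Re (cinner (P *\<^sub>V a t *\<^sub>V u) u) \<Longrightarrow>
      cinner (\<rho> t *\<^sub>V \<iota> *\<^sub>V x) (\<iota> *\<^sub>V y) = cinner x (exp_op ((- \<i>) *\<^sub>C N t) *\<^sub>V y)"
proof -
  define B where "B t x y = B\<^sub>1 t x y + B\<^sub>2 t x y" for t x y
  have minus: "B (- t) x y = cinner (exp_op ((- \<i>) *\<^sub>C N t) *\<^sub>V x) y" if "\<And>u. 0 \<le> Re (sp (a t *\<^sub>V u) u)" for t x y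
  proof -
    have "(- \<i>) *\<^sub>C N (- t) = \<i> *\<^sub>C N t"
      by (simp add: linear_neg[OF linear_N])
    then have "B\<^sub>2 (- t) x y = q (exp_op ((- \<i>) *\<^sub>C N t) *\<^sub>V x) y"
      unfolding B\<^sub>2_def q_exp_N(1) by (simp only:)
    then show ?thesis
      by (simp add: B_def B\<^sub>1_minus[OF that])
  qed
  have B1_simps: "B\<^sub>1 t (x + y) z = B\<^sub>1 t x z + B\<^sub>1 t y z" "B\<^sub>1 t z (x + y) = B\<^sub>1 t z x + B\<^sub>1 t z y"
    "B\<^sub>1 t (c *\<^sub>C x) z = c * B\<^sub>1 t x z" "B\<^sub>1 t z (c *\<^sub>C x) = cnj c * B\<^sub>1 t z x" for t x y z c
    by (rule LIMSEQ_unique[OF B\<^sub>1_lim], simp add: J_add_left J_add_right J_scaleC_left J_scaleC_right,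
        intro tendsto_intros B\<^sub>1_lim)+
  have psd: "psd_kernel (\<lambda>x y. B (fst x - fst y) (snd x) (snd y))"
    unfolding B_def
    by (intro psd_kernel_add B\<^sub>2_psd psd_kernel_limit[OF J_psd B\<^sub>1_lim]) simp
  \<comment> \<open>The operator \<open>a 0\<close> is zero, so the formula for \<open>minus\<close>
    already covers t = 0 and shows that \<open>B 0\<close> is the inner product.\<close>
  have a0: "0 \<le> Re (sp (a 0 *\<^sub>V u) u)" for u
    by (simp add: linear_0[OF linear_a] sp.zero_left)
  have B0: "B 0 x y = cinner x y" for x y
    using minus[OF a0, of x y] by (simp add: linear_0[OF linear_N])
  have cont: "continuous_on UNIV (\<lambda>t. B t x y)" for x y
    unfolding B_def
    by (intro continuous_intros continuous_on_B\<^sub>2 uniform_limit_theorem[OF _ B\<^sub>1_uniform_limit])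
      (auto intro!: always_eventually continuous_on_J)
  obtain \<iota> :: "'h \<Rightarrow>\<^sub>C\<^sub>L ell2" and \<rho> where \<rho>: "isometry_op \<iota>" "unitary_representation \<rho>"
    "\<And>t x y. cinner (\<rho> t *\<^sub>V \<iota> *\<^sub>V x) (\<iota> *\<^sub>V y) = B t x y"
  proof (rule unitary_representation_of_positive_definite[OF separable _ _ _ _ psd B0 cont])
    fix t x y z and c :: complex
    show "B t (x + y) z = B t x z + B t y z" "B t z (x + y) = B t z x + B t z y"
      "B t (c *\<^sub>C x) z = c * B t x z" "B t z (c *\<^sub>C x) = cnj c * B t z x"
      by (simp_all add: B_def B1_simps B\<^sub>2_def q_add_left q_add_right q_scaleC_left q_scaleC_right
          cblinfun_linear algebra_simps)
  qed (rule that)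
  show thesis
  proof (rule that[OF \<rho>(1,2)])
    fix t x y assume pos: "\<forall>u. 0 \<le> Re (cinner (P *\<^sub>V a t *\<^sub>V u) u)"
    have "B t x y = cnj (B (- t) y x)"
      using psd_kernel_hermitian[OF psd, of "(t, x)" "(0, y)"] by simp
    also have "\<dots> = cinner x (exp_op ((- \<i>) *\<^sub>C N t) *\<^sub>V y)"
      using minus[of t y x] pos by (simp add: sp_def flip: cinner_commute)
    finally show "cinner (\<rho> t *\<^sub>V \<iota> *\<^sub>V x) (\<iota> *\<^sub>V y) = cinner x (exp_op ((- \<i>) *\<^sub>C N t) *\<^sub>V y)"
      by (simp only: \<rho>(3))
  qed
qed

end

section \<open>From vessels to the dilation data\<close>

lemma lin_comb_apply: "lin_comb A t *\<^sub>V x = (\<Sum>j\<in>UNIV. (t $ j) *\<^sub>R (A j *\<^sub>V x))"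
  by (simp add: lin_comb_def cblinfun_sum_left)

lemma bilin_comb_apply: "bilin_comb \<gamma> s t *\<^sub>V x = (\<Sum>i\<in>UNIV. \<Sum>l\<in>UNIV. (s $ i * t $ l) *\<^sub>R (\<gamma> i l *\<^sub>V x))"
  by (simp add: bilin_comb_def cblinfun_sum_left)

text \<open>All relations of the vessel are contracted with the coordinates of \<xi> and t.
  Multiplying the contracted input condition by \<open>p\<close> isolates
  \<open>\<Phi> *\<^sub>V N t\<close> and explains the choice of \<open>a\<close> and
  \<open>b\<close>.\<close>

lemma (in vessel) dilation_data_of_vessel:
  fixes \<xi> :: "real^'d"
  defines "\<sigma>\<^sub>\<xi> \<equiv> lin_comb \<sigma> \<xi>"
  assumes pencil: "\<And>x s t. (p o\<^sub>C\<^sub>L (x *\<^sub>C lin_comb \<sigma> s + bilin_comb \<gamma> \<xi> s)) o\<^sub>C\<^sub>L (p o\<^sub>C\<^sub>L (x *\<^sub>C lin_comb \<sigma> t + bilin_comb \<gamma> \<xi> t))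
      = (p o\<^sub>C\<^sub>L (x *\<^sub>C lin_comb \<sigma> t + bilin_comb \<gamma> \<xi> t)) o\<^sub>C\<^sub>L (p o\<^sub>C\<^sub>L (x *\<^sub>C lin_comb \<sigma> s + bilin_comb \<gamma> \<xi> s))"
    and p: "\<sigma>\<^sub>\<xi> o\<^sub>C\<^sub>L p = id_cblinfun" "p o\<^sub>C\<^sub>L \<sigma>\<^sub>\<xi> = id_cblinfun"
    and \<epsilon>: "0 < \<epsilon>" "\<And>u. \<epsilon> * (norm u)\<^sup>2 \<le> Re (cinner (\<sigma>\<^sub>\<xi> *\<^sub>V u) u)"
  shows "dilation_data (lin_comb (\<lambda>j. cadjoint (A j))) \<Phi> \<sigma>\<^sub>\<xi> (\<lambda>t. p o\<^sub>C\<^sub>L lin_comb \<sigma> t)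
    (\<lambda>t. p o\<^sub>C\<^sub>L bilin_comb \<gamma> \<xi> t) \<xi> \<epsilon>"
proof -
  have \<sigma>_sym: "cinner (lin_comb \<sigma> t *\<^sub>V u) v = cinner u (lin_comb \<sigma> t *\<^sub>V v)" for t u v
    by (simp add: lin_comb_apply cinner_sum_left cinner_sum_right selfadjoint_cinner[OF selfadjoint_\<sigma>])
  have \<gamma>_sym: "cinner (bilin_comb \<gamma> s t *\<^sub>V u) v = cinner u (bilin_comb \<gamma> s t *\<^sub>V v)" for s t u v
    by (simp add: bilin_comb_apply cinner_sum_left cinner_sum_right selfadjoint_cinner[OF selfadjoint_\<gamma>])
  have \<sigma>p: "\<sigma>\<^sub>\<xi> *\<^sub>V p *\<^sub>V u = u" and p\<sigma>: "p *\<^sub>V \<sigma>\<^sub>\<xi> *\<^sub>V u = u" for u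
    using arg_cong[OF p(1), of "\<lambda>B. B *\<^sub>V u"] arg_cong[OF p(2), of "\<lambda>B. B *\<^sub>V u"] by simp_all
  have sym: "cinner (\<sigma>\<^sub>\<xi> *\<^sub>V u) v = cinner u (\<sigma>\<^sub>\<xi> *\<^sub>V v)" for u v
    unfolding \<sigma>\<^sub>\<xi>_def by (rule \<sigma>_sym)
  let ?N = "lin_comb (\<lambda>j. cadjoint (A j))"
  have A_adj: "cadjoint (A j) *\<^sub>V cadjoint (A k) *\<^sub>V h = cadjoint (A k) *\<^sub>V cadjoint (A j) *\<^sub>V h" for j k h
    using arg_cong[OF commuting[of j k], of "\<lambda>B. cadjoint B *\<^sub>V h"] by (simp add: cadjoint_compose)
  show ?thesis
  proof (rule dilation_data.intro)
    show "linear ?N"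
      by (rule linear_lin_comb)
    show "linear (\<lambda>t. p o\<^sub>C\<^sub>L lin_comb \<sigma> t)" "linear (\<lambda>t. p o\<^sub>C\<^sub>L bilin_comb \<gamma> \<xi> t)"
      using bilinear_bilin_comb[of \<gamma>]
      by (auto simp: bilinear_def intro!: linear_lin_comb linear_compose[OF _
            bounded_linear.linear[OF cblinfun_compose.bounded_linear_right], unfolded o_def])
    show "?N s *\<^sub>V ?N t *\<^sub>V h = ?N t *\<^sub>V ?N s *\<^sub>V h" for s t h
      unfolding lin_comb_apply cblinfun_sum_right cblinfun_scaleR_right scaleR_sum_right
      by (subst sum.swap) (simp add: A_adj mult.commute)
    show "cinner (\<sigma>\<^sub>\<xi> *\<^sub>V (p o\<^sub>C\<^sub>L lin_comb \<sigma> t) *\<^sub>V u) v = cinner (\<sigma>\<^sub>\<xi> *\<^sub>V u) ((p o\<^sub>C\<^sub>L lin_comb \<sigma> t) *\<^sub>V v)"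
      "cinner (\<sigma>\<^sub>\<xi> *\<^sub>V (p o\<^sub>C\<^sub>L bilin_comb \<gamma> \<xi> t) *\<^sub>V u) v = cinner (\<sigma>\<^sub>\<xi> *\<^sub>V u) ((p o\<^sub>C\<^sub>L bilin_comb \<gamma> \<xi> t) *\<^sub>V v)" for t u v
      by (simp_all add: \<sigma>p sym \<sigma>_sym \<gamma>_sym)
    show "p o\<^sub>C\<^sub>L lin_comb \<sigma> \<xi> = id_cblinfun"
      using p(2) by (simp add: \<sigma>\<^sub>\<xi>_def)
    show "\<Phi> *\<^sub>V ?N t *\<^sub>V h = (p o\<^sub>C\<^sub>L lin_comb \<sigma> t) *\<^sub>V \<Phi> *\<^sub>V ?N \<xi> *\<^sub>V h + (p o\<^sub>C\<^sub>L bilin_comb \<gamma> \<xi> t) *\<^sub>V \<Phi> *\<^sub>V h" for t h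
    proof -
      have expand: "lin_comb \<sigma> s *\<^sub>V \<Phi> *\<^sub>V ?N t *\<^sub>V h = (\<Sum>j\<in>UNIV. \<Sum>k\<in>UNIV. (s $ j * t $ k) *\<^sub>R (\<sigma> j *\<^sub>V \<Phi> *\<^sub>V cadjoint (A k) *\<^sub>V h))" for s t
        unfolding lin_comb_apply cblinfun_sum_right cblinfun_scaleR_right scaleR_sum_right
        by (subst sum.swap) (simp add: mult.commute)
      have input: "\<sigma> j *\<^sub>V \<Phi> *\<^sub>V cadjoint (A k) *\<^sub>V h = \<sigma> k *\<^sub>V \<Phi> *\<^sub>V cadjoint (A j) *\<^sub>V h + \<gamma> j k *\<^sub>V \<Phi> *\<^sub>V h" for j k
        using arg_cong[OF input_compat[of j k], of "\<lambda>B. B *\<^sub>V h"] by (simp add: algebra_simps)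
      have "\<sigma>\<^sub>\<xi> *\<^sub>V \<Phi> *\<^sub>V ?N t *\<^sub>V h = (\<Sum>j\<in>UNIV. \<Sum>k\<in>UNIV. (\<xi> $ j * t $ k) *\<^sub>R (\<sigma> k *\<^sub>V \<Phi> *\<^sub>V cadjoint (A j) *\<^sub>V h))
          + bilin_comb \<gamma> \<xi> t *\<^sub>V \<Phi> *\<^sub>V h"
        unfolding \<sigma>\<^sub>\<xi>_def expand bilin_comb_apply by (subst input) (simp add: scaleR_add_right sum.distrib)
      also have "(\<Sum>j\<in>UNIV. \<Sum>k\<in>UNIV. (\<xi> $ j * t $ k) *\<^sub>R (\<sigma> k *\<^sub>V \<Phi> *\<^sub>V cadjoint (A j) *\<^sub>V h)) = lin_comb \<sigma> t *\<^sub>V \<Phi> *\<^sub>V ?N \<xi> *\<^sub>V h"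
        unfolding expand by (subst sum.swap) (simp add: mult.commute)
      finally show ?thesis
        using p\<sigma>[of "\<Phi> *\<^sub>V ?N t *\<^sub>V h"] by (simp add: cblinfun_linear)
    qed
    show "cinner (?N t *\<^sub>V h) h' - cinner h (?N t *\<^sub>V h') = - \<i> * cinner (\<sigma>\<^sub>\<xi> *\<^sub>V (p o\<^sub>C\<^sub>L lin_comb \<sigma> t) *\<^sub>V \<Phi> *\<^sub>V h) (\<Phi> *\<^sub>V h')" for t h h'
    proof -
      have "cinner (cadjoint (A k) *\<^sub>V h) h' - cinner h (cadjoint (A k) *\<^sub>V h') = - \<i> * cinner (\<sigma> k *\<^sub>V \<Phi> *\<^sub>V h) (\<Phi> *\<^sub>V h')" for k
      proof -
        have "cinner (cadjoint (A k) *\<^sub>V h) h' - cinner h (cadjoint (A k) *\<^sub>V h') = cinner h ((A k - cadjoint (A k)) *\<^sub>V h')"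
          by (simp add: cinner_cadjoint_left cinner_simps)
        also have "\<dots> = - \<i> * cinner h (cadjoint \<Phi> *\<^sub>V \<sigma> k *\<^sub>V \<Phi> *\<^sub>V h')"
          unfolding colligation by (simp add: cinner_simps)
        also have "\<dots> = - \<i> * cinner (\<sigma> k *\<^sub>V \<Phi> *\<^sub>V h) (\<Phi> *\<^sub>V h')"
          by (simp only: cinner_cadjoint[symmetric] selfadjoint_cinner[OF selfadjoint_\<sigma>])
        finally show ?thesis .
      qed
      then have "(\<Sum>k\<in>UNIV. of_real (t $ k) * (cinner (cadjoint (A k) *\<^sub>V h) h' - cinner h (cadjoint (A k) *\<^sub>V h')))
          = (\<Sum>k\<in>UNIV. of_real (t $ k) * (- \<i> * cinner (\<sigma> k *\<^sub>V \<Phi> *\<^sub>V h) (\<Phi> *\<^sub>V h')))"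
        by (simp only:)
      then show ?thesis
        by (simp add: \<sigma>p lin_comb_apply cinner_sum_left cinner_sum_right right_diff_distrib sum_subtractf
            sum_negf sum_distrib_left mult.left_commute)
    qed
    show "(x *\<^sub>C (p o\<^sub>C\<^sub>L lin_comb \<sigma> s) + (p o\<^sub>C\<^sub>L bilin_comb \<gamma> \<xi> s)) o\<^sub>C\<^sub>L (x *\<^sub>C (p o\<^sub>C\<^sub>L lin_comb \<sigma> t) + (p o\<^sub>C\<^sub>L bilin_comb \<gamma> \<xi> t))
      = (x *\<^sub>C (p o\<^sub>C\<^sub>L lin_comb \<sigma> t) + (p o\<^sub>C\<^sub>L bilin_comb \<gamma> \<xi> t)) o\<^sub>C\<^sub>L (x *\<^sub>C (p o\<^sub>C\<^sub>L lin_comb \<sigma> s) + (p o\<^sub>C\<^sub>L bilin_comb \<gamma> \<xi> s))" for x s t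
      using pencil[of x s t] by (simp only: cblinfun_compose.add_right cblinfun_compose_scaleC)
  qed (fact \<epsilon> sym)+
qed

theorem theorem6p3:
  fixes A :: "'d::{finite,linorder} \<Rightarrow> ('h::chilbert_space \<Rightarrow>\<^sub>C\<^sub>L 'h)"
  assumes "separable_space (euclidean :: 'h topology)"
    and "\<And>j k. A j o\<^sub>C\<^sub>L A k = A k o\<^sub>C\<^sub>L A j"
    and "\<And>j. dissipative (A j)"
    and "dissipative_embedding_property TYPE('e::chilbert_space) A"
  shows "\<exists>(\<iota> :: 'h \<Rightarrow>\<^sub>C\<^sub>L ell2) \<rho>. commutative_unitary_dilation (generated_semigroup A) \<iota> \<rho>"
proof -
  obtain \<Phi> :: "'h \<Rightarrow>\<^sub>C\<^sub>L 'e" and \<sigma> \<gamma> \<gamma>s where "vessel A \<Phi> \<sigma> \<gamma> \<gamma>s" and VR: "VR_conditions \<sigma> \<gamma>"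
    and cone: "positive_cone \<sigma> \<noteq> {}" "\<And>j. axis j 1 \<in> closure (positive_cone \<sigma>)"
    using assms(4) unfolding dissipative_embedding_property_def by blast
  interpret vessel A \<Phi> \<sigma> \<gamma> \<gamma>s by fact
  have cone_coercive: "\<exists>\<epsilon>>0. \<forall>u. \<epsilon> * (norm u)\<^sup>2 \<le> Re (cinner (lin_comb \<sigma> \<xi> *\<^sub>V u) u)" if mem: "\<xi> \<in> positive_cone \<sigma>" for \<xi>
  proof -
    have "\<exists>\<epsilon>>0. pos_op (lin_comb \<sigma> \<xi> - \<epsilon> *\<^sub>R id_cblinfun)"
      using mem unfolding positive_cone_def lin_comb_def by (rule CollectD)
    then obtain \<epsilon> where \<epsilon>: "0 < \<epsilon>" "pos_op (lin_comb \<sigma> \<xi> - \<epsilon> *\<^sub>R id_cblinfun)"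
      by (elim exE conjE)
    have "\<epsilon> * (norm u)\<^sup>2 \<le> Re (cinner (lin_comb \<sigma> \<xi> *\<^sub>V u) u)" for u
    proof (cases "u = 0")
      case False
      then have "0 < cinner ((lin_comb \<sigma> \<xi> - \<epsilon> *\<^sub>R id_cblinfun) *\<^sub>V u) u"
        using \<epsilon>(2) by (simp add: pos_op_def)
      then have "0 < Re (cinner ((lin_comb \<sigma> \<xi> - \<epsilon> *\<^sub>R id_cblinfun) *\<^sub>V u) u)"
        by (simp only: less_complex_def zero_complex.sel)
      then show ?thesis
        by (simp add: cinner_simps cinner_self del: of_real_power)
    qed simp
    with \<epsilon>(1) show ?thesis by blast
  qed
  obtain \<xi> where "\<xi> \<in> positive_cone \<sigma>"
    using cone(1) by blast
  from cone_coercive[OF this] obtain \<epsilon> where \<epsilon>: "0 < \<epsilon>" "\<And>u. \<epsilon> * (norm u)\<^sup>2 \<le> Re (cinner (lin_comb \<sigma> \<xi> *\<^sub>V u) u)"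
    by blast
  obtain p where p: "\<And>u. lin_comb \<sigma> \<xi> *\<^sub>V p *\<^sub>V u = u" "\<And>u. p *\<^sub>V lin_comb \<sigma> \<xi> *\<^sub>V u = u"
    by (rule coercive_invertible[OF \<epsilon>]) (rule that)
  have p_id: "lin_comb \<sigma> \<xi> o\<^sub>C\<^sub>L p = id_cblinfun" "p o\<^sub>C\<^sub>L lin_comb \<sigma> \<xi> = id_cblinfun"
    by (rule cblinfun_eqI, simp add: p)+
  let ?N = "lin_comb (\<lambda>j. cadjoint (A j))"
  interpret dilation_data ?N \<Phi> "lin_comb \<sigma> \<xi>" "\<lambda>t. p o\<^sub>C\<^sub>L lin_comb \<sigma> t" "\<lambda>t. p o\<^sub>C\<^sub>L bilin_comb \<gamma> \<xi> t" \<xi> \<epsilon>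
    by (rule dilation_data_of_vessel[OF VR_commuting_pencil[OF VR \<gamma>_antisym p_id] p_id \<epsilon>])
  obtain \<iota> :: "'h \<Rightarrow>\<^sub>C\<^sub>L ell2" and \<rho> where \<iota>\<rho>: "isometry_op \<iota>" "unitary_representation \<rho>"
    and dil: "\<And>t x y. \<forall>u. 0 \<le> Re (cinner (lin_comb \<sigma> \<xi> *\<^sub>V (p o\<^sub>C\<^sub>L lin_comb \<sigma> t) *\<^sub>V u) u) \<Longrightarrow>
      cinner (\<rho> t *\<^sub>V \<iota> *\<^sub>V x) (\<iota> *\<^sub>V y) = cinner x (exp_op ((- \<i>) *\<^sub>C ?N t) *\<^sub>V y)"
    by (rule unitary_dilation[OF assms(1)]) (rule that)
  \<comment> \<open>For fixed \<open>u\<close> nonnegativity of the form is a closed condition on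
    the direction, so it passes from the cone to the basis vectors in its closure. Nonnegative
    combinations then give positivity of \<sigma> at every t of the orthant.\<close>
  have \<sigma>_nonneg: "0 \<le> Re (cinner (\<sigma> j *\<^sub>V u) u)" for j u
  proof -
    have lin: "linear (\<lambda>\<xi>. Re (cinner (lin_comb \<sigma> \<xi> *\<^sub>V u) u))"
      by (rule linearI) (simp_all add: linear_add[OF linear_lin_comb] linear_cmul[OF linear_lin_comb] cinner_simps)
    have "closure (positive_cone \<sigma>) \<subseteq> {\<xi>. 0 \<le> Re (cinner (lin_comb \<sigma> \<xi> *\<^sub>V u) u)}"
    proof (rule closure_minimal)
      show "positive_cone \<sigma> \<subseteq> {\<xi>. 0 \<le> Re (cinner (lin_comb \<sigma> \<xi> *\<^sub>V u) u)}"
      proof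
        fix \<zeta> assume "\<zeta> \<in> positive_cone \<sigma>"
        then obtain \<delta> where \<delta>: "0 < \<delta>" "\<delta> * (norm u)\<^sup>2 \<le> Re (cinner (lin_comb \<sigma> \<zeta> *\<^sub>V u) u)"
          using cone_coercive by blast
        from \<delta>(1) have "0 \<le> \<delta> * (norm u)\<^sup>2"
          by simp
        with \<delta>(2) show "\<zeta> \<in> {\<xi>. 0 \<le> Re (cinner (lin_comb \<sigma> \<xi> *\<^sub>V u) u)}"
          by (simp only: mem_Collect_eq)
      qed
      show "closed {\<xi>. 0 \<le> Re (cinner (lin_comb \<sigma> \<xi> *\<^sub>V u) u)}"
        using linear_continuous_on[of _ UNIV] lin
        by (intro closed_Collect_le) (auto simp: linear_conv_bounded_linear)
    qed
    then have "0 \<le> Re (cinner (lin_comb \<sigma> (axis j 1) *\<^sub>V u) u)"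
      using cone(2) by blast
    also have "lin_comb \<sigma> (axis j 1) *\<^sub>V u = (\<Sum>i\<in>UNIV. if i = j then \<sigma> i *\<^sub>V u else 0)"
      unfolding lin_comb_apply by (intro sum.cong refl) (simp add: axis_def)
    finally show ?thesis by simp
  qed
  have "cadjoint \<iota> o\<^sub>C\<^sub>L \<rho> t o\<^sub>C\<^sub>L \<iota> = generated_semigroup A t" if t: "\<forall>j. 0 \<le> t $ j" for t :: "real^('d::{finite,linorder})"
  proof (rule cblinfun_eqI, rule cinner_eqI)
    fix x y
    have pos: "\<forall>u. 0 \<le> Re (cinner (lin_comb \<sigma> \<xi> *\<^sub>V (p o\<^sub>C\<^sub>L lin_comb \<sigma> t) *\<^sub>V u) u)"
      using t by (simp add: p lin_comb_apply[of \<sigma> t] cinner_sum_left sum_nonneg \<sigma>_nonneg)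
    have "cinner ((cadjoint \<iota> o\<^sub>C\<^sub>L \<rho> t o\<^sub>C\<^sub>L \<iota>) *\<^sub>V x) y = cinner x (exp_op ((- \<i>) *\<^sub>C ?N t) *\<^sub>V y)"
      using dil[OF pos, of x y] by (simp add: cinner_cadjoint_left)
    \<comment> \<open>Moving the exponential to the left factor replaces the adjoints of the
      operators by the operators themselves and \<open>- \<i>\<close> by \<i>.\<close>
    also have "\<dots> = cinner (exp_op (\<i> *\<^sub>C lin_comb A t) *\<^sub>V x) y"
    proof (rule exp_op_adjoint[OF bounded_bilinear_cinner, symmetric])
      show "cinner ((\<i> *\<^sub>C lin_comb A t) *\<^sub>V x) y = cinner x (((- \<i>) *\<^sub>C ?N t) *\<^sub>V y)" for x y
        by (simp add: cinner_simps lin_comb_apply cinner_sum_left cinner_sum_right cinner_cadjoint)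
    qed
    finally show "cinner ((cadjoint \<iota> o\<^sub>C\<^sub>L \<rho> t o\<^sub>C\<^sub>L \<iota>) *\<^sub>V x) y = cinner (generated_semigroup A t *\<^sub>V x) y"
      by (simp add: generated_semigroup_def lin_comb_def)
  qed
  with \<iota>\<rho> show ?thesis
    unfolding commutative_unitary_dilation_def by blast
qed

end
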